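(* Let $\mathfrak g$ be a quasisimple regular Kac-Moody superalgebra with root system $\Delta$. Let $\alpha,\beta\in\Delta$ be such that $\alpha$ is real and non-isotropic. If $|\mathbb S(\beta,\alpha)\cap\Delta^{\mathrm{re}}|\ge1$, then there are non-negative integers $p,q,r$ such that, listing the elements of the root string $\mathbb S(\beta,\alpha)$ in the order of increasing $k$ (where the elements are written $\beta+k\alpha$), the string consists of $p$ real roots, followed by $q$ imaginary roots, followed by $r$ real roots. Moreover, if $q\neq0$, then $p=r$.
   Context: Kac-Moody superalgebras. All vector spaces are complex. Let $I=\{1,\dots,n\}$, $p:I\to\mathbb Z_2$ a parity function, and $A=(a_{ij})$ a complex $n\times n$ matrix, normalized so that $a_{ii}\in\{0,2\}$. Fix an even vector space $\mathfrak h$ of dimension $2n-\mathrm{rank}(A)$ and linearly independent $\alpha_i\in\mathfrak h^*$ and linearly independent $h_i\in\mathfrak h$ with $\alpha_j(h_i)=a_{ij}$. Let $\tilde{\mathfrak g}(A)$ be the Lie superalgebra generated by $\mathfrak h$ and $x_i^\pm$ ($i\in I$, $p(x_i^\pm)=p(i)$) with relations $[h,h']=0$, $[h,x_i^\pm]=\pm\alpha_i(h)x_i^\pm$, $[x_i^+,x_j^-]=\delta_{ij}h_i$; $\mathfrak g=\mathfrak g(A)$ is its quotient by the unique maximal ideal intersecting $\mathfrak h$ trivially. Then $\mathfrak g=\mathfrak h\oplus\bigoplus_{\alpha\in\Delta}\mathfrak g_\alpha$, where $\Delta\subset\mathfrak h^*\setminus\{0\}$ is the set of roots; each root is even or odd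 according to the parity of its root space. $\Pi=\{\alpha_i\}$. $\mathfrak g$ is quasisimple if every ideal $\mathfrak i$ satisfies $\mathfrak i\subseteq\mathfrak h$ or $\mathfrak i+\mathfrak h=\mathfrak g$; it is assumed that $A$ is non-zero and indecomposable. Bases, reflections, regularity. A base is a linearly independent $\Sigma\subseteq\Delta$ such that there are $x_\alpha^\pm\in\mathfrak g_{\pm\alpha}$ ($\alpha\in\Sigma$) which together with $\mathfrak h$ generate $\mathfrak g$ and satisfy $[x_\alpha^+,x_\beta^-]=0$ for $\alpha\ne\beta$ in $\Sigma$; put $h_\alpha=[x_\alpha^+,x_\alpha^-]$ and $A_\Sigma=(a_{\alpha\beta})$, $a_{\alpha\beta}=\beta(h_\alpha)$. $\Pi$ is a base. $A_\Sigma$ is regular if $a_{\alpha\beta}=0\Rightarrow a_{\beta\alpha}=0$ for all $\alpha,\beta\in\Sigma$; a matrix is admissible if all $\mathrm{ad}\,x^\pm$ for its Chevalley generators $x^\pm$ act locally nilpotently. For $\alpha\in\Sigma$ odd with $a_{\alpha\alpha}=0$, the odd reflection is $s_\alpha(\beta)=(-1)^{\delta_{\alpha,\beta}}\beta$ if $a_{\alpha\beta}=a_{\beta\alpha}=0$ and $s_\alpha(\beta)=\alpha+\beta$ otherwise ($\beta\in\Sigma$); under regularity $s_\alpha(\Sigma)$ is again a base. $\mathfrak g(A)$ is a regular Kac-Moody superalgebra if $A_\Sigma$ is regular and admissible for every base $\Sigma$ obtained from $\Pi$ by a sequence of odd reflections. An even root $\alpha$ is principal if $\alpha$ or $\alpha/2$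 lies in a base obtained from $\Pi$ by odd reflections; it has an associated $\mathfrak{sl}_2$-triple $x_\alpha^\pm,h_\alpha$ ($\alpha(h_\alpha)=2$) and the even reflection $s_\alpha(\lambda)=\lambda-\lambda(h_\alpha)\alpha$ on $\mathfrak h^*$. A root $\alpha$ is real if $\alpha$ or $\alpha/2$ lies in a base obtained from $\Pi$ by even and odd reflections, otherwise imaginary; $\Delta^{\mathrm{re}},\Delta^{\mathrm{im}}$ denote the sets of real and imaginary roots. For each real $\alpha$ one fixes $x_\alpha^\pm\in\mathfrak g_{\pm\alpha}$ with $h_\alpha=[x_\alpha^+,x_\alpha^-]\neq0$ and $\alpha(h_\alpha)\in\{0,2\}$; $\alpha$ is isotropic if $\alpha(h_\alpha)=0$ (such roots are odd) and non-isotropic if $\alpha(h_\alpha)=2$. Root strings. For $\alpha\in\Delta^{\mathrm{re}}$ and $\beta\in\Delta$, the $\alpha$-string through $\beta$ is $\mathbb S(\beta,\alpha)=\{\beta+k\alpha:k\in\mathbb Z\}\cap\Delta$. *)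

theory Defs
  imports
    "HOL-Analysis.Analysis"
    "HOL-Library.Function_Algebras"
    "HOL-Library.Poly_Mapping"
    "HOL-Library.Z2"
begin

section \<open>Lie superalgebras\<close>

text \<open>Parities live in \<^typ>\<open>bit\<close>, the field with two elements. The carrier of a Lie superalgebra is
  a whole type, and \<open>lpart L a\<close> is the homogeneous component of parity \<open>a\<close>.\<close>

record 'g superalg =
  lscale :: "complex \<Rightarrow> 'g \<Rightarrow> 'g"
  lbrk :: "'g \<Rightarrow> 'g \<Rightarrow> 'g"
  lpart :: "bit \<Rightarrow> 'g set"

definition ssign :: "bit \<Rightarrow> bit \<Rightarrow> complex" where
  "ssign a b = (if a = 1 \<and> b = 1 then - 1 else 1)"

locale lie_superalgebra =
  fixes L :: "('g::ab_group_add, 'z) superalg_scheme"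
  assumes vs: "vector_space (lscale L)"
    and part_subspace: "module.subspace (lscale L) (lpart L a)"
    and part_sum: "\<exists>y \<in> lpart L 0. \<exists>z \<in> lpart L 1. x = y + z"
    and part_Int: "lpart L 0 \<inter> lpart L 1 = {0}"
    and brk_add_left: "lbrk L (x + y) z = lbrk L x z + lbrk L y z"
    and brk_add_right: "lbrk L x (y + z) = lbrk L x y + lbrk L x z"
    and brk_scale_left: "lbrk L (lscale L c x) y = lscale L c (lbrk L x y)"
    and brk_scale_right: "lbrk L x (lscale L c y) = lscale L c (lbrk L x y)"
    and brk_part: "\<lbrakk>x \<in> lpart L a; y \<in> lpart L b\<rbrakk> \<Longrightarrow> lbrk L x y \<in> lpart L (a + b)"
    and skew: "\<lbrakk>x \<in> lpart L a; y \<in> lpart L b\<rbrakk>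
      \<Longrightarrow> lbrk L x y = - lscale L (ssign a b) (lbrk L y x)"
    and jacobi: "\<lbrakk>x \<in> lpart L a; y \<in> lpart L b\<rbrakk>
      \<Longrightarrow> lbrk L x (lbrk L y z)
          = lbrk L (lbrk L x y) z + lscale L (ssign a b) (lbrk L y (lbrk L x z))"

text \<open>Ideals of Lie superalgebras are graded; being graded, a left ideal is two-sided.\<close>

definition lie_ideal :: "('g::ab_group_add, 'z) superalg_scheme \<Rightarrow> 'g set \<Rightarrow> bool" where
  "lie_ideal L J \<longleftrightarrow>
     module.subspace (lscale L) J \<and>
     (\<forall>x \<in> J. \<exists>y \<in> J \<inter> lpart L 0. \<exists>z \<in> J \<inter> lpart L 1. x = y + z) \<and>
     (\<forall>x. \<forall>y \<in> J. lbrk L x y \<in> J)"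

inductive_set lie_generated :: "('g::ab_group_add, 'z) superalg_scheme \<Rightarrow> 'g set \<Rightarrow> 'g set"
  for L :: "('g::ab_group_add, 'z) superalg_scheme" and X :: "'g set" where
  gen: "x \<in> X \<Longrightarrow> x \<in> lie_generated L X"
| zero: "0 \<in> lie_generated L X"
| add: "x \<in> lie_generated L X \<Longrightarrow> y \<in> lie_generated L X \<Longrightarrow> x + y \<in> lie_generated L X"
| scale: "x \<in> lie_generated L X \<Longrightarrow> lscale L c x \<in> lie_generated L X"
| brk: "x \<in> lie_generated L X \<Longrightarrow> y \<in> lie_generated L X \<Longrightarrow> lbrk L x y \<in> lie_generated L X"

definition locally_nilpotent :: "('g::ab_group_add \<Rightarrow> 'g) \<Rightarrow> bool" where
  "locally_nilpotent f \<longleftrightarrow> (\<forall>z. \<exists>N. (f ^^ N) z = 0)"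

section \<open>Cartan data\<close>

text \<open>The index set \<open>I\<close> is a finite type, \<open>\<hh>\<close> is the type \<open>'h\<close> with scalar multiplication
  \<open>hscale D\<close>, and elements of \<open>\<hh>\<^sup>*\<close> are the linear maps \<open>'h \<Rightarrow> complex\<close>, with the pointwise
  operations.\<close>

record ('h, 'i::finite) cartan_datum =
  cmat :: "complex ^ 'i ^ 'i"
  cpar :: "'i \<Rightarrow> bit"
  hscale :: "complex \<Rightarrow> 'h \<Rightarrow> 'h"
  sroot :: "'i \<Rightarrow> 'h \<Rightarrow> complex"
  scoroot :: "'i \<Rightarrow> 'h"

definition dscale :: "complex \<Rightarrow> ('h \<Rightarrow> complex) \<Rightarrow> ('h \<Rightarrow> complex)" where
  "dscale c l = (\<lambda>h. c * l h)"

definition in_dual :: "('h::ab_group_add, 'i::finite) cartan_datum \<Rightarrow> ('h \<Rightarrow> complex) \<Rightarrow> bool" where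
  "in_dual D l \<longleftrightarrow> Vector_Spaces.linear (hscale D) (*) l"

text \<open>Since \<open>rank A \<le> n\<close> and \<open>n > 0\<close>, the prescribed dimension is positive, so \<open>\<hh>\<close> is in
  particular finite-dimensional (\<open>dim\<close> is 0 on infinite-dimensional spaces).\<close>

definition realization :: "('h::ab_group_add, 'i::finite) cartan_datum \<Rightarrow> bool" where
  "realization D \<longleftrightarrow>
     (\<forall>i. cmat D $ i $ i \<in> {0, 2}) \<and>
     vector_space (hscale D) \<and>
     vector_space.dim (hscale D) (UNIV :: 'h set) = 2 * CARD('i) - rank (cmat D) \<and>
     (\<forall>i. in_dual D (sroot D i)) \<and>
     inj (sroot D) \<and> \<not> module.dependent dscale (range (sroot D)) \<and>
     inj (scoroot D) \<and> \<not> module.dependent (hscale D) (range (scoroot D)) \<and>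
     (\<forall>i j. sroot D j (scoroot D i) = cmat D $ i $ j)"

definition indecomposable :: "complex ^ 'i ^ 'i \<Rightarrow> bool" where
  "indecomposable A \<longleftrightarrow>
     \<not> (\<exists>J. J \<noteq> {} \<and> J \<noteq> UNIV \<and> (\<forall>i \<in> J. \<forall>j \<in> - J. A $ i $ j = 0 \<and> A $ j $ i = 0))"

section \<open>Generators and relations\<close>

text \<open>The free nonassociative algebra on a set of generators consists of the finitely supported
  complex combinations of binary bracketings. The Lie superalgebra presented by a set of relations
  is its quotient by the ideal generated by super skew-symmetry, the super Jacobi identity, and the
  relations. Here \<open>\<hh>\<close> contributes one generator for each of its elements, so that its linear
  structure is part of the relations.\<close>

datatype ('h, 'i) generator = H 'h | XP 'i | XM 'i

datatype 'x magma = Gen 'x | Mul "'x magma" "'x magma"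

type_synonym 'x free_alg = "'x magma \<Rightarrow>\<^sub>0 complex"

definition fmono :: "'x magma \<Rightarrow> 'x free_alg" where
  "fmono u = Poly_Mapping.single u 1"

definition fscale :: "complex \<Rightarrow> 'x free_alg \<Rightarrow> 'x free_alg" where
  "fscale c f = Poly_Mapping.map ((*) c) f"

definition fmul :: "'x free_alg \<Rightarrow> 'x free_alg \<Rightarrow> 'x free_alg" where
  "fmul f g = (\<Sum>u \<in> Poly_Mapping.keys f. \<Sum>v \<in> Poly_Mapping.keys g.
     Poly_Mapping.single (Mul u v) (Poly_Mapping.lookup f u * Poly_Mapping.lookup g v))"

inductive_set free_ideal :: "'x free_alg set \<Rightarrow> 'x free_alg set" for S :: "'x free_alg set" where
  base: "f \<in> S \<Longrightarrow> f \<in> free_ideal S"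
| zero: "0 \<in> free_ideal S"
| add: "f \<in> free_ideal S \<Longrightarrow> g \<in> free_ideal S \<Longrightarrow> f + g \<in> free_ideal S"
| scale: "f \<in> free_ideal S \<Longrightarrow> fscale c f \<in> free_ideal S"
| mul_left: "f \<in> free_ideal S \<Longrightarrow> fmul g f \<in> free_ideal S"
| mul_right: "f \<in> free_ideal S \<Longrightarrow> fmul f g \<in> free_ideal S"

primrec magma_par :: "('x \<Rightarrow> bit) \<Rightarrow> 'x magma \<Rightarrow> bit" where
  "magma_par par (Gen x) = par x"
| "magma_par par (Mul u v) = magma_par par u + magma_par par v"

text \<open>By bilinearity it suffices to impose the Lie superalgebra axioms on bracketings.\<close>

definition lie_identities :: "('x \<Rightarrow> bit) \<Rightarrow> 'x free_alg set" where
  "lie_identities par =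
     {fmono (Mul u v) + fscale (ssign (magma_par par u) (magma_par par v)) (fmono (Mul v u)) | u v. True}
   \<union> {fmono (Mul u (Mul v w)) - fmono (Mul (Mul u v) w)
        - fscale (ssign (magma_par par u) (magma_par par v)) (fmono (Mul v (Mul u w))) | u v w. True}"

primrec gen_par :: "('h, 'i::finite) cartan_datum \<Rightarrow> ('h, 'i) generator \<Rightarrow> bit" where
  "gen_par D (H h) = 0"
| "gen_par D (XP i) = cpar D i"
| "gen_par D (XM i) = cpar D i"

definition defining_relations ::
    "('h::ab_group_add, 'i::finite) cartan_datum \<Rightarrow> ('h, 'i) generator free_alg set" where
  "defining_relations D =
     {fmono (Gen (H (h + h'))) - fmono (Gen (H h)) - fmono (Gen (H h')) | h h'. True}
   \<union> {fmono (Gen (H (hscale D c h))) - fscale c (fmono (Gen (H h))) | c h. True}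
   \<union> {fmono (Mul (Gen (H h)) (Gen (H h'))) | h h'. True}
   \<union> {fmono (Mul (Gen (H h)) (Gen (XP i))) - fscale (sroot D i h) (fmono (Gen (XP i))) | h i. True}
   \<union> {fmono (Mul (Gen (H h)) (Gen (XM i))) + fscale (sroot D i h) (fmono (Gen (XM i))) | h i. True}
   \<union> {fmono (Mul (Gen (XP i)) (Gen (XM i))) - fmono (Gen (H (scoroot D i))) | i. True}
   \<union> {fmono (Mul (Gen (XP i)) (Gen (XM j))) | i j. i \<noteq> j}"

text \<open>A Lie superalgebra together with the images of \<open>\<hh>\<close> and of the Chevalley generators.\<close>

record ('h, 'i, 'g) gen_superalg = "'g superalg" +
  hmap :: "'h \<Rightarrow> 'g"
  xpos :: "'i \<Rightarrow> 'g"
  xneg :: "'i \<Rightarrow> 'g"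

primrec gen_val :: "('h, 'i, 'g) gen_superalg \<Rightarrow> ('h, 'i) generator \<Rightarrow> 'g" where
  "gen_val L (H h) = hmap L h"
| "gen_val L (XP i) = xpos L i"
| "gen_val L (XM i) = xneg L i"

primrec magma_val :: "('h, 'i, 'g) gen_superalg \<Rightarrow> ('h, 'i) generator magma \<Rightarrow> 'g" where
  "magma_val L (Gen x) = gen_val L x"
| "magma_val L (Mul u v) = lbrk L (magma_val L u) (magma_val L v)"

definition free_val ::
    "('h, 'i, 'g::ab_group_add) gen_superalg \<Rightarrow> ('h, 'i) generator free_alg \<Rightarrow> 'g" where
  "free_val L f =
     (\<Sum>u \<in> Poly_Mapping.keys f. lscale L (Poly_Mapping.lookup f u) (magma_val L u))"

text \<open>\<open>L\<close> is (isomorphic to) the Lie superalgebra \<open>\<gg>~(A)\<close> given by generators and relations.\<close>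

definition tilde_superalgebra ::
    "('h::ab_group_add, 'i::finite) cartan_datum \<Rightarrow> ('h, 'i, 'g::ab_group_add) gen_superalg \<Rightarrow> bool" where
  "tilde_superalgebra D L \<longleftrightarrow>
     lie_superalgebra L \<and>
     (\<forall>x. gen_val L x \<in> lpart L (gen_par D x)) \<and>
     surj (free_val L) \<and>
     {f. free_val L f = 0} = free_ideal (lie_identities (gen_par D) \<union> defining_relations D)"

definition gen_hom ::
    "('h, 'i, 't::ab_group_add) gen_superalg \<Rightarrow> ('h, 'i, 'g::ab_group_add) gen_superalg
      \<Rightarrow> ('t \<Rightarrow> 'g) \<Rightarrow> bool" where
  "gen_hom T G \<phi> \<longleftrightarrow>
     Vector_Spaces.linear (lscale T) (lscale G) \<phi> \<and>
     (\<forall>x y. \<phi> (lbrk T x y) = lbrk G (\<phi> x) (\<phi> y)) \<and>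
     (\<forall>a. \<phi> ` lpart T a \<subseteq> lpart G a) \<and>
     (\<forall>x. \<phi> (gen_val T x) = gen_val G x)"

definition greatest_ideal_avoiding_cartan ::
    "('h, 'i, 't::ab_group_add) gen_superalg \<Rightarrow> 't set \<Rightarrow> bool" where
  "greatest_ideal_avoiding_cartan T K \<longleftrightarrow>
     lie_ideal T K \<and> K \<inter> range (hmap T) = {0} \<and>
     (\<forall>J. lie_ideal T J \<and> J \<inter> range (hmap T) = {0} \<longrightarrow> J \<subseteq> K)"

text \<open>\<open>G\<close> is (isomorphic to) \<open>\<gg>(A)\<close>, the quotient of \<open>T = \<gg>~(A)\<close>.\<close>

definition contragredient_superalgebra ::
    "('h::ab_group_add, 'i::finite) cartan_datum \<Rightarrow> ('h, 'i, 't::ab_group_add) gen_superalg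
      \<Rightarrow> ('h, 'i, 'g::ab_group_add) gen_superalg \<Rightarrow> bool" where
  "contragredient_superalgebra D T G \<longleftrightarrow>
     tilde_superalgebra D T \<and> lie_superalgebra G \<and>
     (\<exists>\<phi>. gen_hom T G \<phi> \<and> surj \<phi> \<and> greatest_ideal_avoiding_cartan T {x. \<phi> x = 0})"

definition quasisimple :: "('h, 'i, 'g::ab_group_add) gen_superalg \<Rightarrow> bool" where
  "quasisimple G \<longleftrightarrow>
     (\<forall>J. lie_ideal G J \<longrightarrow>
        J \<subseteq> range (hmap G) \<or> {x + y | x y. x \<in> J \<and> y \<in> range (hmap G)} = UNIV)"

section \<open>Roots\<close>

definition root_space ::
    "('h, 'i, 'g) gen_superalg \<Rightarrow> ('h \<Rightarrow> complex) \<Rightarrow> 'g set" where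
  "root_space G \<alpha> = {x. \<forall>h. lbrk G (hmap G h) x = lscale G (\<alpha> h) x}"

definition roots ::
    "('h::ab_group_add, 'i::finite) cartan_datum \<Rightarrow> ('h, 'i, 'g::ab_group_add) gen_superalg
      \<Rightarrow> ('h \<Rightarrow> complex) set" where
  "roots D G = {\<alpha>. in_dual D \<alpha> \<and> \<alpha> \<noteq> 0 \<and> root_space G \<alpha> \<noteq> {0}}"

definition has_parity :: "('h, 'i, 'g) gen_superalg \<Rightarrow> ('h \<Rightarrow> complex) \<Rightarrow> bit \<Rightarrow> bool" where
  "has_parity G \<alpha> a \<longleftrightarrow> root_space G \<alpha> \<subseteq> lpart G a"

text \<open>For \<open>x \<in> \<gg>\<^sub>\<alpha>\<close> and \<open>y \<in> \<gg>\<^sub>-\<^sub>\<alpha>\<close> the bracket lies in the image of \<open>\<hh>\<close>, on which \<open>hmap G\<close> is injective;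
  \<open>h_brk G x y\<close> is the corresponding element of \<open>\<hh>\<close>, so that roots can be evaluated on it.\<close>

definition h_brk :: "('h, 'i, 'g) gen_superalg \<Rightarrow> 'g \<Rightarrow> 'g \<Rightarrow> 'h" where
  "h_brk G x y = (THE h. hmap G h = lbrk G x y)"

section \<open>Bases and reflections\<close>

definition chevalley_system ::
    "('h::ab_group_add, 'i::finite) cartan_datum \<Rightarrow> ('h, 'i, 'g::ab_group_add) gen_superalg
      \<Rightarrow> ('h \<Rightarrow> complex) set \<Rightarrow> (('h \<Rightarrow> complex) \<Rightarrow> 'g) \<Rightarrow> (('h \<Rightarrow> complex) \<Rightarrow> 'g) \<Rightarrow> bool" where
  "chevalley_system D G \<Sigma> x y \<longleftrightarrow>
     (\<forall>\<alpha> \<in> \<Sigma>. x \<alpha> \<in> root_space G \<alpha> \<and> y \<alpha> \<in> root_space G (- \<alpha>)) \<and>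
     lie_generated G (range (hmap G) \<union> x ` \<Sigma> \<union> y ` \<Sigma>) = UNIV \<and>
     (\<forall>\<alpha> \<in> \<Sigma>. \<forall>\<beta> \<in> \<Sigma>. \<alpha> \<noteq> \<beta> \<longrightarrow> lbrk G (x \<alpha>) (y \<beta>) = 0)"

definition base_with ::
    "('h::ab_group_add, 'i::finite) cartan_datum \<Rightarrow> ('h, 'i, 'g::ab_group_add) gen_superalg
      \<Rightarrow> ('h \<Rightarrow> complex) set \<Rightarrow> (('h \<Rightarrow> complex) \<Rightarrow> 'g) \<Rightarrow> (('h \<Rightarrow> complex) \<Rightarrow> 'g) \<Rightarrow> bool" where
  "base_with D G \<Sigma> x y \<longleftrightarrow>
     \<Sigma> \<subseteq> roots D G \<and> \<not> module.dependent dscale \<Sigma> \<and> chevalley_system D G \<Sigma> x y"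

text \<open>The entry \<open>a\<^sub>\<alpha>\<^sub>\<beta> = \<beta>(h\<^sub>\<alpha>)\<close>. Another choice of the vectors \<open>x\<^sub>\<alpha>\<^sup>\<plusminus>\<close> only rescales
  the rows by nonzero numbers, and all conditions below are invariant under that.\<close>

definition cartan_entry ::
    "('h, 'i, 'g) gen_superalg \<Rightarrow> (('h \<Rightarrow> complex) \<Rightarrow> 'g) \<Rightarrow> (('h \<Rightarrow> complex) \<Rightarrow> 'g)
      \<Rightarrow> ('h \<Rightarrow> complex) \<Rightarrow> ('h \<Rightarrow> complex) \<Rightarrow> complex" where
  "cartan_entry G x y \<alpha> \<beta> = \<beta> (h_brk G (x \<alpha>) (y \<alpha>))"

definition regular_matrix :: "'r set \<Rightarrow> ('r \<Rightarrow> 'r \<Rightarrow> complex) \<Rightarrow> bool" where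
  "regular_matrix \<Sigma> a \<longleftrightarrow> (\<forall>\<alpha> \<in> \<Sigma>. \<forall>\<beta> \<in> \<Sigma>. a \<alpha> \<beta> = 0 \<longrightarrow> a \<beta> \<alpha> = 0)"

definition admissible_matrix ::
    "('h, 'i, 'g::ab_group_add) gen_superalg \<Rightarrow> ('h \<Rightarrow> complex) set
      \<Rightarrow> (('h \<Rightarrow> complex) \<Rightarrow> 'g) \<Rightarrow> (('h \<Rightarrow> complex) \<Rightarrow> 'g) \<Rightarrow> bool" where
  "admissible_matrix G \<Sigma> x y \<longleftrightarrow>
     (\<forall>\<alpha> \<in> \<Sigma>. locally_nilpotent (lbrk G (x \<alpha>)) \<and> locally_nilpotent (lbrk G (y \<alpha>)))"

definition odd_reflection ::
    "('r \<Rightarrow> 'r \<Rightarrow> complex) \<Rightarrow> 'r \<Rightarrow> 'r \<Rightarrow> 'r::ab_group_add" where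
  "odd_reflection a \<alpha> \<beta> =
     (if a \<alpha> \<beta> = 0 \<and> a \<beta> \<alpha> = 0 then (if \<alpha> = \<beta> then - \<beta> else \<beta>) else \<alpha> + \<beta>)"

definition odd_reflects_to ::
    "('h::ab_group_add, 'i::finite) cartan_datum \<Rightarrow> ('h, 'i, 'g::ab_group_add) gen_superalg
      \<Rightarrow> ('h \<Rightarrow> complex) set \<Rightarrow> ('h \<Rightarrow> complex) set \<Rightarrow> bool" where
  "odd_reflects_to D G \<Sigma> \<Sigma>' \<longleftrightarrow>
     (\<exists>x y. \<exists>\<alpha> \<in> \<Sigma>. base_with D G \<Sigma> x y \<and> has_parity G \<alpha> 1 \<and> cartan_entry G x y \<alpha> \<alpha> = 0 \<and>
        \<Sigma>' = odd_reflection (cartan_entry G x y) \<alpha> ` \<Sigma>)"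

inductive_set odd_bases ::
    "('h::ab_group_add, 'i::finite) cartan_datum \<Rightarrow> ('h, 'i, 'g::ab_group_add) gen_superalg
      \<Rightarrow> ('h \<Rightarrow> complex) set set"
  for D :: "('h::ab_group_add, 'i::finite) cartan_datum" and G :: "('h, 'i, 'g::ab_group_add) gen_superalg"
  where
  initial: "range (sroot D) \<in> odd_bases D G"
| odd: "\<Sigma> \<in> odd_bases D G \<Longrightarrow> odd_reflects_to D G \<Sigma> \<Sigma>' \<Longrightarrow> \<Sigma>' \<in> odd_bases D G"

definition regular_kac_moody ::
    "('h::ab_group_add, 'i::finite) cartan_datum \<Rightarrow> ('h, 'i, 'g::ab_group_add) gen_superalg \<Rightarrow> bool" where
  "regular_kac_moody D G \<longleftrightarrow>
     (\<forall>\<Sigma> \<in> odd_bases D G. \<forall>x y. base_with D G \<Sigma> x y \<longrightarrow>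
        regular_matrix \<Sigma> (cartan_entry G x y) \<and> admissible_matrix G \<Sigma> x y)"

definition principal_roots ::
    "('h::ab_group_add, 'i::finite) cartan_datum \<Rightarrow> ('h, 'i, 'g::ab_group_add) gen_superalg
      \<Rightarrow> ('h \<Rightarrow> complex) set" where
  "principal_roots D G =
     {\<alpha> \<in> roots D G. has_parity G \<alpha> 0 \<and> (\<exists>\<Sigma> \<in> odd_bases D G. \<alpha> \<in> \<Sigma> \<or> dscale (1/2) \<alpha> \<in> \<Sigma>)}"

text \<open>\<open>h\<close> is the element \<open>h\<^sub>\<alpha>\<close> of an \<open>sl\<^sub>2\<close>-triple \<open>x\<^sub>\<alpha>\<^sup>\<plusminus>, h\<^sub>\<alpha>\<close> with \<open>\<alpha>(h\<^sub>\<alpha>) = 2\<close>.\<close>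

definition sl2_coroot ::
    "('h, 'i, 'g) gen_superalg \<Rightarrow> ('h \<Rightarrow> complex) \<Rightarrow> 'h \<Rightarrow> bool" where
  "sl2_coroot G \<alpha> h \<longleftrightarrow>
     (\<exists>x \<in> root_space G \<alpha>. \<exists>y \<in> root_space G (- \<alpha>). h = h_brk G x y \<and> \<alpha> h = 2)"

definition even_reflection ::
    "('h \<Rightarrow> complex) \<Rightarrow> 'h \<Rightarrow> ('h \<Rightarrow> complex) \<Rightarrow> ('h \<Rightarrow> complex)" where
  "even_reflection \<alpha> h l = l - dscale (l h) \<alpha>"

inductive_set all_bases ::
    "('h::ab_group_add, 'i::finite) cartan_datum \<Rightarrow> ('h, 'i, 'g::ab_group_add) gen_superalg
      \<Rightarrow> ('h \<Rightarrow> complex) set set"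
  for D :: "('h::ab_group_add, 'i::finite) cartan_datum" and G :: "('h, 'i, 'g::ab_group_add) gen_superalg"
  where
  initial: "range (sroot D) \<in> all_bases D G"
| odd: "\<Sigma> \<in> all_bases D G \<Longrightarrow> odd_reflects_to D G \<Sigma> \<Sigma>' \<Longrightarrow> \<Sigma>' \<in> all_bases D G"
| even: "\<Sigma> \<in> all_bases D G \<Longrightarrow> \<alpha> \<in> principal_roots D G \<Longrightarrow> sl2_coroot G \<alpha> h
     \<Longrightarrow> even_reflection \<alpha> h ` \<Sigma> \<in> all_bases D G"

definition real_roots ::
    "('h::ab_group_add, 'i::finite) cartan_datum \<Rightarrow> ('h, 'i, 'g::ab_group_add) gen_superalg
      \<Rightarrow> ('h \<Rightarrow> complex) set" where
  "real_roots D G = {\<alpha> \<in> roots D G. \<exists>\<Sigma> \<in> all_bases D G. \<alpha> \<in> \<Sigma> \<or> dscale (1/2) \<alpha> \<in> \<Sigma>}"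

definition imaginary_roots ::
    "('h::ab_group_add, 'i::finite) cartan_datum \<Rightarrow> ('h, 'i, 'g::ab_group_add) gen_superalg
      \<Rightarrow> ('h \<Rightarrow> complex) set" where
  "imaginary_roots D G = roots D G - real_roots D G"

text \<open>For a real root the root spaces of \<open>\<plusminus>\<alpha>\<close> are one-dimensional, so whether the normalized value
  \<open>\<alpha>(h\<^sub>\<alpha>)\<close> is 0 or 2 does not depend on the choice of \<open>x\<^sub>\<alpha>\<^sup>\<plusminus>\<close>.\<close>

definition non_isotropic :: "('h, 'i, 'g::zero) gen_superalg \<Rightarrow> ('h \<Rightarrow> complex) \<Rightarrow> bool" where
  "non_isotropic G \<alpha> \<longleftrightarrow>
     (\<exists>x \<in> root_space G \<alpha>. \<exists>y \<in> root_space G (- \<alpha>). lbrk G x y \<noteq> 0 \<and> \<alpha> (h_brk G x y) = 2)"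

definition string_element ::
    "('h \<Rightarrow> complex) \<Rightarrow> ('h \<Rightarrow> complex) \<Rightarrow> int \<Rightarrow> ('h \<Rightarrow> complex)" where
  "string_element \<beta> \<alpha> k = \<beta> + dscale (of_int k) \<alpha>"

definition root_string ::
    "('h::ab_group_add, 'i::finite) cartan_datum \<Rightarrow> ('h, 'i, 'g::ab_group_add) gen_superalg
      \<Rightarrow> ('h \<Rightarrow> complex) \<Rightarrow> ('h \<Rightarrow> complex) \<Rightarrow> ('h \<Rightarrow> complex) set" where
  "root_string D G \<beta> \<alpha> = {string_element \<beta> \<alpha> k | k. True} \<inter> roots D G"

end

(*
  Every base arises from an odd-reflected base by a product of principal reflections, each of which
  lifts to an automorphism exp(ad e) exp(-ad f) exp(ad e). In each base all roots are non-negative or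
  non-positive integral combinations, and a reflection in a simple root changes the sign only of
  multiples of that root. Hence an imaginary root has the same sign with respect to all bases. A real
  root changes sign, since the negative of a simple root lies in some base; this needs that even
  simple roots are not isotropic, which follows from quasisimplicity. So an element of the string that
  lies between two imaginary roots of equal sign is imaginary. The reflection in alpha reverses the
  string and preserves real roots, imaginary roots and signs of imaginary roots; applied to an
  imaginary root and its mirror image, this shows that the imaginary roots form a symmetric interval.
*)
theory Submission
  imports Defs
begin

text \<open>The hypotheses cover few bases and the conclusion many: regularity and admissibility are
  given for bases reached by odd reflections, while real roots refer to all bases. What is needed
  elsewhere is transported by the automorphisms, which preserve Cartan entries and parities. The
  sign of an imaginary root is followed through one nonzero coordinate away from the reflected
  simple root. It exists because roots that are multiples of a simple root are real, and the
  reflection leaves it unchanged. Generators and relations hide even the injectivity of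
  \<open>hmap\<close>, without which roots cannot be evaluated on brackets; a representation on
  functions of words supplies it. Integral coordinates come from a triangular decomposition for
  arbitrary Chevalley vectors, and vanishing of brackets comes from maximality of the ideal divided
  out. An even isotropic simple root would give a Heisenberg triple: local nilpotency makes its
  centre act by zero, regularity makes the triple span an ideal, and quasisimplicity then forces a
  zero Cartan matrix.\<close>

declare add_bit_eq_xor [simp del] mult_bit_eq_and [simp del]

lemma bit_add_self [simp]: "a + a = (0::bit)"
  by (cases a) (simp_all add: add_bit_eq_xor)

lemma bit_add_self_left [simp]: "a + (a + b) = (b::bit)"
  by (simp add: add.assoc[symmetric])

section \<open>Evaluation of the free algebra\<close>

text \<open>\<open>free_val\<close> and the scalar functionals of the word representation are both
  of this form, so linearity and products are treated once.\<close>

definition lin_ext :: "(complex \<Rightarrow> 'v \<Rightarrow> 'v) \<Rightarrow> ('x magma \<Rightarrow> 'v::ab_group_add) \<Rightarrow> 'x free_alg \<Rightarrow> 'v" where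
  "lin_ext s \<phi> f = (\<Sum>u \<in> Poly_Mapping.keys f. s (Poly_Mapping.lookup f u) (\<phi> u))"

lemma lookup_fscale: "Poly_Mapping.lookup (fscale c f) u = c * Poly_Mapping.lookup f u"
  by (simp add: fscale_def Poly_Mapping.map.rep_eq when_def)

locale complex_vector_space = vector_space scale for scale :: "complex \<Rightarrow> 'v::ab_group_add \<Rightarrow> 'v"
begin

lemma lin_ext_superset:
  assumes "finite S" "Poly_Mapping.keys f \<subseteq> S"
  shows "lin_ext scale \<phi> f = (\<Sum>u \<in> S. scale (Poly_Mapping.lookup f u) (\<phi> u))"
  unfolding lin_ext_def
  by (rule sum.mono_neutral_left) (use assms in \<open>auto simp: in_keys_iff\<close>)

lemma lin_ext_add: "lin_ext scale \<phi> (f + g) = lin_ext scale \<phi> f + lin_ext scale \<phi> g"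
proof -
  let ?S = "Poly_Mapping.keys f \<union> Poly_Mapping.keys g"
  have "Poly_Mapping.keys (f + g) \<subseteq> ?S" by (rule Poly_Mapping.keys_add)
  then show ?thesis
    by (simp add: lin_ext_superset[of ?S] lookup_add scale_left_distrib sum.distrib)
qed

lemma lin_ext_scale: "lin_ext scale \<phi> (fscale c f) = scale c (lin_ext scale \<phi> f)"
proof -
  have "Poly_Mapping.keys (fscale c f) \<subseteq> Poly_Mapping.keys f"
    by (auto simp: in_keys_iff lookup_fscale)
  then show ?thesis
    by (simp add: lin_ext_superset[of "Poly_Mapping.keys f"] lookup_fscale scale_sum_right)
qed

lemma lin_ext_zero [simp]: "lin_ext scale \<phi> 0 = 0"
  by (simp add: lin_ext_def)

lemma lin_ext_single [simp]: "lin_ext scale \<phi> (Poly_Mapping.single u c) = scale c (\<phi> u)"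
  by (simp add: lin_ext_def)

lemma lin_ext_fmono [simp]: "lin_ext scale \<phi> (fmono u) = \<phi> u"
  by (simp add: fmono_def)

lemma lin_ext_diff: "lin_ext scale \<phi> (f - g) = lin_ext scale \<phi> f - lin_ext scale \<phi> g"
  using lin_ext_add[of \<phi> "f - g" g] by (simp add: algebra_simps)

lemma lin_ext_sum: "lin_ext scale \<phi> (sum f S) = (\<Sum>i\<in>S. lin_ext scale \<phi> (f i))"
  by (induction S rule: infinite_finite_induct) (simp_all add: lin_ext_add)

lemma lin_ext_fmul:
  "lin_ext scale \<phi> (fmul f g) = lin_ext scale (\<lambda>u. lin_ext scale (\<lambda>v. \<phi> (Mul u v)) g) f"
  by (simp add: fmul_def lin_ext_sum) (simp add: lin_ext_def scale_sum_right)

text \<open>The double sum in the other order. Ideals are closed under multiplication on both sides,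
  and each side needs the fixed factor in the outer sum.\<close>

lemma lin_ext_fmul':
  "lin_ext scale \<phi> (fmul f g) = lin_ext scale (\<lambda>v. lin_ext scale (\<lambda>u. \<phi> (Mul u v)) f) g"
  unfolding lin_ext_fmul unfolding lin_ext_def scale_sum_right
  by (subst sum.swap) (simp add: mult.commute)

lemma lin_ext_zero_fun [simp]: "lin_ext scale (\<lambda>u. 0) f = 0"
  by (simp add: lin_ext_def)

end

interpretation cmult: complex_vector_space "(*)"
  by (simp add: complex_vector_space_def vector_space_over_itself.vector_space_axioms)

section \<open>A representation on functions of words\<close>

text \<open>This is the dual of a Verma-type module with highest weight \<open>l\<close>: \<open>x\<^sub>i\<^sup>+\<close> deletes the first letter, and
  the recursion for \<open>x\<^sub>i\<^sup>-\<close> is forced by \<open>[x\<^sub>j\<^sup>+, x\<^sub>i\<^sup>-] = \<delta>\<^sub>i\<^sub>j h\<^sub>i\<close>. As \<open>l\<close> is arbitrary, \<open>\<hh>\<close> embeds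
  into the Lie superalgebra given by generators and relations.\<close>

primrec word_weight :: "('h::ab_group_add, 'i::finite) cartan_datum \<Rightarrow> 'i list \<Rightarrow> 'h \<Rightarrow> complex" where
  "word_weight D [] h = 0"
| "word_weight D (j # w) h = sroot D j h + word_weight D w h"

text \<open>\<open>neg_op D l i w f\<close> is the value of x_i^- f at \<open>w\<close>. The value
  at \<open>j # w\<close> is that of x_j^+ x_i^- f at \<open>w\<close>, which gives the second
  clause; at the empty word, which carries the highest weight, a lowering operator contributes
  nothing.\<close>

primrec neg_op :: "('h::ab_group_add, 'i::finite) cartan_datum \<Rightarrow> ('h \<Rightarrow> complex) \<Rightarrow> 'i
    \<Rightarrow> 'i list \<Rightarrow> ('i list \<Rightarrow> complex) \<Rightarrow> complex" where
  "neg_op D l i [] = (\<lambda>f. 0)"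
| "neg_op D l i (j # w) = (\<lambda>f. ssign (cpar D i) (cpar D j) * neg_op D l i w (\<lambda>u. f (j # u))
     + (if i = j then (l (scoroot D i) - word_weight D w (scoroot D i)) * f w else 0))"

primrec gen_op :: "('h::ab_group_add, 'i::finite) cartan_datum \<Rightarrow> ('h \<Rightarrow> complex) \<Rightarrow> ('h, 'i) generator
    \<Rightarrow> ('i list \<Rightarrow> complex) \<Rightarrow> 'i list \<Rightarrow> complex" where
  "gen_op D l (H h) = (\<lambda>f w. (l h - word_weight D w h) * f w)"
| "gen_op D l (XP i) = (\<lambda>f w. f (i # w))"
| "gen_op D l (XM i) = (\<lambda>f w. neg_op D l i w f)"

primrec magma_op :: "('h::ab_group_add, 'i::finite) cartan_datum \<Rightarrow> ('h \<Rightarrow> complex)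
    \<Rightarrow> ('h, 'i) generator magma \<Rightarrow> ('i list \<Rightarrow> complex) \<Rightarrow> 'i list \<Rightarrow> complex" where
  "magma_op D l (Gen x) = gen_op D l x"
| "magma_op D l (Mul u v) = (\<lambda>f w. magma_op D l u (magma_op D l v f) w
     - ssign (magma_par (gen_par D) u) (magma_par (gen_par D) v)
         * magma_op D l v (magma_op D l u f) w)"

definition op_linear :: "(('a \<Rightarrow> complex) \<Rightarrow> 'a \<Rightarrow> complex) \<Rightarrow> bool" where
  "op_linear A \<longleftrightarrow> (\<forall>f g. A (\<lambda>w. f w + g w) = (\<lambda>w. A f w + A g w)) \<and>
     (\<forall>c f. A (\<lambda>w. c * f w) = (\<lambda>w. c * A f w))"

lemma op_linear_add: "op_linear A \<Longrightarrow> A (\<lambda>w. f w + g w) = (\<lambda>w. A f w + A g w)"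
  and op_linear_scale: "op_linear A \<Longrightarrow> A (\<lambda>w. c * f w) = (\<lambda>w. c * A f w)"
  by (auto simp: op_linear_def)

lemma op_linear_diff: "op_linear A \<Longrightarrow> A (\<lambda>w. f w - g w) = (\<lambda>w. A f w - A g w)"
  using op_linear_add[of A f "\<lambda>w. (-1) * g w"] op_linear_scale[of A "-1" g] by simp

lemma op_linear_sum:
  assumes "op_linear A"
  shows "A (\<lambda>w. \<Sum>i\<in>S. c i * f i w) = (\<lambda>w. \<Sum>i\<in>S. c i * A (f i) w)"
proof (induction S rule: infinite_finite_induct)
  case (insert i S)
  then show ?case
    by (simp add: op_linear_add[OF assms, of "\<lambda>w. c i * f i w"] op_linear_scale[OF assms])
qed (use op_linear_scale[OF assms, of 0 "\<lambda>_. 0"] in simp_all)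

lemma op_linear_neg: "op_linear (\<lambda>f w. neg_op D l i w f)"
proof -
  have "neg_op D l i w (\<lambda>w. f w + g w) = neg_op D l i w f + neg_op D l i w g" for w f g
    by (induction w arbitrary: f g) (simp_all add: algebra_simps)
  moreover have "neg_op D l i w (\<lambda>w. c * f w) = c * neg_op D l i w f" for w f c
    by (induction w arbitrary: f) (simp_all add: algebra_simps)
  ultimately show ?thesis by (simp add: op_linear_def)
qed

lemma op_linear_magma: "op_linear (magma_op D l u)"
proof (induction u)
  case (Gen x)
  have "op_linear (gen_op D l x)"
    using op_linear_neg[of D l] by (cases x) (simp_all add: op_linear_def algebra_simps)
  then show ?case by simp
next
  case (Mul u v)
  then show ?case
    by (simp add: op_linear_def algebra_simps)
qed

lemma ssign_mult: "ssign a (b + c) = ssign a b * ssign a c"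
  by (cases a; cases b; cases c) (simp_all add: ssign_def)

lemma ssign_commute: "ssign a b = ssign b a"
  by (auto simp: ssign_def)

lemma ssign_square [simp]: "ssign a b * ssign a b = 1"
  by (auto simp: ssign_def)

lemma ssign_square' [simp]: "ssign a b * (ssign a b * z) = z"
  by (auto simp: ssign_def)

text \<open>The relation [h, x_i^-] = -\<alpha>_i(h) x_i^- for the word operators. As x_i^- is
  defined by recursion, this takes an induction on the word; the other relations hold by
  unfolding.\<close>

lemma neg_op_weight:
  "(l h - word_weight D w h) * neg_op D l i w f
     = neg_op D l i w (\<lambda>u. (l h - word_weight D u h) * f u) - sroot D i h * neg_op D l i w f"
proof (induction w arbitrary: f)
  case (Cons j w)
  have lin: "neg_op D l i w (\<lambda>u. (l h - (sroot D j h + word_weight D u h)) * f (j # u))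
     = neg_op D l i w (\<lambda>u. (l h - word_weight D u h) * f (j # u))
         - sroot D j h * neg_op D l i w (\<lambda>u. f (j # u))"
    using fun_cong[OF op_linear_diff[OF op_linear_neg[of D l i],
          of "\<lambda>u. (l h - word_weight D u h) * f (j # u)" "\<lambda>u. sroot D j h * f (j # u)"], of w]
      fun_cong[OF op_linear_scale[OF op_linear_neg[of D l i], of "sroot D j h" "\<lambda>u. f (j # u)"], of w]
    by (simp add: algebra_simps)
  have IH: "(l h - word_weight D w h) * neg_op D l i w (\<lambda>u. f (j # u))
     = neg_op D l i w (\<lambda>u. (l h - word_weight D u h) * f (j # u))
       - sroot D i h * neg_op D l i w (\<lambda>u. f (j # u))"
    by (rule Cons.IH)
  then have IH: "neg_op D l i w (\<lambda>u. (l h - word_weight D u h) * f (j # u))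
     = (l h - word_weight D w h) * neg_op D l i w (\<lambda>u. f (j # u))
       + sroot D i h * neg_op D l i w (\<lambda>u. f (j # u))"
    by simp
  show ?case
    unfolding neg_op.simps word_weight.simps lin IH by (simp add: algebra_simps)
qed simp

text \<open>Both parity components are evaluated separately because the sign in the supercommutator
  depends on the parity, so that the kernel of the total evaluation is not obviously an ideal.\<close>

definition op_ext where
  "op_ext D l a f w F = lin_ext (*) (\<lambda>u. if magma_par (gen_par D) u = a then magma_op D l u f w else 0) F"

lemma op_ext_add: "op_ext D l a f w (F + F') = op_ext D l a f w F + op_ext D l a f w F'"
  and op_ext_diff: "op_ext D l a f w (F - F') = op_ext D l a f w F - op_ext D l a f w F'"
  and op_ext_fscale: "op_ext D l a f w (fscale c F) = c * op_ext D l a f w F"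
  and op_ext_zero: "op_ext D l a f w 0 = 0"
  and op_ext_fmono: "op_ext D l a f w (fmono u)
     = (if magma_par (gen_par D) u = a then magma_op D l u f w else 0)"
  by (simp_all add: op_ext_def cmult.lin_ext_add cmult.lin_ext_diff cmult.lin_ext_scale)

lemma bit_cancel: "(a + b = (c::bit)) \<longleftrightarrow> b = c + a"
  by (metis add.commute bit_add_self_left)

text \<open>On the part of \<open>F\<close> of parity \<open>b\<close> the sign \<open>c\<close> of
  the supercommutator with \<open>u\<close> is constant. The sum over bracketings can then be moved
  past \<open>magma_op D l u\<close> on either side, and that part already acts as zero.\<close>

lemma op_ext_compose:
  assumes "\<And>a f w. op_ext D l a f w F = 0"
  shows "lin_ext (*) (\<lambda>v. if magma_par (gen_par D) v = b
            then magma_op D l u (magma_op D l v f) w - c * magma_op D l v (magma_op D l u f) w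
            else 0) F = 0"
proof -
  let ?p = "magma_par (gen_par D)" and ?K = "Poly_Mapping.keys F"
  let ?c = "\<lambda>v. if ?p v = b then Poly_Mapping.lookup F v else 0"
  have 1: "(\<lambda>w. \<Sum>v\<in>?K. ?c v * magma_op D l v f w) = (\<lambda>w. 0)"
  proof
    fix w show "(\<Sum>v\<in>?K. ?c v * magma_op D l v f w) = 0"
      using assms[of b f w] by (simp add: op_ext_def lin_ext_def if_distrib if_distribR cong: if_cong)
  qed
  have "magma_op D l u (\<lambda>w. \<Sum>v\<in>?K. ?c v * magma_op D l v f w) w = 0"
    unfolding 1 using op_linear_scale[OF op_linear_magma, of D l u 0 "\<lambda>_. 0"] by simp
  then have 2: "(\<Sum>v\<in>?K. ?c v * magma_op D l u (magma_op D l v f) w) = 0"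
    unfolding op_linear_sum[OF op_linear_magma] .
  have 3: "(\<Sum>v\<in>?K. ?c v * magma_op D l v (magma_op D l u f) w) = 0"
    using assms[of b "magma_op D l u f" w]
    by (simp add: op_ext_def lin_ext_def if_distrib if_distribR cong: if_cong)
  have "lin_ext (*) (\<lambda>v. if ?p v = b
            then magma_op D l u (magma_op D l v f) w - c * magma_op D l v (magma_op D l u f) w
            else 0) F
     = (\<Sum>v\<in>?K. ?c v * magma_op D l u (magma_op D l v f) w)
     - c * (\<Sum>v\<in>?K. ?c v * magma_op D l v (magma_op D l u f) w)"
    unfolding lin_ext_def sum_distrib_left sum_subtractf[symmetric]
    by (rule sum.cong) (auto simp: algebra_simps)
  then show ?thesis using 2 3 by simp
qed

lemma op_ext_free_ideal:
  assumes "F \<in> free_ideal S" "\<And>F a f w. F \<in> S \<Longrightarrow> op_ext D l a f w F = 0"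
  shows "op_ext D l a f w F = 0"
  using assms(1)
proof (induction arbitrary: a f w)
  case (base F)
  then show ?case by (rule assms(2))
next
  case zero
  show ?case by (rule op_ext_zero)
next
  case (add F F')
  then show ?case by (simp add: op_ext_add)
next
  case (scale F c)
  then show ?case by (simp add: op_ext_fscale)
next
  case (mul_left F E)
  let ?p = "magma_par (gen_par D)"
  have *: "lin_ext (*) (\<lambda>v. if ?p (Mul u v) = a then magma_op D l (Mul u v) f w else 0) F = 0" for u
  proof -
    have "(\<lambda>v. if ?p (Mul u v) = a then magma_op D l (Mul u v) f w else 0)
      = (\<lambda>v. if ?p v = a + ?p u then magma_op D l u (magma_op D l v f) w
           - ssign (?p u) (a + ?p u) * magma_op D l v (magma_op D l u f) w else 0)"
      by (rule ext) (simp only: magma_par.simps bit_cancel magma_op.simps cong: if_cong)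
    then show ?thesis
      using op_ext_compose[OF mul_left.IH] by simp
  qed
  show ?case unfolding op_ext_def cmult.lin_ext_fmul * by simp
next
  case (mul_right F E)
  let ?p = "magma_par (gen_par D)"
  have *: "lin_ext (*) (\<lambda>u. if ?p (Mul u v) = a then magma_op D l (Mul u v) f w else 0) F = 0" for v
  proof -
    let ?b = "a + ?p v"
    \<comment> \<open>Writing [u, v] as minus the sign times [v, u] puts the fixed factor first, as
      \<open>op_ext_compose\<close> expects.\<close>
    have "(\<lambda>u. if ?p (Mul u v) = a then magma_op D l (Mul u v) f w else 0)
      = (\<lambda>u. - ssign (?p v) ?b * (if ?p u = ?b then magma_op D l v (magma_op D l u f) w
           - ssign (?p v) ?b * magma_op D l u (magma_op D l v f) w else 0))"
      by (rule ext) (simp only: magma_par.simps add.commute[of _ "?p v"] bit_cancel magma_op.simps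
          ssign_commute[of _ "?p v"] cong: if_cong, simp add: right_diff_distrib)
    moreover have "lin_ext (*) (\<lambda>u. c * \<phi> u) F = c * lin_ext (*) \<phi> F" for c and \<phi> :: "_ \<Rightarrow> complex"
      by (simp add: lin_ext_def sum_distrib_left algebra_simps)
    ultimately show ?thesis
      by (simp only: op_ext_compose[OF mul_right.IH] mult_zero_right)
  qed
  show ?case unfolding op_ext_def cmult.lin_ext_fmul' * by simp
qed

lemma magma_op_diff: "magma_op D l u (\<lambda>w. f w - g w) w = magma_op D l u f w - magma_op D l u g w"
  and magma_op_scale: "magma_op D l u (\<lambda>w. c * f w) w = c * magma_op D l u f w"
  using op_linear_diff[OF op_linear_magma, of D l u] op_linear_scale[OF op_linear_magma, of D l u]
  by (auto dest: fun_cong)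

text \<open>Supercommutators in an associative superalgebra satisfy both identities; the equations
  \<open>s\<close> below express that the sign is a symmetric bicharacter on parities.\<close>

lemma op_ext_identities:
  assumes "F \<in> lie_identities (gen_par D)"
  shows "op_ext D l a f w F = 0"
proof -
  let ?p = "magma_par (gen_par D)"
  consider (skew) u v where "F = fmono (Mul u v) + fscale (ssign (?p u) (?p v)) (fmono (Mul v u))"
    | (jac) u v t where "F = fmono (Mul u (Mul v t)) - fmono (Mul (Mul u v) t)
        - fscale (ssign (?p u) (?p v)) (fmono (Mul v (Mul u t)))"
    using assms unfolding lie_identities_def by blast
  then show ?thesis
  proof cases
    case skew
    then show ?thesis
      by (auto simp: op_ext_add op_ext_fscale op_ext_fmono add.commute ssign_commute[of "?p v" "?p u"]
          algebra_simps)
  next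
    case jac
    have eq: "?p (Mul u (Mul v t)) = ?p (Mul (Mul u v) t)" "?p (Mul v (Mul u t)) = ?p (Mul (Mul u v) t)"
      by (simp_all only: magma_par.simps ac_simps)
    have s: "ssign (?p v) (?p u) = ssign (?p u) (?p v)" "ssign (?p t) (?p u) = ssign (?p u) (?p t)"
       "ssign (?p t) (?p v) = ssign (?p v) (?p t)"
      "ssign (?p u + ?p v) (?p t) = ssign (?p u) (?p t) * ssign (?p v) (?p t)"
      "ssign (?p u) (?p v + ?p t) = ssign (?p u) (?p v) * ssign (?p u) (?p t)"
      "ssign (?p v) (?p u + ?p t) = ssign (?p u) (?p v) * ssign (?p v) (?p t)"
      by (simp_all only: ssign_mult ssign_commute[of "?p u + ?p v"] ssign_commute)
    have q: "ssign (?p u) (?p v) * ssign (?p u) (?p v) = 1" by simp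
    have "magma_op D l (Mul u (Mul v t)) f w - magma_op D l (Mul (Mul u v) t) f w
        - ssign (?p u) (?p v) * magma_op D l (Mul v (Mul u t)) f w = 0"
      using q by (simp add: magma_op_diff magma_op_scale s) (simp add: algebra_simps)
    then show ?thesis
      using jac by (simp add: op_ext_diff op_ext_fscale op_ext_fmono eq del: magma_op.simps magma_par.simps)
  qed
qed

lemma linear_dual:
  assumes "in_dual D l"
  shows "l (h + h') = l h + l h'" "l (hscale D c h) = c * l h"
  using assms by (simp_all add: in_dual_def Vector_Spaces.linear_def module_hom_def
      module_hom_axioms_def)

lemma word_weight_linear:
  assumes "\<And>i. in_dual D (sroot D i)"
  shows "word_weight D w (h + h') = word_weight D w h + word_weight D w h'"
    "word_weight D w (hscale D c h) = c * word_weight D w h"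
  by (induction w) (simp_all add: linear_dual[OF assms] algebra_simps)

lemma op_ext_relations:
  assumes F: "F \<in> defining_relations D" and l: "in_dual D l" and s: "\<And>i. in_dual D (sroot D i)"
  shows "op_ext D l a f w F = 0"
  using F unfolding defining_relations_def
proof (elim UnE CollectE exE conjE)
  fix h i assume F: "F = fmono (Mul (Gen (H h)) (Gen (XM i))) + fscale (sroot D i h) (fmono (Gen (XM i)))"
  show ?thesis
    using neg_op_weight[of l h D w i f]
    by (simp add: F op_ext_add op_ext_fscale op_ext_fmono) (simp add: ssign_def)
qed (hypsubst, simp add: op_ext_add op_ext_diff op_ext_fscale op_ext_fmono linear_dual[OF l]
      word_weight_linear[OF s] ssign_def algebra_simps)+

text \<open>With a highest weight \<open>l\<close> such that \<open>l h = 1\<close>, the generator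
  \<open>H h\<close> acts on the constant function 1 at the empty word by 1. If its class vanished,
  it would lie in the ideal of relations and act by 0.\<close>

lemma hmap_tilde_inj:
  assumes T: "tilde_superalgebra D T" and vs: "vector_space (hscale D)"
    and s: "\<And>i. in_dual D (sroot D i)" and h: "hmap T h = 0"
  shows "h = 0"
proof (rule ccontr)
  assume "h \<noteq> 0"
  interpret L: lie_superalgebra T using T by (simp add: tilde_superalgebra_def)
  interpret V: complex_vector_space "lscale T" unfolding complex_vector_space_def by (rule L.vs)
  interpret VH: vector_space "hscale D" by (rule vs)
  interpret P: vector_space_pair "hscale D" "(*) :: complex \<Rightarrow> complex \<Rightarrow> complex" by unfold_locales
  have "VH.independent {h}" using \<open>h \<noteq> 0\<close> by simp
  then obtain l where l: "in_dual D l" "l h = 1"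
    using P.linear_independent_extend[of "{h}" "\<lambda>_. 1"] by (auto simp: in_dual_def)
  have "free_val T F = lin_ext (lscale T) (magma_val T) F" for F
    by (simp add: free_val_def lin_ext_def)
  then have "free_val T (fmono (Gen (H h))) = 0" by (simp add: h)
  then have "fmono (Gen (H h)) \<in> free_ideal (lie_identities (gen_par D) \<union> defining_relations D)"
    using T by (auto simp: tilde_superalgebra_def)
  then have "op_ext D l 0 (\<lambda>_. 1) [] (fmono (Gen (H h))) = 0"
    by (rule op_ext_free_ideal) (elim UnE op_ext_identities op_ext_relations[OF _ l(1) s])
  then show False by (simp add: op_ext_fmono l)
qed

section \<open>Lie superalgebras\<close>

context lie_superalgebra
begin

sublocale V: complex_vector_space "lscale L"
  unfolding complex_vector_space_def by (rule vs)

abbreviation br where "br \<equiv> lbrk L"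
abbreviation sc where "sc \<equiv> lscale L"
abbreviation part where "part \<equiv> lpart L"

lemma brk_zero_left [simp]: "br 0 y = 0"
  using brk_add_left[of 0 0 y] by simp

lemma brk_zero_right [simp]: "br y 0 = 0"
  using brk_add_right[of y 0 0] by simp

lemma brk_minus_left [simp]: "br (- x) y = - br x y"
  using brk_add_left[of "- x" x y] by (simp add: eq_neg_iff_add_eq_0)

lemma brk_minus_right [simp]: "br x (- y) = - br x y"
  using brk_add_right[of x "- y" y] by (simp add: eq_neg_iff_add_eq_0)

lemma brk_sum_left: "br (sum f S) y = (\<Sum>i\<in>S. br (f i) y)"
  by (induction S rule: infinite_finite_induct) (simp_all add: brk_add_left)

lemma brk_sum_right: "br x (sum f S) = (\<Sum>i\<in>S. br x (f i))"
  by (induction S rule: infinite_finite_induct) (simp_all add: brk_add_right)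

lemma zero_part [simp]: "0 \<in> part a"
  by (rule V.subspace_0[OF part_subspace])

lemma part_add: "x \<in> part a \<Longrightarrow> y \<in> part a \<Longrightarrow> x + y \<in> part a"
  by (rule V.subspace_add[OF part_subspace])

lemma part_scale: "x \<in> part a \<Longrightarrow> sc c x \<in> part a"
  by (rule V.subspace_scale[OF part_subspace])

lemma part_neg: "x \<in> part a \<Longrightarrow> - x \<in> part a"
  by (rule V.subspace_neg[OF part_subspace])

lemma part_diff: "x \<in> part a \<Longrightarrow> y \<in> part a \<Longrightarrow> x - y \<in> part a"
  by (rule V.subspace_diff[OF part_subspace])

lemma parts_disjoint: "x \<in> part 0 \<Longrightarrow> x \<in> part 1 \<Longrightarrow> x = 0"
  using part_Int by blast

lemma parts_unique:
  assumes "a + b = c + d" "a \<in> part 0" "c \<in> part 0" "b \<in> part 1" "d \<in> part 1"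
  shows "a = c" "b = d"
proof -
  have "a - c = d - b" using assms(1) by (simp add: algebra_simps)
  moreover have "a - c \<in> part 0" "d - b \<in> part 1" using assms by (auto intro: part_diff)
  ultimately have "a - c = 0" using parts_disjoint by metis
  with \<open>a - c = d - b\<close> show "a = c" "b = d" by auto
qed

lemma ssign_0 [simp]: "ssign 0 b = 1" "ssign b 0 = 1"
  by (simp_all add: ssign_def)

lemma brk_brk_left:
  "x \<in> part a \<Longrightarrow> y \<in> part b \<Longrightarrow> br (br x y) z = br x (br y z) - sc (ssign a b) (br y (br x z))"
  using jacobi[of x a y b z] by simp

lemma even_derivation:
  assumes x: "x \<in> part 0"
  shows "br x (br y z) = br (br x y) z + br y (br x z)"
proof -
  obtain y0 y1 where y: "y0 \<in> part 0" "y1 \<in> part 1" "y = y0 + y1"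
    using part_sum[of y] by blast
  show ?thesis
    using jacobi[OF x y(1), of z] jacobi[OF x y(2), of z]
    by (simp add: y(3) brk_add_left brk_add_right)
qed

lemma even_skew:
  assumes x: "x \<in> part 0"
  shows "br y x = - br x y"
proof -
  obtain y0 y1 where y: "y0 \<in> part 0" "y1 \<in> part 1" "y = y0 + y1"
    using part_sum[of y] by blast
  show ?thesis
    using skew[OF y(1) x] skew[OF y(2) x]
    by (simp add: y(3) brk_add_left brk_add_right)
qed

lemma odd_square:
  assumes x: "x \<in> part 1"
  shows "br x (br x z) = sc (1/2) (br (br x x) z)"
proof -
  have "br x (br x z) = br (br x x) z - br x (br x z)"
    using jacobi[OF x x, of z] by (simp add: ssign_def)
  then have "br (br x x) z = sc 2 (br x (br x z))"
    using V.scale_left_distrib[of 1 1 "br x (br x z)"] by (simp add: algebra_simps)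
  then show ?thesis by simp
qed

lemma even_self_brk:
  assumes "x \<in> part 0"
  shows "br x x = 0"
proof -
  have "br x x + br x x = 0" using even_skew[OF assms, of x] by (simp add: eq_neg_iff_add_eq_0)
  then have "sc 2 (br x x) = 0" using V.scale_left_distrib[of 1 1 "br x x"] by simp
  then show ?thesis by simp
qed

text \<open>For u = [x, [x, x]], skew-symmetry gives [[x, x], x] = -u and \<open>odd_square\<close>
  gives u = (1/2) [[x, x], x]; together 3 u = 0.\<close>

lemma odd_cube:
  assumes x: "x \<in> part 1"
  shows "br x (br x x) = 0"
proof -
  let ?u = "br x (br x x)"
  have "br x x \<in> part 0" using brk_part[OF x x] by simp
  then have "br (br x x) x = - ?u" using even_skew by (metis minus_minus)
  then have "?u = sc (1/2) (- ?u)" using odd_square[OF x, of x] by simp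
  then have "sc 2 ?u = - ?u" by (metis V.scale_scale V.scale_one mult_2 nonzero_mult_div_cancel_left
        times_divide_eq_right zero_neq_numeral mult.right_neutral)
  then have "sc 3 ?u = 0" using V.scale_left_distrib[of 2 1 ?u] by simp
  then show ?thesis by simp
qed

lemma brk_span:
  assumes "z \<in> V.span S" "\<And>s. s \<in> S \<Longrightarrow> br u s \<in> V.span S'"
  shows "br u z \<in> V.span S'"
  using assms(1)
  by (induction rule: V.span_induct_alt)
     (simp_all add: brk_add_right brk_scale_right assms(2) V.span_add V.span_scale V.span_zero)

definition homogeneous where "homogeneous u \<longleftrightarrow> u \<in> part 0 \<or> u \<in> part 1"

lemma homogeneousI: "u \<in> part a \<Longrightarrow> homogeneous u"
  unfolding homogeneous_def by (cases a) auto

lemma homogeneousE: assumes "homogeneous u" obtains a where "u \<in> part a"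
  using assms unfolding homogeneous_def by blast

text \<open>\<open>jacobi\<close> concerns homogeneous elements, whereas elements of the generated
  subalgebra are mixed. The induction therefore carries an even and an odd part, each of which
  stabilizes \<open>J\<close>.\<close>

lemma generated_stable:
  assumes u: "u \<in> lie_generated L X" and J: "V.subspace J"
    and hom: "\<And>u. u \<in> X \<Longrightarrow> homogeneous u"
    and X: "\<And>u z. u \<in> X \<Longrightarrow> z \<in> J \<Longrightarrow> br u z \<in> J"
    and z: "z \<in> J"
  shows "br u z \<in> J"
proof -
  let ?st = "\<lambda>u. \<forall>z\<in>J. br u z \<in> J"
  note J_add = V.subspace_add[OF J] and J_scale = V.subspace_scale[OF J] and J_0 = V.subspace_0[OF J]
    and J_diff = V.subspace_diff[OF J]
  have st_brk: "?st (br v w)" if "v \<in> part a" "w \<in> part b" "?st v" "?st w" for v w a b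
    using that by (auto simp: brk_brk_left intro!: J_diff J_scale)
  have st_add: "?st (v + w)" if "?st v" "?st w" for v w
    using that by (auto simp: brk_add_left intro!: J_add)
  have "\<exists>v\<in>part 0. \<exists>w\<in>part 1. u = v + w \<and> ?st v \<and> ?st w"
    using u
  proof induction
    case (gen u)
    then have "u \<in> part 0 \<or> u \<in> part 1" using hom by (simp add: homogeneous_def)
    moreover have "?st u" "?st 0" using gen X J_0 by auto
    ultimately show ?case by (metis add_0 add.right_neutral zero_part)
  next
    case zero
    then show ?case using J_0 by (intro bexI[of _ 0]) auto
  next
    case (add u v)
    then obtain u0 u1 v0 v1 where *: "u0 \<in> part 0" "u1 \<in> part 1" "v0 \<in> part 0" "v1 \<in> part 1"
      "u = u0 + u1" "v = v0 + v1" "?st u0" "?st u1" "?st v0" "?st v1" by blast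
    show ?case
      by (rule bexI[of _ "u0 + v0"], rule bexI[of _ "u1 + v1"])
        (use * st_add in \<open>auto intro: part_add simp: algebra_simps\<close>)
  next
    case (scale u c)
    then obtain u0 u1 where *: "u0 \<in> part 0" "u1 \<in> part 1"
      "u = u0 + u1" "?st u0" "?st u1" by blast
    show ?case
      by (rule bexI[of _ "sc c u0"], rule bexI[of _ "sc c u1"])
        (use * in \<open>auto intro: part_scale J_scale simp: V.scale_right_distrib brk_scale_left\<close>)
  next
    case (brk u v)
    then obtain u0 u1 v0 v1 where *: "u0 \<in> part 0" "u1 \<in> part 1" "v0 \<in> part 0" "v1 \<in> part 1"
      "u = u0 + u1" "v = v0 + v1" "?st u0" "?st u1" "?st v0" "?st v1" by blast
    have "?st (br u0 v0)" "?st (br u1 v1)" "?st (br u0 v1)" "?st (br u1 v0)"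
      using * st_brk by metis+
    moreover have "br u0 v0 \<in> part 0" "br u1 v1 \<in> part 0" "br u0 v1 \<in> part 1" "br u1 v0 \<in> part 1"
      using brk_part[OF *(1,3)] brk_part[OF *(2,4)] brk_part[OF *(1,4)] brk_part[OF *(2,3)] by simp_all
    ultimately show ?case
      by (intro bexI[of _ "br u0 v0 + br u1 v1"] bexI[of _ "br u0 v1 + br u1 v0"] conjI st_add part_add)
        (auto simp: * brk_add_left brk_add_right algebra_simps)
  qed
  then show ?thesis using z J_add by (auto simp: brk_add_left)
qed

lemma span_homogeneous_parts:
  assumes "z \<in> V.span S" "\<And>s. s \<in> S \<Longrightarrow> homogeneous s"
  shows "\<exists>v\<in>V.span S \<inter> part 0. \<exists>w\<in>V.span S \<inter> part 1. z = v + w"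
  using assms(1)
proof (induction rule: V.span_induct_alt)
  case base
  then show ?case by (intro bexI[of _ 0]) (auto simp: V.span_zero)
next
  case (step c s z)
  then obtain v w where *: "v \<in> V.span S" "v \<in> part 0" "w \<in> V.span S" "w \<in> part 1" "z = v + w"
    by blast
  have s: "sc c s \<in> V.span S" using step by (simp add: V.span_base V.span_scale)
  consider "s \<in> part 0" | "s \<in> part 1" using assms(2) step by (auto simp: homogeneous_def)
  then show ?case
  proof cases
    case 1
    then show ?thesis using * s
      by (intro bexI[of _ "sc c s + v"] bexI[of _ w]) (auto intro: V.span_add part_add part_scale)
  next
    case 2
    then show ?thesis using * s
      by (intro bexI[of _ v] bexI[of _ "sc c s + w"])
        (auto intro: V.span_add part_add part_scale simp: algebra_simps)
  qed
qed

lemma lie_ideal_span: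
  assumes gen: "lie_generated L X = UNIV" and X: "\<And>u. u \<in> X \<Longrightarrow> homogeneous u"
    and S: "\<And>s. s \<in> S \<Longrightarrow> homogeneous s"
    and XS: "\<And>u s. u \<in> X \<Longrightarrow> s \<in> S \<Longrightarrow> br u s \<in> V.span S"
  shows "lie_ideal L (V.span S)"
proof -
  have "br u z \<in> V.span S" if "z \<in> V.span S" for u z
    by (rule generated_stable[of u X]) (use gen X XS that brk_span in auto)
  then show ?thesis
    unfolding lie_ideal_def using span_homogeneous_parts S by auto
qed

lemma lie_generated_mono:
  assumes "X \<subseteq> lie_generated L Y"
  shows "lie_generated L X \<subseteq> lie_generated L Y"
proof
  fix u assume "u \<in> lie_generated L X"
  then show "u \<in> lie_generated L Y"
    by induction (use assms in \<open>auto intro: lie_generated.intros\<close>)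
qed

end

section \<open>Weight spaces\<close>

lemma in_dualI:
  assumes "vector_space (hscale D)" "\<And>h h'. l (h + h') = l h + l h'" "\<And>c h. l (hscale D c h) = c * l h"
  shows "in_dual D l"
proof -
  interpret VH: vector_space "hscale D" by fact
  show ?thesis using assms VH.vector_space_axioms vector_space_over_itself.vector_space_axioms
    by (simp add: in_dual_def Vector_Spaces.linear_iff)
qed

text \<open>What remains of \<gg>(A) when no base is singled out; all bases are compared inside this
  locale. \<open>no_ideal\<close> is the maximality of the ideal divided out.\<close>

locale cartan_superalgebra = lie_superalgebra G
  for G :: "('h::ab_group_add, 'i::finite, 'g::ab_group_add) gen_superalg" +
  fixes D :: "('h, 'i) cartan_datum"
  assumes hvs: "vector_space (hscale D)"
    and hmap_add: "hmap G (h + h') = hmap G h + hmap G h'"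
    and hmap_scale: "hmap G (hscale D c h) = lscale G c (hmap G h)"
    and hmap_inj: "hmap G h = 0 \<Longrightarrow> h = 0"
    and hmap_even: "hmap G h \<in> lpart G 0"
    and hmap_comm: "lbrk G (hmap G h) (hmap G h') = 0"
    and no_ideal: "lie_ideal G J \<Longrightarrow> J \<inter> range (hmap G) = {0} \<Longrightarrow> J = {0}"
begin

abbreviation hm where "hm \<equiv> hmap G"
abbreviation R where "R \<equiv> root_space G"

sublocale VH: vector_space "hscale D" by (rule hvs)

lemma hmap_zero [simp]: "hm 0 = 0"
  using hmap_add[of 0 0] by simp

lemma hmap_minus: "hm (- h) = - hm h"
  using hmap_add[of "- h" h] by (simp add: eq_neg_iff_add_eq_0)

lemma hmap_eq_iff [simp]: "hm h = hm h' \<longleftrightarrow> h = h'"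
proof
  assume "hm h = hm h'"
  then have "hm (h - h') = 0" using hmap_add[of h "- h'"] by (simp add: hmap_minus)
  then show "h = h'" using hmap_inj by force
qed simp

lemma h_brk_eq: "br u v = hm h \<Longrightarrow> h_brk G u v = h"
  unfolding h_brk_def by (rule the_equality) auto

lemma subspace_hmap: "V.subspace (range hm)"
  by (rule V.subspaceI) (auto simp: hmap_add[symmetric] hmap_scale[symmetric] intro: range_eqI[of _ _ 0])

lemma root_spaceI: "(\<And>h. br (hm h) u = sc (l h) u) \<Longrightarrow> u \<in> R l"
  by (simp add: root_space_def)

lemma root_spaceD: "u \<in> R l \<Longrightarrow> br (hm h) u = sc (l h) u"
  by (simp add: root_space_def)

lemma root_spaceD': "u \<in> R l \<Longrightarrow> br u (hm h) = - sc (l h) u"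
  by (simp add: root_space_def even_skew[OF hmap_even])

lemma subspace_root_space: "V.subspace (R l)"
  by (rule V.subspaceI)
     (simp_all add: root_space_def brk_add_right brk_scale_right V.scale_right_distrib V.scale_left_commute)

lemmas root_space_0 [simp] = V.subspace_0[OF subspace_root_space]
  and root_space_scale = V.subspace_scale[OF subspace_root_space]
  and root_space_diff = V.subspace_diff[OF subspace_root_space]

lemma hmap_root_space: "hm h \<in> R 0"
  by (simp add: root_space_def hmap_comm)

lemma root_space_brk:
  assumes "u \<in> R l" "v \<in> R m"
  shows "br u v \<in> R (l + m)"
  using assms
  by (intro root_spaceI)
     (simp add: even_derivation[OF hmap_even] root_spaceD brk_scale_left brk_scale_right
        V.scale_left_distrib)

lemma root_space_unique: "u \<in> R l \<Longrightarrow> u \<in> R m \<Longrightarrow> u \<noteq> 0 \<Longrightarrow> l = m"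
  by (rule ext) (metis root_spaceD V.scale_cancel_right)

lemma root_space_dual:
  assumes "u \<in> R l" "u \<noteq> 0"
  shows "in_dual D l"
proof (rule in_dualI[OF hvs])
  fix h h' c
  have "sc (l (h + h')) u = sc (l h + l h') u"
    using assms(1) by (simp flip: root_spaceD add: hmap_add brk_add_left V.scale_left_distrib)
  then show "l (h + h') = l h + l h'" using assms(2) by simp
  have "sc (l (hscale D c h)) u = sc (c * l h) u"
    using assms(1) by (simp flip: root_spaceD V.scale_scale add: hmap_scale brk_scale_left)
  then show "l (hscale D c h) = c * l h" using assms(2) by simp
qed

lemma rootsI: "u \<in> R l \<Longrightarrow> u \<noteq> 0 \<Longrightarrow> l \<noteq> 0 \<Longrightarrow> l \<in> roots D G"
  using root_space_dual by (auto simp: roots_def)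

lemma rootsE: assumes "l \<in> roots D G" obtains u where "u \<in> R l" "u \<noteq> 0" "l \<noteq> 0" "in_dual D l"
  using assms root_space_0[of l] unfolding roots_def by blast

lemma weight_vectors_independent:
  assumes "finite F" "\<And>m. m \<in> F \<Longrightarrow> f m \<in> R m" "(\<Sum>m\<in>F. f m) = 0" "m \<in> F"
  shows "f m = 0"
  using assms
proof (induction F arbitrary: f m rule: finite_induct)
  case (insert k F)
  have *: "f m = 0" if m: "m \<in> F" for m
  proof -
    from m insert have "m \<noteq> k" by blast
    then obtain h where h: "m h \<noteq> k h" by auto
    \<comment> \<open>The operator ad h - k(h) kills the component of weight \<open>k\<close> and
      multiplies that of weight \<open>m\<close> by a nonzero number.\<close>
    let ?g = "\<lambda>n. sc (n h - k h) (f n)"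
    have "0 = br (hm h) (\<Sum>n\<in>insert k F. f n) - sc (k h) (\<Sum>n\<in>insert k F. f n)"
      using insert.prems by simp
    also have "\<dots> = (\<Sum>n\<in>insert k F. ?g n)"
      unfolding brk_sum_right V.scale_sum_right sum_subtractf[symmetric]
      by (rule sum.cong) (use insert.prems(1) in \<open>auto simp: root_spaceD V.scale_left_diff_distrib\<close>)
    also have "\<dots> = (\<Sum>n\<in>F. ?g n)" using insert.hyps by simp
    finally have "?g m = 0"
      using insert.IH[of ?g m] insert.prems(1) m by (simp add: root_space_scale)
    then show "f m = 0" using h by simp
  qed
  then have "(\<Sum>m\<in>insert k F. f m) = f k" using insert.hyps by simp
  with insert.prems * show ?case by auto
qed simp

lemma span_weight_decomposition:
  assumes "z \<in> V.span S" "\<And>s. s \<in> S \<Longrightarrow> \<exists>m. s \<in> R m"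
  shows "\<exists>F f. finite F \<and> (\<forall>m. f m \<in> V.span (S \<inter> R m)) \<and> (\<forall>m. m \<notin> F \<longrightarrow> f m = 0) \<and> z = (\<Sum>m\<in>F. f m)"
  using assms(1)
proof (induction rule: V.span_induct_alt)
  case base
  then show ?case by (intro exI[of _ "{}"] exI[of _ "\<lambda>_. 0"]) (simp add: V.span_zero)
next
  case (step c s z)
  then obtain F f where *: "finite F" "\<forall>m. f m \<in> V.span (S \<inter> R m)" "\<forall>m. m \<notin> F \<longrightarrow> f m = 0"
    "z = (\<Sum>m\<in>F. f m)" by blast
  obtain k where k: "s \<in> R k" using assms(2) step by blast
  let ?f = "\<lambda>m. if m = k then sc c s + f m else f m"
  have "?f m \<in> V.span (S \<inter> R m)" for m
    using *(2) V.span_add[OF V.span_scale[OF V.span_base], of s "S \<inter> R k" "f k" c] k step by auto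
  moreover have "(\<Sum>m\<in>insert k F. ?f m) = sc c s + z"
  proof -
    have "(\<Sum>m\<in>insert k F. ?f m) = ?f k + (\<Sum>m\<in>F - {k}. ?f m)"
      using * by (simp add: sum.insert_remove)
    also have "(\<Sum>m\<in>F - {k}. ?f m) = (\<Sum>m\<in>F - {k}. f m)" by (rule sum.cong) auto
    finally show ?thesis using * by (cases "k \<in> F") (simp_all add: sum.remove add.assoc)
  qed
  ultimately show ?case using * by (intro exI[of _ "insert k F"] exI[of _ ?f]) auto
qed

text \<open>Subtracting \<open>z\<close> from the component of weight \<open>l\<close> in a weight
  decomposition of \<open>z\<close> gives a vanishing sum of weight vectors, so \<open>z\<close>
  equals that component.\<close>

lemma span_weight_component:
  assumes "z \<in> V.span S" "\<And>s. s \<in> S \<Longrightarrow> \<exists>m. s \<in> R m" "z \<in> R l"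
  shows "z \<in> V.span (S \<inter> R l)"
proof -
  obtain F f where *: "finite F" "\<And>m. f m \<in> V.span (S \<inter> R m)" "\<And>m. m \<notin> F \<Longrightarrow> f m = 0"
    "z = (\<Sum>m\<in>F. f m)" using span_weight_decomposition[OF assms(1,2)] by blast
  have fR: "f m \<in> R m" for m
    using *(2)[of m] V.span_minimal[OF _ subspace_root_space, of "S \<inter> R m" m] by auto
  let ?g = "\<lambda>m. if m = l then f m - z else f m"
  have "(\<Sum>m\<in>insert l F. ?g m) = (f l - z) + (\<Sum>m\<in>F - {l}. ?g m)"
    using * by (simp add: sum.insert_remove)
  also have "(\<Sum>m\<in>F - {l}. ?g m) = (\<Sum>m\<in>F - {l}. f m)" by (rule sum.cong) auto
  also have "f l - z + \<dots> = 0"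
    unfolding *(4) using * by (cases "l \<in> F") (simp_all add: sum.remove[of F l])
  finally have "?g l = 0"
    by (rule weight_vectors_independent[rotated 2])
       (use * fR assms(3) in \<open>auto intro: root_space_diff\<close>)
  then have "z = f l" by simp
  then show ?thesis using *(2) by simp
qed

end

section \<open>Triangular decomposition with respect to Chevalley generators\<close>

text \<open>Coordinates are indexed by the type \<open>'i\<close> and not by the base itself, so
  that coordinates with respect to two bases can be compared index by index.\<close>

definition wt :: "('i::finite \<Rightarrow> 'h \<Rightarrow> complex) \<Rightarrow> ('i \<Rightarrow> int) \<Rightarrow> 'h \<Rightarrow> complex" where
  "wt r n = (\<lambda>h. \<Sum>i\<in>UNIV. of_int (n i) * r i h)"

definition wpar :: "('i::finite \<Rightarrow> bit) \<Rightarrow> ('i \<Rightarrow> int) \<Rightarrow> bit" where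
  "wpar p n = (\<Sum>i\<in>UNIV. of_int (n i) * p i)"

definition unitv :: "'i \<Rightarrow> 'i \<Rightarrow> int" where
  "unitv i = (\<lambda>j. if j = i then 1 else 0)"

lemma unitv_simps [simp]: "unitv i i = 1" "j \<noteq> i \<Longrightarrow> unitv i j = 0"
  by (simp_all add: unitv_def)

lemma unitv_nonneg [simp]: "0 \<le> unitv i j"
  by (simp add: unitv_def)

lemma unitv_nonzero [simp]: "unitv i \<noteq> 0"
proof
  assume "unitv i = 0"
  from fun_cong[OF this, of i] show False by simp
qed

lemma wt_add: "wt r (m + n) = wt r m + wt r n"
  by (rule ext) (simp add: wt_def algebra_simps sum.distrib)

lemma wt_minus: "wt r (- n) = - wt r n"
  by (rule ext) (simp add: wt_def sum_negf)

lemma wt_zero [simp]: "wt r 0 = 0"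
  by (rule ext) (simp add: wt_def)

lemma wt_opposite: "wt (\<lambda>i. - r i) n = - wt r n"
  by (rule ext) (simp add: wt_def sum_negf)

lemma wt_unitv [simp]: "wt r (unitv i) = r i"
  by (rule ext) (simp add: wt_def unitv_def if_distrib if_distribR cong: if_cong)

lemma wpar_add: "wpar p (m + n) = wpar p m + wpar p n"
  by (simp add: wpar_def algebra_simps sum.distrib)

lemma wpar_unitv [simp]: "wpar p (unitv i) = p i"
  by (simp add: wpar_def unitv_def if_distrib if_distribR cong: if_cong)

text \<open>\<open>raise G x Z n z\<close> records that \<open>z\<close> arises from a start vector in \<open>Z\<close> by repeated application of
  the \<open>ad x\<^sub>i\<close>, and that \<open>n\<close> is its weight in the coordinates of the family.\<close>

inductive raise :: "('h, 'i::finite, 'g::ab_group_add) gen_superalg \<Rightarrow> ('i \<Rightarrow> 'g)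
    \<Rightarrow> (('i \<Rightarrow> int) \<times> 'g) set \<Rightarrow> ('i \<Rightarrow> int) \<Rightarrow> 'g \<Rightarrow> bool"
  for G x Z where
  base: "(n, z) \<in> Z \<Longrightarrow> raise G x Z n z"
| step: "raise G x Z n z \<Longrightarrow> raise G x Z (n + unitv i) (lbrk G (x i) z)"

text \<open>A base as an indexed family, with its Chevalley vectors. For a given base, nonvanishing
  of the vectors \<open>x i\<close> is deduced inside this locale and then recorded in
  \<open>base_family\<close>.\<close>

locale chevalley_family = cartan_superalgebra G D
  for G :: "('h::ab_group_add, 'i::finite, 'g::ab_group_add) gen_superalg"
    and D :: "('h, 'i) cartan_datum" +
  fixes r :: "'i \<Rightarrow> 'h \<Rightarrow> complex" and x y :: "'i \<Rightarrow> 'g" and p :: "'i \<Rightarrow> bit"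
  assumes indep: "\<And>c i. (\<And>h. (\<Sum>j\<in>UNIV. c j * r j h) = 0) \<Longrightarrow> c i = 0"
    and r_dual: "\<And>i. in_dual D (r i)"
    and x_root: "\<And>i. x i \<in> root_space G (r i)" and y_root: "\<And>i. y i \<in> root_space G (- r i)"
    and x_par: "\<And>i. x i \<in> lpart G (p i)" and y_par: "\<And>i. y i \<in> lpart G (p i)"
    and brk_xy: "\<And>i j. i \<noteq> j \<Longrightarrow> lbrk G (x i) (y j) = 0"
    and brk_xy_same: "\<And>i. lbrk G (x i) (y i) \<in> range (hmap G)"
    and generates: "lie_generated G (range (hmap G) \<union> range x \<union> range y) = UNIV"
begin

definition coroot where "coroot i = (SOME h. hm h = br (x i) (y i))"

lemma brk_xy_coroot: "br (x i) (y i) = hm (coroot i)"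
proof -
  have "\<exists>h. hm h = br (x i) (y i)" using brk_xy_same[of i] by auto
  then have "hm (coroot i) = br (x i) (y i)" unfolding coroot_def by (rule someI_ex)
  then show ?thesis by simp
qed

lemma span_neg_scale_base: "s \<in> S \<Longrightarrow> - sc c s \<in> V.span S"
  by (intro V.span_neg V.span_scale V.span_base)

lemma brk_yx: "i \<noteq> j \<Longrightarrow> br (y i) (x j) = 0"
  using skew[OF y_par x_par, of i j] brk_xy[of j i] by simp

lemma brk_yx_coroot: "br (y i) (x i) = - sc (ssign (p i) (p i)) (hm (coroot i))"
  using skew[OF y_par x_par, of i i] brk_xy_coroot[of i] by simp

text \<open>This replaces the Chevalley involution: every statement about \<open>pos\<close> is used
  for \<open>neg\<close> through this instance.\<close>

lemma opposite: "chevalley_family G D (\<lambda>i. - r i) y x p"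
proof unfold_locales
  fix c :: "'i \<Rightarrow> complex" and i assume *: "\<And>h. (\<Sum>j\<in>UNIV. c j * (- r j) h) = 0"
  show "c i = 0"
    by (rule indep) (use * in \<open>simp add: sum_negf\<close>)
next
  fix i
  show "in_dual D (- r i)"
    by (rule in_dualI[OF hvs]) (simp_all add: linear_dual[OF r_dual])
next
  fix i
  show "br (y i) (x i) \<in> range hm"
    unfolding brk_yx_coroot hmap_scale[symmetric] hmap_minus[symmetric] by (rule rangeI)
qed (use x_root y_root x_par y_par brk_yx generates in \<open>simp_all add: Un_ac\<close>)

lemma wt_inj: "wt r m = wt r n \<longleftrightarrow> m = n"
proof
  assume *: "wt r m = wt r n"
  show "m = n"
  proof
    fix i
    have "complex_of_int (m i) - of_int (n i) = 0"
      by (rule indep[of "\<lambda>i. of_int (m i) - of_int (n i)"])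
         (use fun_cong[OF *] in \<open>simp add: wt_def algebra_simps sum_subtractf\<close>)
    then show "m i = n i" by simp
  qed
qed simp

lemma wt_eq_0_iff [simp]: "wt r n = 0 \<longleftrightarrow> n = 0"
  using wt_inj[of n 0] by simp

lemma wt_eq_minus: "wt r m = - wt r n \<longleftrightarrow> m = - n"
  using wt_inj[of m "- n"] by (simp add: wt_minus)

lemma r_nonzero: "r i \<noteq> 0"
  using wt_eq_0_iff[of "unitv i"] by (metis unitv_nonzero wt_unitv)

lemma r_inj: "inj r"
proof
  fix i j assume "r i = r j"
  then have "unitv i = unitv j" using wt_inj[of "unitv i" "unitv j"] by simp
  from fun_cong[OF this, of i] show "i = j" by (auto simp: unitv_def split: if_splits)
qed

lemma raise_root:
  assumes "raise G x Z n z" "\<And>n z. (n, z) \<in> Z \<Longrightarrow> z \<in> R (wt r n)"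
  shows "z \<in> R (wt r n)"
  using assms(1)
proof induction
  case (step n z i)
  show ?case using root_space_brk[OF x_root[of i] step.IH] by (simp only: wt_add wt_unitv add.commute)
qed (use assms(2) in auto)

lemma raise_par:
  assumes "raise G x Z n z" "\<And>n z. (n, z) \<in> Z \<Longrightarrow> z \<in> part (a + wpar p n)"
  shows "z \<in> part (a + wpar p n)"
  using assms(1)
proof induction
  case (step n z i)
  show ?case using brk_part[OF x_par[of i] step.IH] by (simp only: wpar_add wpar_unitv ac_simps)
qed (use assms(2) in auto)

text \<open>Moving \<open>y j\<close> past \<open>x i\<close> leaves a Cartan element acting by a
  scalar, plus \<open>x i\<close> applied to a vector covered by the induction. The set
  \<open>C\<close> admits the Cartan elements that appear when the start vectors are the
  \<open>x i\<close>; for a singular start vector it is empty.\<close>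

lemma lower_raise:
  fixes Z C defines "W \<equiv> {z. \<exists>n. raise G x Z n z}"
  assumes "raise G x Z n z"
    and Zr: "\<And>n z. (n, z) \<in> Z \<Longrightarrow> z \<in> R (wt r n)"
    and Zy: "\<And>n z j. (n, z) \<in> Z \<Longrightarrow> br (y j) z \<in> V.span (C \<union> W)"
    and C: "\<And>c i. c \<in> C \<Longrightarrow> br (x i) c \<in> V.span (C \<union> W)"
  shows "br (y j) z \<in> V.span (C \<union> W)"
  using assms(2)
proof (induction arbitrary: j)
  case (base n z)
  then show ?case by (rule Zy)
next
  case (step n z i)
  have z: "z \<in> W" "z \<in> R (wt r n)" using step raise_root[OF step.hyps Zr] by (auto simp: W_def)
  have eq: "br (y j) (br (x i) z) = br (br (y j) (x i)) z + sc (ssign (p j) (p i)) (br (x i) (br (y j) z))"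
    by (rule jacobi[OF y_par x_par])
  have "br (x i) (br (y j) z) \<in> V.span (C \<union> W)"
  proof (rule brk_span[OF step.IH])
    fix s assume "s \<in> C \<union> W"
    then show "br (x i) s \<in> V.span (C \<union> W)"
    proof
      assume "s \<in> W"
      then have "br (x i) s \<in> W" by (auto simp: W_def intro: raise.step)
      then show ?thesis by (simp add: V.span_base)
    qed (rule C)
  qed
  moreover have "br (br (y j) (x i)) z \<in> V.span (C \<union> W)"
  proof (cases "i = j")
    case True
    then show ?thesis using z
      by (auto simp: brk_yx_coroot brk_scale_left root_spaceD intro!: span_neg_scale_base)
  next
    case False
    then show ?thesis by (simp add: brk_yx V.span_zero)
  qed
  ultimately show ?case unfolding eq by (intro V.span_add V.span_scale)
qed

abbreviation pos where "pos \<equiv> raise G x (range (\<lambda>i. (unitv i, x i)))"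
abbreviation neg where "neg \<equiv> raise G y (range (\<lambda>i. (unitv i, y i)))"

lemma pos_root: "pos n z \<Longrightarrow> z \<in> R (wt r n)"
  by (erule raise_root) (use x_root in auto)

lemma neg_root: "neg n z \<Longrightarrow> z \<in> R (- wt r n)"
proof -
  interpret opp: chevalley_family G D "\<lambda>i. - r i" y x p by (rule opposite)
  assume "neg n z" then show ?thesis using opp.pos_root by (simp add: wt_opposite)
qed

lemma pos_par: "pos n z \<Longrightarrow> z \<in> part (wpar p n)"
proof -
  assume "pos n z"
  then have "z \<in> part (0 + wpar p n)"
    by (rule raise_par) (auto simp: x_par)
  then show ?thesis by simp
qed

lemma raise_nonneg:
  assumes "raise G w Z n z" "\<And>n z. (n, z) \<in> Z \<Longrightarrow> (\<forall>i. 0 \<le> n i) \<and> n \<noteq> 0"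
  shows "(\<forall>i. 0 \<le> n i) \<and> n \<noteq> 0"
  using assms(1)
proof induction
  case (step n z i)
  have "(n + unitv i) i > 0" using step by (simp add: add_nonneg_pos)
  then have "n + unitv i \<noteq> 0" by (metis less_irrefl zero_fun_apply)
  moreover have "0 \<le> (n + unitv i) k" for k using step.IH by (simp add: unitv_def)
  ultimately show ?case by blast
qed (rule assms(2))

lemma pos_nonneg: "pos n z \<Longrightarrow> (\<forall>i. 0 \<le> n i) \<and> n \<noteq> 0"
  by (erule raise_nonneg) auto

lemma neg_nonneg: "neg n z \<Longrightarrow> (\<forall>i. 0 \<le> n i) \<and> n \<noteq> 0"
  by (erule raise_nonneg) auto

lemma lower_pos: "pos n z \<Longrightarrow> br (y j) z \<in> V.span (range hm \<union> {z. \<exists>n. pos n z})"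
proof (erule lower_raise)
  fix n z j assume "(n, z) \<in> range (\<lambda>i. (unitv i, x i))"
  then obtain i where z: "z = x i" "n = unitv i" by auto
  show "br (y j) z \<in> V.span (range hm \<union> {z. \<exists>n. pos n z})"
    by (cases "i = j")
       (auto simp: z brk_yx brk_yx_coroot V.span_zero intro!: span_neg_scale_base)
next
  fix c i assume "c \<in> range hm"
  then obtain h where c: "c = hm h" by auto
  have "pos (unitv i) (x i)" by (rule raise.base) auto
  then show "br (x i) c \<in> V.span (range hm \<union> {z. \<exists>n. pos n z})"
    by (auto simp: c root_spaceD'[OF x_root] intro!: span_neg_scale_base)
qed (use x_root in auto)

lemma generator_homogeneous: "u \<in> range hm \<union> range x \<union> range y \<Longrightarrow> homogeneous u"
  using hmap_even x_par y_par by (auto intro: homogeneousI)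

abbreviation monomials where "monomials \<equiv> range hm \<union> {z. \<exists>n. pos n z} \<union> {z. \<exists>n. neg n z}"

lemma generator_monomial: "x i \<in> monomials"
  by (auto intro: raise.base)

lemma monomial_weight: "s \<in> monomials \<Longrightarrow> \<exists>l. s \<in> R l"
  using hmap_root_space pos_root neg_root by blast

lemma brk_x_monomial:
  assumes "s \<in> monomials"
  shows "br (x j) s \<in> V.span monomials"
proof -
  interpret opp: chevalley_family G D "\<lambda>i. - r i" y x p by (rule opposite)
  from assms consider h where "s = hm h" | n where "pos n s" | n where "neg n s" by blast
  then show ?thesis
  proof cases
    case 1
    show ?thesis unfolding 1 root_spaceD'[OF x_root]
      by (rule span_neg_scale_base) (rule generator_monomial)
  next
    case (2 n)
    then show ?thesis by (intro V.span_base UnI1 UnI2) (auto intro: raise.step)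
  next
    case (3 n)
    have "V.span (range hm \<union> {z. \<exists>n. neg n z}) \<subseteq> V.span monomials" by (rule V.span_mono) auto
    then show ?thesis using opp.lower_pos[OF 3, of j] by auto
  qed
qed

text \<open>The span is stable under brackets with all generators, hence with everything, and it
  contains the generators.\<close>

lemma triangular: "V.span monomials = UNIV"
proof -
  interpret opp: chevalley_family G D "\<lambda>i. - r i" y x p by (rule opposite)
  have opp: "opp.monomials = monomials" by (simp add: Un_ac)
  have stable: "br u z \<in> V.span monomials"
    if u: "u \<in> range hm \<union> range x \<union> range y" and z: "z \<in> V.span monomials" for u z
  proof (rule brk_span[OF z])
    fix s assume s: "s \<in> monomials"
    from u consider h where "u = hm h" | j where "u = x j" | j where "u = y j" by blast
    then show "br u s \<in> V.span monomials"
    proof cases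
      case 1
      obtain l where "s \<in> R l" using monomial_weight[OF s] by blast
      then show ?thesis unfolding 1 by (simp only: root_spaceD V.span_scale V.span_base[OF s])
    next
      case 2
      then show ?thesis using brk_x_monomial[OF s] by simp
    next
      case 3
      then show ?thesis using opp.brk_x_monomial[of s] s unfolding opp by simp
    qed
  qed
  have st: "br u z \<in> V.span monomials" if "z \<in> V.span monomials" for u z
    by (rule generated_stable[of u "range hm \<union> range x \<union> range y"])
       (use generates generator_homogeneous stable that in auto)
  have "u \<in> V.span monomials" if "u \<in> lie_generated G (range hm \<union> range x \<union> range y)" for u
    using that
  proof induction
    case (gen u)
    then show ?case
      using generator_monomial opp.generator_monomial unfolding opp by (intro V.span_base) blast
  qed (use st in \<open>auto intro: V.span_zero V.span_add V.span_scale\<close>)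
  then show ?thesis using generates by auto
qed

lemma root_space_in_span: "u \<in> R l \<Longrightarrow> u \<in> V.span (monomials \<inter> R l)"
  by (rule span_weight_component) (use triangular monomial_weight in auto)

lemma span_subset_zero: "S \<subseteq> {0} \<Longrightarrow> u \<in> V.span S \<Longrightarrow> u = 0"
  using V.span_mono[of S "{0}"] by auto

lemma monomial_cases:
  assumes "b \<in> monomials" "b \<in> R l" "b \<noteq> 0"
  obtains "l = 0" "b \<in> range hm" | n where "pos n b" "l = wt r n" | n where "neg n b" "l = - wt r n"
  using assms(1) hmap_root_space pos_root neg_root root_space_unique[OF assms(2) _ assms(3)] by blast

lemma root_vector_cases:
  assumes "u \<in> R l" "u \<noteq> 0"
  shows "l = 0 \<or> (\<exists>n z. pos n z \<and> l = wt r n) \<or> (\<exists>n z. neg n z \<and> l = - wt r n)"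
proof -
  have "\<not> monomials \<inter> R l \<subseteq> {0}" using span_subset_zero[OF _ root_space_in_span[OF assms(1)]] assms(2) by blast
  then obtain b where b: "b \<in> monomials" "b \<in> R l" "b \<noteq> 0" by blast
  from b show ?thesis by (rule monomial_cases) blast+
qed

lemma root_space_zero: "R 0 = range hm"
proof
  show "range hm \<subseteq> R 0" using hmap_root_space by auto
  have "b \<in> range hm" if b: "b \<in> monomials" "b \<in> R 0" for b
  proof (cases "b = 0")
    case False
    from b False show ?thesis
    proof (rule monomial_cases)
      fix n assume "pos n b" "0 = wt r n"
      then show ?thesis using pos_nonneg[of n b] wt_eq_0_iff[of n] by simp
    next
      fix n assume "neg n b" "0 = - wt r n"
      then show ?thesis using neg_nonneg[of n b] wt_eq_0_iff[of n] by simp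
    qed
  qed (simp add: V.subspace_0[OF subspace_hmap])
  then have "V.span (monomials \<inter> R 0) \<subseteq> range hm"
    by (intro V.span_minimal subspace_hmap) blast
  then show "R 0 \<subseteq> range hm" using root_space_in_span by blast
qed

lemma root_space_pos:
  assumes "u \<in> R (wt r n)" "n i > 0"
  shows "u \<in> V.span {z. pos n z}"
proof -
  have "b \<in> V.span {z. pos n z}" if b: "b \<in> monomials" "b \<in> R (wt r n)" for b
  proof (cases "b = 0")
    case False
    from b False show ?thesis
    proof (rule monomial_cases)
      assume "wt r n = 0"
      then show ?thesis using assms(2) by simp
    next
      fix m assume "pos m b" "wt r n = wt r m"
      then show ?thesis by (auto simp: wt_inj intro: V.span_base)
    next
      fix m assume m: "neg m b" "wt r n = - wt r m"
      then have "n = - m" by (simp add: wt_eq_minus)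
      then show ?thesis using neg_nonneg[OF m(1)] assms(2) by (auto dest: spec[of _ i])
    qed
  qed (simp add: V.span_zero)
  then have "V.span (monomials \<inter> R (wt r n)) \<subseteq> V.span {z. pos n z}"
    by (intro V.span_minimal) (auto intro: V.subspace_span)
  then show ?thesis using root_space_in_span[OF assms(1)] by blast
qed

section \<open>Roots that are multiples of a simple root\<close>

lemma brk_x_double: "br (x j) (br (x j) (x j)) = 0"
proof (cases "p j")
  case zero
  then show ?thesis using even_self_brk[of "x j"] x_par[of j] by simp
next
  case one
  then show ?thesis using odd_cube[of "x j"] x_par[of j] by simp
qed

text \<open>Such a monomial involves \<open>x j\<close> alone, and the chain x_j, [x_j, x_j] stops
  because [x_j, [x_j, x_j]] = 0.\<close>

lemma pos_multiple:
  assumes "pos n z" "\<And>i. i \<noteq> j \<Longrightarrow> n i = 0"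
  shows "n j = 1 \<and> z = x j \<or> n j = 2 \<and> z = br (x j) (x j) \<or> z = 0"
  using assms
proof induction
  case (base n z)
  then obtain i where i: "n = unitv i" "z = x i" by auto
  then have "i = j" using base.prems[of i] by auto
  then show ?case using i by simp
next
  case (step n z i)
  note nn = pos_nonneg[OF step.hyps]
  have "i = j"
  proof (rule ccontr)
    assume "i \<noteq> j"
    then have "n i + 1 = 0" using step.prems[of i] by simp
    moreover have "0 \<le> n i" using nn by blast
    ultimately show False by simp
  qed
  moreover have "n k = 0" if "k \<noteq> j" for k using step.prems[OF that] that \<open>i = j\<close> by simp
  ultimately show ?case using step.IH brk_x_double by auto
qed

lemma root_space_simple: "u \<in> R (r j) \<Longrightarrow> \<exists>c. u = sc c (x j)"
proof -
  assume "u \<in> R (r j)"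
  then have "u \<in> V.span {z. pos (unitv j) z}" using root_space_pos[of u "unitv j" j] by simp
  also have "{z. pos (unitv j) z} \<subseteq> {x j, 0}" using pos_multiple[of "unitv j" _ j] by auto
  then have "V.span {z. pos (unitv j) z} \<subseteq> V.span {x j, 0}" by (rule V.span_mono)
  also have "V.span {x j, 0} = V.span {x j}" by (metis V.span_insert_0 insert_commute)
  finally show ?thesis by (auto simp: V.span_singleton)
qed

lemma root_space_double: "u \<in> R (r j + r j) \<Longrightarrow> \<exists>c. u = sc c (br (x j) (x j))"
proof -
  let ?n = "unitv j + unitv j"
  assume "u \<in> R (r j + r j)"
  then have "u \<in> R (wt r ?n)" by (simp only: wt_add wt_unitv)
  then have "u \<in> V.span {z. pos ?n z}" by (rule root_space_pos[of u ?n j]) simp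
  also have "{z. pos ?n z} \<subseteq> {br (x j) (x j), 0}" using pos_multiple[of ?n _ j] by auto
  then have "V.span {z. pos ?n z} \<subseteq> V.span {br (x j) (x j), 0}" by (rule V.span_mono)
  also have "\<dots> = V.span {br (x j) (x j)}" by (metis V.span_insert_0 insert_commute)
  finally show ?thesis by (auto simp: V.span_singleton)
qed

lemma root_sign:
  assumes "l \<in> roots D G"
  shows "\<exists>n. (\<forall>i. 0 \<le> n i) \<and> (l = wt r n \<or> l = - wt r n)"
proof -
  obtain u where "u \<in> R l" "u \<noteq> 0" "l \<noteq> 0" using assms by (rule rootsE)
  then consider n z where "pos n z" "l = wt r n" | n z where "neg n z" "l = - wt r n"
    using root_vector_cases[of u l] by blast
  then show ?thesis
  proof cases
    case 1
    then show ?thesis using pos_nonneg[OF 1(1)] by blast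
  next
    case 2
    then show ?thesis using neg_nonneg[OF 2(1)] by blast
  qed
qed

lemma root_multiple_pos:
  assumes "wt r n \<in> roots D G" "\<And>i. i \<noteq> j \<Longrightarrow> n i = 0" "n j > 0"
  shows "n j = 1 \<or> n j = 2 \<and> br (x j) (x j) \<noteq> 0"
proof -
  obtain u where u: "u \<in> R (wt r n)" "u \<noteq> 0" using assms(1) by (rule rootsE)
  have "\<not> {z. pos n z} \<subseteq> {0}"
    using root_space_pos[OF u(1) assms(3)] u(2) span_subset_zero by blast
  then obtain z where "pos n z" "z \<noteq> 0" by blast
  then have "n j = 1 \<and> z = x j \<or> n j = 2 \<and> z = br (x j) (x j)"
    using pos_multiple[of n z j] assms(2) by blast
  then show ?thesis using \<open>z \<noteq> 0\<close> by auto
qed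

lemma root_multiple:
  assumes "wt r n \<in> roots D G" "\<And>i. i \<noteq> j \<Longrightarrow> n i = 0"
  shows "n j \<in> {1, 2, -1, -2}"
proof -
  interpret opp: chevalley_family G D "\<lambda>i. - r i" y x p by (rule opposite)
  consider "n j > 0" | "n j = 0" | "n j < 0" by linarith
  then show ?thesis
  proof cases
    case 1
    then show ?thesis using root_multiple_pos[OF assms] by auto
  next
    case 2
    then have "n = 0" using assms(2) by (metis ext zero_fun_apply)
    then show ?thesis using assms(1) by (simp add: roots_def)
  next
    case 3
    have "wt (\<lambda>i. - r i) (- n) = wt r n" by (simp add: wt_opposite wt_minus)
    then show ?thesis using opp.root_multiple_pos[of "- n" j] assms 3 by auto
  qed
qed

lemma pos_has_parity:
  assumes "n i > 0"
  shows "has_parity G (wt r n) (wpar p n)"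
  unfolding has_parity_def
proof
  fix u assume "u \<in> R (wt r n)"
  then have "u \<in> V.span {z. pos n z}" using assms by (rule root_space_pos)
  moreover have "V.span {z. pos n z} \<subseteq> part (wpar p n)"
    by (rule V.span_minimal) (use pos_par part_subspace in auto)
  ultimately show "u \<in> part (wpar p n)" by blast
qed

lemma root_has_parity: "l \<in> roots D G \<Longrightarrow> \<exists>a. has_parity G l a \<and> has_parity G (- l) a"
proof -
  interpret opp: chevalley_family G D "\<lambda>i. - r i" y x p by (rule opposite)
  assume l: "l \<in> roots D G"
  obtain n where n: "\<forall>i. 0 \<le> n i" "l = wt r n \<or> l = - wt r n" using root_sign[OF l] by blast
  have "n \<noteq> 0" using l n by (auto simp: roots_def)
  then obtain i where "n i \<noteq> 0" by (metis ext zero_fun_apply)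
  then have "n i > 0" using n(1) by (simp add: order.not_eq_order_implies_strict)
  then show ?thesis
    using n pos_has_parity[of n i] opp.pos_has_parity[of n i] by (auto simp: wt_opposite)
qed

text \<open>Since every \<open>y j\<close> kills \<open>z\<close>, the vectors raised from
  \<open>z\<close> span an ideal. Their weights stay nonzero and non-negative, so the ideal meets
  the Cartan subalgebra trivially and vanishes by maximality.\<close>

lemma no_singular_vector:
  assumes z: "z \<in> R (wt r n0)" "homogeneous z" and n0: "\<forall>i. 0 \<le> n0 i" "n0 \<noteq> 0"
    and y: "\<And>j. br (y j) z = 0"
  shows "z = 0"
proof -
  let ?Z = "{(n0, z)}"
  define W where "W = {z. \<exists>n. raise G x ?Z n z}"
  obtain a where a: "z \<in> part a" using z(2) by (rule homogeneousE)
  have W_root: "s \<in> R (wt r n)" if "raise G x ?Z n s" for n s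
    using that by (rule raise_root) (use z in auto)
  have hom: "homogeneous s" if s: "s \<in> W" for s
  proof -
    obtain n where "raise G x ?Z n s" using s unfolding W_def by blast
    from raise_par[OF this, of "a + wpar p n0"] a show ?thesis
      by (auto intro!: homogeneousI simp: add.assoc)
  qed
  have "lie_ideal G (V.span W)"
  proof (rule lie_ideal_span[OF generates])
    fix u s assume u: "u \<in> range hm \<union> range x \<union> range y" and s: "s \<in> W"
    obtain n where n: "raise G x ?Z n s" using s by (auto simp: W_def)
    from u consider h where "u = hm h" | j where "u = x j" | j where "u = y j" by blast
    then show "br u s \<in> V.span W"
    proof cases
      case 1
      then show ?thesis using s by (simp add: root_spaceD[OF W_root[OF n]] V.span_scale V.span_base)
    next
      case (2 j)
      then show ?thesis using n by (auto simp: W_def intro!: V.span_base raise.step)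
    next
      case (3 j)
      have "br (y j) s \<in> V.span ({} \<union> {z'. \<exists>n. raise G x ?Z n z'})"
        by (rule lower_raise[OF n]) (use z y in \<open>auto intro: V.span_zero\<close>)
      then show ?thesis by (simp add: 3 W_def)
    qed
  qed (use generator_homogeneous hom in auto)
  moreover have "V.span W \<inter> range hm = {0}"
  proof -
    have "s = 0" if s: "s \<in> W" "s \<in> R 0" for s
    proof (rule ccontr)
      assume "s \<noteq> 0"
      obtain n where n: "raise G x ?Z n s" using s by (auto simp: W_def)
      have "wt r n = 0" by (rule root_space_unique[OF W_root[OF n] s(2) \<open>s \<noteq> 0\<close>])
      moreover have "n \<noteq> 0" using raise_nonneg[OF n] n0 by auto
      ultimately show False by simp
    qed
    then have "W \<inter> R 0 \<subseteq> {0}" by blast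
    moreover have "u \<in> V.span (W \<inter> R 0)" if "u \<in> V.span W" "u \<in> range hm" for u
      by (rule span_weight_component) (use that hmap_root_space W_root in \<open>auto simp: W_def\<close>)
    ultimately have "u = 0" if "u \<in> V.span W" "u \<in> range hm" for u
      using that span_subset_zero by blast
    moreover have "0 \<in> range hm" by (rule V.subspace_0[OF subspace_hmap])
    ultimately show ?thesis using V.span_zero[of W] by blast
  qed
  ultimately have "V.span W = {0}" by (rule no_ideal)
  moreover have "z \<in> V.span W" by (rule V.span_base) (auto simp: W_def intro: raise.base)
  ultimately show ?thesis by simp
qed

end

section \<open>The contragredient Lie superalgebra\<close>

lemma tilde_relation:
  assumes "tilde_superalgebra D T" "F \<in> defining_relations D"
  shows "lin_ext (lscale T) (magma_val T) F = 0"
proof -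
  have "F \<in> free_ideal (lie_identities (gen_par D) \<union> defining_relations D)"
    using assms(2) by (intro free_ideal.base) simp
  then have "free_val T F = 0" using assms(1) by (auto simp: tilde_superalgebra_def)
  then show ?thesis by (simp add: free_val_def lin_ext_def)
qed

lemma tilde_relations:
  fixes T :: "('h::ab_group_add, 'i::finite, 't::ab_group_add) gen_superalg"
  assumes T: "tilde_superalgebra D T"
  shows "hmap T (h + h') = hmap T h + hmap T h'"
    and "hmap T (hscale D c h) = lscale T c (hmap T h)"
    and "lbrk T (hmap T h) (hmap T h') = 0"
    and "lbrk T (hmap T h) (xpos T i) = lscale T (sroot D i h) (xpos T i)"
    and "lbrk T (hmap T h) (xneg T i) = - lscale T (sroot D i h) (xneg T i)"
    and "lbrk T (xpos T i) (xneg T i) = hmap T (scoroot D i)"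
    and "i \<noteq> j \<Longrightarrow> lbrk T (xpos T i) (xneg T j) = 0"
proof -
  interpret L: lie_superalgebra T using T by (simp add: tilde_superalgebra_def)
  note [simp] = L.V.lin_ext_add L.V.lin_ext_diff L.V.lin_ext_scale
  have "fmono (Gen (H (h + h'))) - fmono (Gen (H h)) - fmono (Gen (H h')) \<in> defining_relations D"
    unfolding defining_relations_def
    by (rule UnI1, rule UnI1, rule UnI1, rule UnI1, rule UnI1, rule UnI1, rule CollectI,
        rule exI[of _ h], rule exI[of _ h'], simp)
  from tilde_relation[OF T this] show "hmap T (h + h') = hmap T h + hmap T h'"
    by (simp add: diff_diff_add)
  have "fmono (Gen (H (hscale D c h))) - fscale c (fmono (Gen (H h))) \<in> defining_relations D"
    unfolding defining_relations_def
    by (rule UnI1, rule UnI1, rule UnI1, rule UnI1, rule UnI1, rule UnI2, rule CollectI,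
        rule exI[of _ c], rule exI[of _ h], simp)
  from tilde_relation[OF T this] show "hmap T (hscale D c h) = lscale T c (hmap T h)"
    unfolding L.V.lin_ext_add L.V.lin_ext_diff L.V.lin_ext_scale L.V.lin_ext_fmono by simp
  have "fmono (Mul (Gen (H h)) (Gen (H h'))) \<in> defining_relations D"
    unfolding defining_relations_def
    by (rule UnI1, rule UnI1, rule UnI1, rule UnI1, rule UnI2, rule CollectI,
        rule exI[of _ h], rule exI[of _ h'], simp)
  from tilde_relation[OF T this] show "lbrk T (hmap T h) (hmap T h') = 0" by simp
  have "fmono (Mul (Gen (H h)) (Gen (XP i))) - fscale (sroot D i h) (fmono (Gen (XP i))) \<in> defining_relations D"
    unfolding defining_relations_def
    by (rule UnI1, rule UnI1, rule UnI1, rule UnI2, rule CollectI,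
        rule exI[of _ h], rule exI[of _ i], simp)
  from tilde_relation[OF T this]
  show "lbrk T (hmap T h) (xpos T i) = lscale T (sroot D i h) (xpos T i)" by simp
  have "fmono (Mul (Gen (H h)) (Gen (XM i))) + fscale (sroot D i h) (fmono (Gen (XM i))) \<in> defining_relations D"
    unfolding defining_relations_def
    by (rule UnI1, rule UnI1, rule UnI2, rule CollectI,
        rule exI[of _ h], rule exI[of _ i], simp)
  from tilde_relation[OF T this]
  show "lbrk T (hmap T h) (xneg T i) = - lscale T (sroot D i h) (xneg T i)"
    by (simp add: eq_neg_iff_add_eq_0)
  have "fmono (Mul (Gen (XP i)) (Gen (XM i))) - fmono (Gen (H (scoroot D i))) \<in> defining_relations D"
    unfolding defining_relations_def
    by (rule UnI1, rule UnI2, rule CollectI,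
        rule exI[of _ i], simp)
  from tilde_relation[OF T this] show "lbrk T (xpos T i) (xneg T i) = hmap T (scoroot D i)" by simp
  assume ij: "i \<noteq> j"
  have "fmono (Mul (Gen (XP i)) (Gen (XM j))) \<in> defining_relations D"
    unfolding defining_relations_def
    by (rule UnI2, rule CollectI,
        rule exI[of _ i], rule exI[of _ j], simp add: ij)
  from tilde_relation[OF T this] show "lbrk T (xpos T i) (xneg T j) = 0" by simp
qed

interpretation dual: vector_space dscale
  by unfold_locales (auto simp: dscale_def fun_eq_iff algebra_simps)

lemma sum_dscale_apply: "(\<Sum>j\<in>S. dscale (c j) (r j)) h = (\<Sum>j\<in>S. c j * r j h)"
  by (induction S rule: infinite_finite_induct) (simp_all add: dscale_def)

lemma independent_familyI:
  fixes r :: "'i::finite \<Rightarrow> 'h \<Rightarrow> complex"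
  assumes "inj r" and "\<And>c i. (\<And>h. (\<Sum>j\<in>UNIV. c j * r j h) = 0) \<Longrightarrow> c i = 0"
  shows "\<not> module.dependent dscale (range r)"
proof -
  have "u (r i) = 0" if "(\<Sum>v\<in>range r. dscale (u v) v) = 0" for u i
  proof (rule assms(2))
    fix h
    have "(\<Sum>j\<in>UNIV. dscale (u (r j)) (r j)) = 0"
      using that by (simp add: sum.reindex[OF assms(1)])
    then have "(\<Sum>j\<in>UNIV. dscale (u (r j)) (r j)) h = 0" by simp
    then show "(\<Sum>j\<in>UNIV. u (r j) * r j h) = 0" by (simp add: sum_dscale_apply)
  qed
  then show ?thesis by (auto simp: dual.dependent_finite)
qed

lemma independent_familyD:
  fixes r :: "'i::finite \<Rightarrow> 'h \<Rightarrow> complex"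
  assumes "inj r" and "\<not> module.dependent dscale (range r)" and "\<And>h. (\<Sum>j\<in>UNIV. c j * r j h) = 0"
  shows "c i = 0"
proof -
  have "(\<Sum>j\<in>UNIV. dscale (c j) (r j)) = 0"
    using assms(3) by (auto simp: fun_eq_iff sum_dscale_apply)
  then have "(\<Sum>v\<in>range r. dscale (c (inv r v)) v) = 0"
    using assms(1) by (simp add: sum.reindex)
  then have "c (inv r (r i)) = 0" using assms(2) by (auto simp: dual.dependent_finite)
  then show ?thesis using assms(1) by simp
qed

lemma contragredient_chevalley_family:
  fixes D :: "('h::ab_group_add, 'i::finite) cartan_datum"
    and T :: "('h, 'i, 't::ab_group_add) gen_superalg"
    and G :: "('h, 'i, 'g::ab_group_add) gen_superalg"
  assumes D: "realization D" and C: "contragredient_superalgebra D T G"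
  shows "chevalley_family G D (sroot D) (xpos G) (xneg G) (cpar D)"
    and "\<And>i. lbrk G (xpos G i) (xneg G i) = hmap G (scoroot D i)"
    and "\<And>h. hmap G h = 0 \<Longrightarrow> h = 0"
proof -
  have T: "tilde_superalgebra D T" and "lie_superalgebra G" using C by (auto simp: contragredient_superalgebra_def)
  interpret T: lie_superalgebra T using T by (simp add: tilde_superalgebra_def)
  interpret G: lie_superalgebra G by fact
  interpret hv: vector_space "hscale D" using D by (simp add: realization_def)
  have rd: "\<And>i. in_dual D (sroot D i)"
    and ri: "inj (sroot D)" "\<not> module.dependent dscale (range (sroot D))"
    using D by (auto simp: realization_def)
  obtain \<phi> where \<phi>: "gen_hom T G \<phi>" "surj \<phi>" and K: "greatest_ideal_avoiding_cartan T {x. \<phi> x = 0}"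
    using C by (auto simp: contragredient_superalgebra_def)
  have lin: "\<phi> (u + v) = \<phi> u + \<phi> v" "\<phi> (lscale T c u) = lscale G c (\<phi> u)" for u v c
    using \<phi>(1) by (auto simp: gen_hom_def Vector_Spaces.linear_iff)
  have phi0 [simp]: "\<phi> 0 = 0" using lin(1)[of 0 0] by simp
  have phi_neg [simp]: "\<phi> (- u) = - \<phi> u" for u
    using lin(1)[of "- u" u] by (simp add: eq_neg_iff_add_eq_0)
  have brk: "\<phi> (lbrk T u v) = lbrk G (\<phi> u) (\<phi> v)" for u v using \<phi>(1) by (auto simp: gen_hom_def)
  have part: "u \<in> lpart T a \<Longrightarrow> \<phi> u \<in> lpart G a" for u a using \<phi>(1) by (auto simp: gen_hom_def image_subset_iff)
  have gv: "\<phi> (gen_val T g) = gen_val G g" for g using \<phi>(1) by (auto simp: gen_hom_def)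
  have [simp]: "\<phi> (hmap T h) = hmap G h" "\<phi> (xpos T i) = xpos G i" "\<phi> (xneg T i) = xneg G i" for h i
    using gv[of "H h"] gv[of "XP i"] gv[of "XM i"] by simp_all
  have gpar: "gen_val G g \<in> lpart G (gen_par D g)" for g
    using T part gv by (metis tilde_superalgebra_def)
  note rel = tilde_relations[OF T, THEN arg_cong[of _ _ \<phi>]]
  \<comment> \<open>The kernel of \<open>\<phi>\<close> avoids the Cartan subalgebra of
    \<open>T\<close>, and that subalgebra is a faithful image of \<open>'h\<close> by the word
    representation.\<close>
  show inj: "h = 0" if "hmap G h = 0" for h
  proof -
    have "hmap T h \<in> {x. \<phi> x = 0} \<inter> range (hmap T)" using that by simp
    then have "hmap T h = 0" using K by (auto simp: greatest_ideal_avoiding_cartan_def)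
    then show ?thesis using hmap_tilde_inj[OF T hv.vector_space_axioms rd] by blast
  qed
  have hd: "hmap G (h + h') = hmap G h + hmap G h'" "hmap G (hscale D c h) = lscale G c (hmap G h)" for h h' c
    using rel(1)[of h h'] rel(2)[of c h] by (simp_all add: lin)
  show xy: "lbrk G (xpos G i) (xneg G i) = hmap G (scoroot D i)" for i
    using rel(6)[of i] by (simp add: brk)
  \<comment> \<open>The preimage of \<open>J\<close> is an ideal of \<open>T\<close> avoiding the
    Cartan subalgebra, hence contained in the kernel. Its grading follows from uniqueness of parity
    components in \<open>G\<close>.\<close>
  have no_ideal: "J = {0}" if J: "lie_ideal G J" "J \<inter> range (hmap G) = {0}" for J
  proof -
    let ?K = "{u. \<phi> u \<in> J}"
    have Js: "G.V.subspace J" using J by (simp add: lie_ideal_def)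
    have "T.V.subspace ?K"
      by (rule T.V.subspaceI)
         (auto simp: lin intro: G.V.subspace_0[OF Js] G.V.subspace_add[OF Js] G.V.subspace_scale[OF Js])
    moreover have "\<exists>v\<in>?K \<inter> lpart T 0. \<exists>w\<in>?K \<inter> lpart T 1. u = v + w" if u: "u \<in> ?K" for u
    proof -
      obtain v w where vw: "v \<in> lpart T 0" "w \<in> lpart T 1" "u = v + w" using T.part_sum by blast
      obtain v' w' where vw': "v' \<in> J" "v' \<in> lpart G 0" "w' \<in> J" "w' \<in> lpart G 1" "\<phi> u = v' + w'"
        using J(1) u unfolding lie_ideal_def by blast
      have "\<phi> v + \<phi> w = v' + w'" using vw'(5) unfolding vw(3) lin(1) .
      then have "\<phi> v = v'" "\<phi> w = w'"
        using G.parts_unique[of "\<phi> v" "\<phi> w" v' w'] part[OF vw(1)] part[OF vw(2)] vw'(2,4)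
        by simp_all
      then show ?thesis using vw vw' by blast
    qed
    moreover have "lbrk T u v \<in> ?K" if "v \<in> ?K" for u v
      using J(1) that by (simp add: brk lie_ideal_def)
    ultimately have "lie_ideal T ?K" by (auto simp: lie_ideal_def)
    moreover have "?K \<inter> range (hmap T) = {0}"
    proof -
      have "hmap T h = 0" if "\<phi> (hmap T h) \<in> J" for h
      proof -
        have "hmap G h \<in> J \<inter> range (hmap G)" using that by simp
        then have "hmap G h = 0" unfolding J(2) by simp
        then have "h = 0" by (rule inj)
        then show ?thesis using tilde_relations(1)[OF T, of 0 0] by simp
      qed
      moreover have "hmap T 0 = 0" using tilde_relations(1)[OF T, of 0 0] by simp
      then have "0 \<in> range (hmap T)" by (metis rangeI)
      ultimately show ?thesis using G.V.subspace_0[OF Js] by auto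
    qed
    ultimately have "?K \<subseteq> {x. \<phi> x = 0}" using K by (auto simp: greatest_ideal_avoiding_cartan_def)
    moreover have "u \<in> \<phi> ` ?K" if "u \<in> J" for u
      using that \<phi>(2) by (metis (mono_tags, lifting) image_eqI mem_Collect_eq surjD)
    ultimately show ?thesis using G.V.subspace_0[OF Js] by auto
  qed
  let ?X = "range (hmap G) \<union> range (xpos G) \<union> range (xneg G)"
  have mv: "\<phi> (magma_val T w) = magma_val G w" for w
    by (induction w) (simp_all add: brk gv)
  have mg: "magma_val G w \<in> lie_generated G ?X" for w
  proof (induction w)
    case (Gen g)
    then show ?case by (cases g) (auto intro: lie_generated.gen)
  qed (auto intro: lie_generated.brk)
  have fv: "\<phi> (\<Sum>w\<in>S. lscale T (c w) (magma_val T w)) \<in> lie_generated G ?X" for c S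
    by (induction S rule: infinite_finite_induct)
       (simp_all add: lin mv, auto intro: lie_generated.intros(2-4) mg)
  have "u \<in> lie_generated G ?X" for u
  proof -
    obtain t where "u = \<phi> t" using \<phi>(2) by (metis surjD)
    moreover obtain F where "t = free_val T F" using T by (metis tilde_superalgebra_def surjD)
    ultimately show ?thesis using fv by (simp add: free_val_def)
  qed
  then have gen: "lie_generated G ?X = UNIV" by blast
  show "chevalley_family G D (sroot D) (xpos G) (xneg G) (cpar D)"
  proof unfold_locales
    show "lie_ideal G J \<Longrightarrow> J \<inter> range (hmap G) = {0} \<Longrightarrow> J = {0}" for J by fact
    show "hmap G h \<in> lpart G 0" for h using gpar[of "H h"] by simp
    show "xpos G i \<in> lpart G (cpar D i)" for i using gpar[of "XP i"] by simp
    show "xneg G i \<in> lpart G (cpar D i)" for i using gpar[of "XM i"] by simp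
    show "lbrk G (hmap G h) (hmap G h') = 0" for h h' using rel(3)[of h h'] by (simp add: brk)
    show "xpos G i \<in> root_space G (sroot D i)" for i
      using rel(4)[of _ i] by (simp add: brk lin root_space_def)
    show "xneg G i \<in> root_space G (- sroot D i)" for i
      using rel(5)[of _ i] by (simp add: brk lin root_space_def)
    show "i \<noteq> j \<Longrightarrow> lbrk G (xpos G i) (xneg G j) = 0" for i j
      using rel(7)[of i j] by (simp add: brk)
    show "lbrk G (xpos G i) (xneg G i) \<in> range (hmap G)" for i by (simp add: xy)
    show "(\<And>h. (\<Sum>j\<in>UNIV. c j * sroot D j h) = 0) \<Longrightarrow> c i = 0" for c i
      by (rule independent_familyD[OF ri])
  qed (use hd inj rd gen in auto)
qed

section \<open>Bases and odd reflections\<close>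

context chevalley_family
begin

text \<open>Bracketing [x_i, x_k] with a \<open>y j\<close> leaves only terms with a factor
  \<open>r k (coroot i)\<close> or \<open>r i (coroot k)\<close>. So the bracket is a singular
  vector.\<close>

lemma brk_zero_of_entries:
  assumes "r i (coroot k) = 0" "r k (coroot i) = 0"
  shows "br (x i) (x k) = 0"
proof (rule no_singular_vector[of _ "unitv i + unitv k"])
  show "br (x i) (x k) \<in> R (wt r (unitv i + unitv k))"
    unfolding wt_add wt_unitv by (rule root_space_brk[OF x_root x_root])
  show "homogeneous (br (x i) (x k))" using brk_part[OF x_par x_par] by (rule homogeneousI)
  have "(unitv i + unitv k) i > 0" by (simp add: add_pos_nonneg)
  then show "unitv i + unitv k \<noteq> 0" by (metis less_irrefl zero_fun_apply)
  show "br (y j) (br (x i) (x k)) = 0" for j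
  proof -
    have 1: "br (br (y j) (x i)) (x k) = 0"
      using root_spaceD[OF x_root[of k], of "coroot i"] assms(2)
      by (cases "j = i") (simp_all add: brk_yx brk_yx_coroot brk_scale_left)
    have 2: "br (x i) (br (y j) (x k)) = 0"
      using root_spaceD'[OF x_root[of i], of "coroot k"] assms(1)
      by (cases "j = k") (simp_all add: brk_yx brk_yx_coroot brk_scale_right)
    show ?thesis unfolding jacobi[OF y_par x_par] 1 2 by simp
  qed
qed simp

lemma opposite_coroot: "chevalley_family.coroot G y x i = hscale D (- ssign (p i) (p i)) (coroot i)"
proof -
  interpret opp: chevalley_family G D "\<lambda>i. - r i" y x p by (rule opposite)
  have "hm (opp.coroot i) = hm (hscale D (- ssign (p i) (p i)) (coroot i))"
    using opp.brk_xy_coroot[of i] brk_yx_coroot[of i]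
    unfolding hmap_scale V.scale_minus_left by metis
  then show ?thesis unfolding hmap_eq_iff .
qed

text \<open>The opposite family has the same Cartan matrix up to the sign of the odd rows; in
  particular vanishing of entries carries over.\<close>

lemma opposite_entry: "(- r k) (chevalley_family.coroot G y x i) = ssign (p i) (p i) * r k (coroot i)"
  unfolding opposite_coroot fun_Compl_def linear_dual[OF r_dual] by simp

lemma brk_zero_of_entries_neg:
  assumes "r i (coroot k) = 0" "r k (coroot i) = 0"
  shows "br (y i) (y k) = 0"
proof -
  interpret opp: chevalley_family G D "\<lambda>i. - r i" y x p by (rule opposite)
  show ?thesis by (rule opp.brk_zero_of_entries) (use assms opposite_entry in auto)
qed

text \<open>If \<open>y i\<close> vanished, \<open>x i\<close> would be killed by all
  \<open>y j\<close> and hence be singular.\<close>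

lemma y_nonzero:
  assumes "x i \<noteq> 0" shows "y i \<noteq> 0"
proof
  assume y0: "y i = 0"
  have "x i = 0"
  proof (rule no_singular_vector[of _ "unitv i"])
    fix j show "br (y j) (x i) = 0" using y0 by (cases "j = i") (simp_all add: brk_yx)
  qed (use x_root homogeneousI[OF x_par] in auto)
  then show False using assms by simp
qed

lemma r_root: "x i \<noteq> 0 \<Longrightarrow> r i \<in> roots D G"
  by (rule rootsI[OF x_root _ r_nonzero])

lemma base_with_family:
  assumes "\<And>i. x i \<noteq> 0"
  shows "base_with D G (range r) (x \<circ> inv r) (y \<circ> inv r)"
proof -
  have inv: "inv r (r i) = i" for i using r_inj by simp
  have "(x \<circ> inv r) ` range r = range x" "(y \<circ> inv r) ` range r = range y"
    by (auto simp: inv image_image)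
  then have "chevalley_system D G (range r) (x \<circ> inv r) (y \<circ> inv r)"
    unfolding chevalley_system_def using x_root y_root brk_xy generates by (simp add: inv) metis
  moreover have "\<not> module.dependent dscale (range r)"
    by (rule independent_familyI[OF r_inj]) (rule indep)
  ultimately show ?thesis using r_root assms by (auto simp: base_with_def)
qed

lemma cartan_entry_coroot:
  assumes "X (r i) = x i" "Y (r i) = y i"
  shows "cartan_entry G X Y (r i) l = l (coroot i)"
  unfolding cartan_entry_def using h_brk_eq[OF brk_xy_coroot] assms by simp

lemma coroot_root_space: "u \<in> R l \<Longrightarrow> br (hm (coroot i)) u = sc (l (coroot i)) u"
  by (rule root_spaceD)

end

locale isotropic_simple_root = chevalley_family +
  fixes j
  assumes x_nonzero: "\<And>i. x i \<noteq> 0" and odd: "p j = 1" and isotropic: "r j (coroot j) = 0"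
    and regular: "\<And>i k. r k (coroot i) = 0 \<Longrightarrow> r i (coroot k) = 0"
begin

definition adj where "adj i \<longleftrightarrow> r i (coroot j) \<noteq> 0"
definition r' where "r' i = (if i = j then - r j else if adj i then r j + r i else r i)"
definition x' where "x' i = (if i = j then y j else if adj i then br (x j) (x i) else x i)"
definition y' where "y' i = (if i = j then x j else if adj i then br (y j) (y i) else y i)"
definition p' where "p' i = (if i \<noteq> j \<and> adj i then p j + p i else p i)"

lemma adj_self: "\<not> adj j"
  using isotropic by (simp add: adj_def)

lemma brk_not_adj:
  assumes "\<not> adj i"
  shows "br (x j) (x i) = 0" "br (y j) (y i) = 0" "br (x i) (x j) = 0" "br (y i) (y j) = 0"
proof -
  have "r i (coroot j) = 0" "r j (coroot i) = 0" using assms regular by (auto simp: adj_def)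
  then show "br (x j) (x i) = 0" "br (y j) (y i) = 0" "br (x i) (x j) = 0" "br (y i) (y j) = 0"
    by (simp_all add: brk_zero_of_entries brk_zero_of_entries_neg)
qed

text \<open>For odd x_j, (ad x_j)^2 is half of ad [x_j, x_j], and [x_j, x_j] = 0 because
  \<open>j\<close> is not adjacent to itself.\<close>

lemma square_zero: "br (x j) (br (x j) z) = 0" "br (y j) (br (y j) z) = 0"
  using odd_square[of "x j" z] odd_square[of "y j" z] x_par[of j] y_par[of j] brk_not_adj[OF adj_self]
  by (simp_all add: odd)

text \<open>\<open>y j\<close> undoes \<open>x j\<close> up to a scalar that is nonzero exactly for
  adjacent \<open>i\<close>. This recovers the old generators from the reflected ones.\<close>

lemma recover: "br (y j) (br (x j) (x i)) = sc (r i (coroot j)) (x i)" if "i \<noteq> j"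
  using jacobi[OF y_par[of j] x_par[of j], of "x i"] brk_yx[of j i] that
  by (simp add: brk_yx_coroot odd ssign_def coroot_root_space[OF x_root])

lemma recover_neg: "br (x j) (br (y j) (y i)) = - sc (r i (coroot j)) (y i)" if "i \<noteq> j"
  using jacobi[OF x_par[of j] y_par[of j], of "y i"] brk_xy[of j i] that
  by (simp add: brk_xy_coroot coroot_root_space[OF y_root])

lemma r'_sum:
  "(\<Sum>i\<in>UNIV. c i * r' i h)
     = (\<Sum>i\<in>UNIV. (if i = j then (\<Sum>k\<in>{k. adj k}. c k) - c j else c i) * r i h)"
proof -
  have "(\<Sum>i\<in>UNIV. c i * r' i h)
    = (\<Sum>i\<in>UNIV. (if i = j then - c j * r j h else c i * r i h) + (if adj i then c i * r j h else 0))"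
    by (rule sum.cong) (auto simp: r'_def adj_self algebra_simps)
  also have "\<dots> = (\<Sum>i\<in>UNIV. if i = j then - c j * r j h else c i * r i h)
      + (\<Sum>k\<in>{k. adj k}. c k) * r j h"
    by (simp add: sum.distrib sum.inter_filter[symmetric] sum_distrib_right)
  also have "(\<Sum>k\<in>{k. adj k}. c k) * r j h
    = (\<Sum>i\<in>UNIV. if i = j then (\<Sum>k\<in>{k. adj k}. c k) * r j h else 0)" by simp
  finally show ?thesis unfolding sum.distrib[symmetric]
    by (rule trans) (rule sum.cong, auto simp: algebra_simps)
qed

text \<open>The change of coordinates is an involution, because \<open>j\<close> is not adjacent to
  itself, and it touches the coordinate at \<open>j\<close> only. The persistence of the others is
  what later preserves the sign of imaginary roots.\<close>

lemma wt_r':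
  "wt r' (\<lambda>i. if i = j then (\<Sum>k\<in>{k. adj k}. n k) - n j else n i) = wt r n"
proof
  fix h
  let ?n = "\<lambda>i. if i = j then (\<Sum>k\<in>{k. adj k}. n k) - n j else n i"
  have *: "(\<Sum>k\<in>{k. adj k}. ?n k) = (\<Sum>k\<in>{k. adj k}. n k)"
    by (rule sum.cong) (auto simp: adj_self)
  have "(\<Sum>k\<in>{k. adj k}. complex_of_int (?n k)) = of_int (\<Sum>k\<in>{k. adj k}. n k)"
    unfolding of_int_sum[symmetric] * ..
  then show "wt r' ?n h = wt r n h"
    unfolding wt_def r'_sum by (intro sum.cong) auto
qed

text \<open>In the off-diagonal relations, pairs involving \<open>j\<close> reduce to (ad x_j)^2 =
  0, (ad y_j)^2 = 0 or to non-adjacency; the remaining ones reduce to the old relations. Generation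
  follows from \<open>recover\<close> and \<open>recover_neg\<close>.\<close>

lemma reflected: "chevalley_family G D r' x' y' p'"
proof unfold_locales
  fix c i assume *: "\<And>h. (\<Sum>k\<in>UNIV. c k * r' k h) = 0"
  let ?d = "\<lambda>i. if i = j then (\<Sum>k\<in>{k. adj k}. c k) - c j else c i"
  have d: "?d i = 0" for i by (rule indep) (use * r'_sum in simp)
  then have c: "c k = 0" if "k \<noteq> j" for k using that by (metis)
  then have "(\<Sum>k\<in>{k. adj k}. c k) = 0" using adj_self by (intro sum.neutral ballI) (metis mem_Collect_eq)
  then have "c j = 0" using d[of j] by simp
  then show "c i = 0" using c by (cases "i = j") auto
next
  fix i
  show "in_dual D (r' i)"
    by (rule in_dualI[OF hvs]) (simp_all add: r'_def linear_dual[OF r_dual] algebra_simps)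
  show xr: "x' i \<in> R (r' i)"
    using x_root y_root root_space_brk[OF x_root[of j] x_root[of i]] by (simp add: x'_def r'_def)
  show yr: "y' i \<in> R (- r' i)"
    using x_root y_root root_space_brk[OF y_root[of j] y_root[of i]] by (simp add: y'_def r'_def)
  show "x' i \<in> part (p' i)"
    using x_par y_par brk_part[OF x_par[of j] x_par[of i]] by (simp add: x'_def p'_def)
  show "y' i \<in> part (p' i)"
    using x_par y_par brk_part[OF y_par[of j] y_par[of i]] by (simp add: y'_def p'_def)
  show "br (x' i) (y' i) \<in> range hm"
    using root_space_brk[OF xr yr] root_space_zero by simp
next
  fix i k :: 'c assume ik: "i \<noteq> k"
  have mixed: "br (x i) (br (y j) (y k)) = 0" if "i \<noteq> j" "i \<noteq> k" for i k
    unfolding jacobi[OF x_par y_par] using that by (simp add: brk_xy)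
  have mixed': "br (br (x j) (x i)) (y k) = 0" if "k \<noteq> j" "i \<noteq> k" for i k
    unfolding brk_brk_left[OF x_par x_par] using that brk_xy[of j k] by (simp add: brk_xy)
  \<comment> \<open>Expanding the left bracket, one term contains [x_i, [y_j, y_k]] = 0, and in the
    other x_j turns [y_j, y_k] back into a multiple of y_k, which commutes with x_i.\<close>
  have both: "br (br (x j) (x i)) (br (y j) (y k)) = 0" if "i \<noteq> j" "k \<noteq> j"
    unfolding brk_brk_left[OF x_par x_par] mixed[OF that(1) ik] recover_neg[OF that(2)]
    using ik by (simp add: brk_xy brk_scale_right)
  have xxj: "br (br (x j) (x i)) (x j) = 0"
    using skew[OF brk_part[OF x_par[of j] x_par[of i]] x_par[of j]] square_zero(1) by simp
  show "br (x' i) (y' k) = 0"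
    using ik both mixed[of i k] mixed'[of k i] xxj square_zero(2) brk_not_adj brk_xy[of i k]
    unfolding x'_def y'_def by (auto split: if_splits)
next
  let ?X = "range hm \<union> range x' \<union> range y'"
  have x'j: "y j \<in> lie_generated G ?X" "x j \<in> lie_generated G ?X"
    using lie_generated.gen[of "x' j" ?X G] lie_generated.gen[of "y' j" ?X G] by (auto simp: x'_def y'_def)
  have gx: "x i \<in> lie_generated G ?X" "y i \<in> lie_generated G ?X" for i
  proof -
    consider "i = j" | "i \<noteq> j" "\<not> adj i" | "i \<noteq> j" "adj i" by blast
    then have "x i \<in> lie_generated G ?X \<and> y i \<in> lie_generated G ?X"
    proof cases
      case 1
      then show ?thesis using x'j by simp
    next
      case 2
      then show ?thesis
        using lie_generated.gen[of "x' i" ?X G] lie_generated.gen[of "y' i" ?X G] by (auto simp: x'_def y'_def)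
    next
      case 3
      then have c: "r i (coroot j) \<noteq> 0" by (simp add: adj_def)
      have "br (x j) (x i) \<in> lie_generated G ?X" "br (y j) (y i) \<in> lie_generated G ?X"
        using lie_generated.gen[of "x' i" ?X G] lie_generated.gen[of "y' i" ?X G] 3 by (auto simp: x'_def y'_def)
      then have "br (y j) (br (x j) (x i)) \<in> lie_generated G ?X"
        "br (x j) (br (y j) (y i)) \<in> lie_generated G ?X"
        using x'j by (simp_all add: lie_generated.brk)
      then have "sc (1 / r i (coroot j)) (br (y j) (br (x j) (x i))) \<in> lie_generated G ?X"
        "sc (- 1 / r i (coroot j)) (br (x j) (br (y j) (y i))) \<in> lie_generated G ?X"
        by (blast intro: lie_generated.scale)+
      then show ?thesis using c by (simp add: recover[OF 3(1)] recover_neg[OF 3(1)])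
    qed
    then show "x i \<in> lie_generated G ?X" "y i \<in> lie_generated G ?X" by auto
  qed
  have "range hm \<union> range x \<union> range y \<subseteq> lie_generated G ?X"
    using gx by (auto intro: lie_generated.gen)
  from lie_generated_mono[OF this] show "lie_generated G ?X = UNIV" unfolding generates by auto
qed

lemma x'_nonzero: "x' i \<noteq> 0"
proof -
  have "br (x j) (x i) \<noteq> 0" if "i \<noteq> j" "adj i"
    using recover[OF that(1)] that(2) x_nonzero[of i] by (auto simp: adj_def)
  then show ?thesis using x_nonzero y_nonzero by (auto simp: x'_def)
qed

text \<open>\<open>odd_reflection\<close> tests both entries between two roots and
  \<open>adj\<close> only one; by regularity they vanish together.\<close>

lemma odd_reflection_r':
  assumes "\<And>i k. a (r i) (r k) = r k (coroot i)"
  shows "odd_reflection a (r j) (r i) = r' i"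
  using regular[of i j] regular[of j i] inj_eq[OF r_inj, of j i] isotropic
  by (auto simp: odd_reflection_def assms r'_def adj_def)

end

section \<open>Bases obtained by odd reflections\<close>

context cartan_superalgebra
begin

lemma hmap_brk_even: "br (hm h) (br u v) = br (br (hm h) u) v + br u (br (hm h) v)"
  by (rule even_derivation[OF hmap_even])

lemma nilpotent_last:
  assumes "locally_nilpotent f" "v \<noteq> 0"
  obtains k where "(f ^^ k) v \<noteq> 0" "f ((f ^^ k) v) = 0"
proof -
  obtain N where N: "(f ^^ N) v = 0" using assms(1) by (auto simp: locally_nilpotent_def)
  define M where "M = (LEAST N. (f ^^ N) v = 0)"
  have M: "(f ^^ M) v = 0" unfolding M_def by (rule LeastI[of "\<lambda>N. (f ^^ N) v = 0", OF N])
  then obtain k where k: "M = Suc k" using assms(2) by (cases M) auto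
  have "(f ^^ k) v \<noteq> 0" using not_less_Least[of k "\<lambda>N. (f ^^ N) v = 0"] k M_def by auto
  then show thesis using that[of k] M k by simp
qed

text \<open>For \<open>a = 2\<close> this is integrality of weights for an \<open>sl\<^sub>2\<close>-triple, for \<open>a = 0\<close> it says that
  the centre of a Heisenberg algebra acts by zero if both other generators are locally nilpotent.\<close>

lemma weight_of_nilpotent_triple:
  assumes e: "e \<in> part 0" and ef: "br e f = hm h"
    and he: "br (hm h) e = sc a e" and hf: "br (hm h) f = - sc a f"
    and nil: "locally_nilpotent (br e)" "locally_nilpotent (br f)"
    and v: "v \<noteq> 0" "br (hm h) v = sc c v"
  shows "\<exists>m k. c + of_nat m * a = of_nat k * a / 2"
proof -
  obtain m where m: "(br e ^^ m) v \<noteq> 0" "br e ((br e ^^ m) v) = 0"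
    using nilpotent_last[OF nil(1) v(1)] by blast
  define w where "w = (br e ^^ m) v"
  have "br (hm h) ((br e ^^ k) v) = sc (c + of_nat k * a) ((br e ^^ k) v)" for k
  proof (induction k)
    case (Suc k)
    then show ?case
      by (simp add: hmap_brk_even he brk_scale_left brk_scale_right V.scale_left_distrib
          brk_add_right distrib_right add_ac)
  qed (simp add: v)
  then have hw: "br (hm h) w = sc (c + of_nat m * a) w" by (simp add: w_def)
  define d where "d = c + of_nat m * a"
  have hfk: "br (hm h) ((br f ^^ k) w) = sc (d - of_nat k * a) ((br f ^^ k) w)" for k
  proof (induction k)
    case (Suc k)
    then show ?case
      by (simp add: hmap_brk_even hf brk_scale_left brk_scale_right algebra_simps
          flip: V.scale_left_diff_distrib V.scale_left_distrib)
  qed (simp add: hw d_def)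
  \<comment> \<open>The usual formula for an \<open>sl\<^sub>2\<close>-triple with \<open>a\<close>
    in place of 2. At the last nonzero power of f on w the left side vanishes, which forces d = k a
    / 2.\<close>
  have efk: "br e ((br f ^^ Suc k) w) = sc (of_nat (Suc k) * (d - of_nat k * a / 2)) ((br f ^^ k) w)" for k
  proof (induction k)
    case 0
    then show ?case
      using m(2) hw by (simp add: even_derivation[OF e, of f] ef d_def w_def)
  next
    case (Suc k)
    have "br e ((br f ^^ Suc (Suc k)) w)
      = br (hm h) ((br f ^^ Suc k) w) + br f (br e ((br f ^^ Suc k) w))"
      using even_derivation[OF e, of f "(br f ^^ Suc k) w"] ef by simp
    also have "\<dots> = sc (d - of_nat (Suc k) * a) ((br f ^^ Suc k) w)
       + sc (of_nat (Suc k) * (d - of_nat k * a / 2)) ((br f ^^ Suc k) w)"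
      unfolding hfk Suc.IH by (simp add: brk_scale_right)
    also have "\<dots> = sc (of_nat (Suc (Suc k)) * (d - of_nat (Suc k) * a / 2)) ((br f ^^ Suc k) w)"
      unfolding V.scale_left_distrib[symmetric] by (simp add: field_simps)
    finally show ?case .
  qed
  have "w \<noteq> 0" using m(1) by (simp add: w_def)
  then obtain k where k: "(br f ^^ k) w \<noteq> 0" "br f ((br f ^^ k) w) = 0"
    using nilpotent_last[OF nil(2)] by blast
  then have "sc (of_nat (Suc k) * (d - of_nat k * a / 2)) ((br f ^^ k) w) = 0"
    using efk[of k] by simp
  then have "d - of_nat k * a / 2 = 0" using k(1)
    by (metis V.scale_eq_0_iff mult_eq_0_iff nat.simps(3) of_nat_eq_0_iff)
  then show ?thesis unfolding d_def by (intro exI[of _ m] exI[of _ k]) simp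
qed

end

locale kac_moody = cartan_superalgebra G D + Pi: chevalley_family G D "sroot D" "xpos G" "xneg G" "cpar D"
  for G :: "('h::ab_group_add, 'i::finite, 'g::ab_group_add) gen_superalg"
    and D :: "('h, 'i) cartan_datum" +
  assumes regular_km: "regular_kac_moody D G" and quasisimple: "quasisimple G" and cmat_nonzero: "cmat D \<noteq> 0"
    and xpos_xneg: "\<And>i. lbrk G (xpos G i) (xneg G i) = hmap G (scoroot D i)"
    and scoroot_nonzero: "\<And>i. scoroot D i \<noteq> 0"
    and sroot_scoroot: "\<And>i j. sroot D j (scoroot D i) = cmat D $ i $ j"
begin

definition base_family where
  "base_family r x y p \<longleftrightarrow> chevalley_family G D r x y p \<and> (\<forall>i. x i \<noteq> 0)"

lemma base_familyD: "base_family r x y p \<Longrightarrow> chevalley_family G D r x y p"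
  "base_family r x y p \<Longrightarrow> x i \<noteq> 0"
  by (auto simp: base_family_def)

text \<open>Parities are read off the root spaces, whose homogeneity is known from the initial base.
  The vectors \<open>X\<close> do not vanish, since each spans its root space and that space is
  nonzero.\<close>

lemma family_of_base:
  fixes r :: "'i \<Rightarrow> 'h \<Rightarrow> complex"
  assumes r: "inj r" and base: "base_with D G (range r) X Y"
  obtains p where "base_family r (X \<circ> r) (Y \<circ> r) p"
proof -
  have sub: "\<And>i. r i \<in> roots D G" and ind: "\<not> module.dependent dscale (range r)"
    and ch: "chevalley_system D G (range r) X Y"
    using base by (auto simp: base_with_def)
  have "\<exists>p. \<forall>i. has_parity G (r i) (p i) \<and> has_parity G (- r i) (p i)"
    by (rule choice) (use Pi.root_has_parity[OF sub] in blast)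
  then obtain p where p: "\<And>i. has_parity G (r i) (p i)" "\<And>i. has_parity G (- r i) (p i)" by blast
  have xr: "X (r i) \<in> R (r i)" and yr: "Y (r i) \<in> R (- r i)" for i
    using ch by (auto simp: chevalley_system_def)
  interpret F: chevalley_family G D r "X \<circ> r" "Y \<circ> r" p
  proof unfold_locales
    show "(\<And>h. (\<Sum>j\<in>UNIV. c j * r j h) = 0) \<Longrightarrow> c i = 0" for c i
      by (rule independent_familyD[OF r ind])
    show "in_dual D (r i)" for i using sub by (auto simp: roots_def)
    show "(X \<circ> r) i \<in> R (r i)" "(Y \<circ> r) i \<in> R (- r i)" for i using xr yr by simp_all
    show "(X \<circ> r) i \<in> part (p i)" "(Y \<circ> r) i \<in> part (p i)" for i
      using xr[of i] yr[of i] p(1)[of i] p(2)[of i] by (simp_all add: has_parity_def subset_iff)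
    show "i \<noteq> j \<Longrightarrow> br ((X \<circ> r) i) ((Y \<circ> r) j) = 0" for i j
      using ch r by (auto simp: chevalley_system_def inj_eq)
    show "br ((X \<circ> r) i) ((Y \<circ> r) i) \<in> range hm" for i
      using root_space_brk[OF xr yr, of i i] Pi.root_space_zero by simp
    show "lie_generated G (range hm \<union> range (X \<circ> r) \<union> range (Y \<circ> r)) = UNIV"
      using ch by (simp add: chevalley_system_def image_comp)
  qed
  have "(X \<circ> r) i \<noteq> 0" for i
  proof -
    obtain u where "u \<in> R (r i)" "u \<noteq> 0" using sub by (rule rootsE)
    then show ?thesis using F.root_space_simple by fastforce
  qed
  then show thesis using that F.chevalley_family_axioms by (simp add: base_family_def)
qed

lemma xpos_nonzero: "xpos G i \<noteq> 0"
  using xpos_xneg[of i] hmap_inj[of "scoroot D i"] scoroot_nonzero[of i] by auto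

lemma simple_family: "base_family (sroot D) (xpos G) (xneg G) (cpar D)"
  unfolding base_family_def using Pi.chevalley_family_axioms xpos_nonzero by blast

lemma odd_base_regular:
  assumes "base_family r x y p" "range r \<in> odd_bases D G"
    and "r k (chevalley_family.coroot G x y i) = 0"
  shows "r i (chevalley_family.coroot G x y k) = 0"
proof -
  interpret F: chevalley_family G D r x y p using assms(1) by (rule base_familyD)
  have b: "base_with D G (range r) (x \<circ> inv r) (y \<circ> inv r)"
    by (rule F.base_with_family) (rule base_familyD[OF assms(1)])
  then have "regular_matrix (range r) (cartan_entry G (x \<circ> inv r) (y \<circ> inv r))"
    using regular_km assms(2) by (auto simp: regular_kac_moody_def)
  moreover have "cartan_entry G (x \<circ> inv r) (y \<circ> inv r) (r i) l = l (F.coroot i)" for i l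
    by (rule F.cartan_entry_coroot) (simp_all add: F.r_inj)
  ultimately show ?thesis using assms(3) by (auto simp: regular_matrix_def)
qed

lemma odd_base_admissible:
  assumes "base_family r x y p" "range r \<in> odd_bases D G"
  shows "locally_nilpotent (br (x i))" "locally_nilpotent (br (y i))"
proof -
  interpret F: chevalley_family G D r x y p using assms(1) by (rule base_familyD)
  have "base_with D G (range r) (x \<circ> inv r) (y \<circ> inv r)"
    by (rule F.base_with_family) (rule base_familyD[OF assms(1)])
  then have "admissible_matrix G (range r) (x \<circ> inv r) (y \<circ> inv r)"
    using regular_km assms(2) by (auto simp: regular_kac_moody_def)
  then show "locally_nilpotent (br (x i))" "locally_nilpotent (br (y i))"
    by (auto simp: admissible_matrix_def F.r_inj)
qed

text \<open>\<open>odd_reflects_to\<close> brings its own Chevalley vectors, so the family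
  describing the reflection is part of the conclusion.\<close>

lemma odd_reflection_family:
  assumes r: "inj r" "range r \<in> odd_bases D G" and refl: "odd_reflects_to D G (range r) \<Sigma>'"
  obtains j x y p where "base_family r x y p" "isotropic_simple_root G D r x y p j"
    "\<Sigma>' = range (isotropic_simple_root.r' G r x y j)"
    "base_family (isotropic_simple_root.r' G r x y j) (isotropic_simple_root.x' G r x y j)
       (isotropic_simple_root.y' G r x y j) (isotropic_simple_root.p' G r x y p j)"
proof -
  obtain X Y j where *: "base_with D G (range r) X Y" "has_parity G (r j) 1"
    "cartan_entry G X Y (r j) (r j) = 0"
    "\<Sigma>' = odd_reflection (cartan_entry G X Y) (r j) ` range r"
    using refl unfolding odd_reflects_to_def by blast
  obtain p where f: "base_family r (X \<circ> r) (Y \<circ> r) p" using family_of_base[OF r(1) *(1)] .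
  interpret F: chevalley_family G D r "X \<circ> r" "Y \<circ> r" p using f by (rule base_familyD)
  have ent: "cartan_entry G X Y (r i) l = l (F.coroot i)" for i l
    by (rule F.cartan_entry_coroot) simp_all
  have "(X \<circ> r) j \<in> part 1" using *(2) F.x_root[of j] by (auto simp: has_parity_def)
  then have "p j = 1" using F.x_par[of j] base_familyD(2)[OF f, of j] parts_disjoint
    by (cases "p j") auto
  then interpret I: isotropic_simple_root G D r "X \<circ> r" "Y \<circ> r" p j
    using *(3) base_familyD(2)[OF f] odd_base_regular[OF f r(2)]
    by unfold_locales (auto simp: ent)
  have "\<Sigma>' = range I.r'"
    using *(4) I.odd_reflection_r'[of "cartan_entry G X Y"] by (simp add: ent image_image)
  moreover have "base_family I.r' I.x' I.y' I.p'"
    unfolding base_family_def using I.reflected I.x'_nonzero by blast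
  ultimately show thesis using that[OF f I.isotropic_simple_root_axioms] by blast
qed

lemma odd_bases_family:
  assumes "\<Sigma> \<in> odd_bases D G"
  obtains r x y p where "base_family r x y p" "\<Sigma> = range r"
proof -
  have "\<exists>r x y p. base_family r x y p \<and> \<Sigma> = range r"
    using assms
  proof induction
    case initial
    then show ?case using simple_family by blast
  next
    case (odd \<Sigma> \<Sigma>')
    then obtain r x y p where f: "base_family r x y p" "\<Sigma> = range r" by blast
    have "inj r" using base_familyD(1)[OF f(1)] by (rule chevalley_family.r_inj)
    from odd_reflection_family[OF this, of \<Sigma>'] odd.hyps f(2) show ?case by metis
  qed
  then show thesis using that by blast
qed

section \<open>Isotropic simple roots are odd\<close>

lemma xpos_multiple:
  assumes UNIV: "V.span ({u, v} \<union> range hm) = UNIV" and uv: "u \<in> R l" "v \<in> R (- l)"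
  shows "sroot D i = l \<or> sroot D i = - l"
proof -
  have "xpos G i \<in> V.span (({u, v} \<union> range hm) \<inter> R (sroot D i))"
  proof (rule span_weight_component[OF _ _ Pi.x_root])
    show "\<And>s. s \<in> {u, v} \<union> range hm \<Longrightarrow> \<exists>m. s \<in> R m" using uv hmap_root_space by blast
  qed (use UNIV in auto)
  then obtain b where b: "b \<in> {u, v} \<union> range hm" "b \<in> R (sroot D i)" "b \<noteq> 0"
    using Pi.span_subset_zero xpos_nonzero by (metis (no_types, lifting) IntD1 IntD2 singletonI subsetI)
  have "b \<notin> range hm"
    using root_space_unique[OF _ b(2,3), of 0] hmap_root_space Pi.r_nonzero[of i] by auto
  then have "b = u \<or> b = v" using b(1) by blast
  then show ?thesis using uv root_space_unique[OF b(2) _ b(3)] by blast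
qed

text \<open>If \<open>r j\<close> were even, x_j, y_j and h_j would form a Heisenberg triple of
  locally nilpotent vectors, so every root of the base vanishes on h_j. By regularity
  \<open>r j\<close> vanishes on all coroots, and the triple spans an ideal. Quasisimplicity then
  leaves only \<plusminus> \<open>r j\<close> as simple roots, all coroots are multiples of h_j, and
  the Cartan matrix is zero.\<close>

lemma isotropic_odd:
  assumes f: "base_family r x y p" and r: "range r \<in> odd_bases D G"
    and iso: "r j (chevalley_family.coroot G x y j) = 0"
  shows "p j = 1"
proof (rule ccontr)
  assume "p j \<noteq> 1"
  then have pj: "p j = 0" by simp
  interpret F: chevalley_family G D r x y p using f by (rule base_familyD)
  note x_nz = base_familyD(2)[OF f]
  let ?h = "F.coroot j"
  \<comment> \<open>The case a = 0: the conclusion \<open>c + m * a = k * a / 2\<close> says that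
    the central element h_j has eigenvalue 0.\<close>
  have entry: "r i ?h = 0" for i
  proof -
    have "\<exists>m k. r i ?h + of_nat m * 0 = of_nat k * 0 / 2"
      by (rule weight_of_nilpotent_triple[of "x j" "y j" ?h _ "x i"])
         (use F.x_par[of j] pj F.brk_xy_coroot odd_base_admissible[OF f r] x_nz iso
            F.coroot_root_space[OF F.x_root] F.coroot_root_space[OF F.y_root] in auto)
    then show ?thesis by simp
  qed
  have entry': "r j (F.coroot i) = 0" for i by (rule odd_base_regular[OF f r entry])
  have xx: "br (x i) (x j) = 0" and yy: "br (y i) (y j) = 0" for i
    using F.brk_zero_of_entries F.brk_zero_of_entries_neg entry entry' by auto
  let ?S = "{x j, y j, hm ?h}"
  have hj: "homogeneous s" if "s \<in> ?S" for s
    using that F.x_par[of j] F.y_par[of j] hmap_even by (auto intro: homogeneousI)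
  have J: "lie_ideal G (V.span ?S)"
  proof (rule lie_ideal_span[OF F.generates F.generator_homogeneous hj])
    fix u s assume u: "u \<in> range hm \<union> range x \<union> range y" and s: "s \<in> ?S"
    have base: "s \<in> V.span ?S" if "s \<in> ?S" for s using that by (rule V.span_base)
    have xh: "br (x i) (hm ?h) = 0" and yh: "br (y i) (hm ?h) = 0" for i
      using root_spaceD'[OF F.x_root] root_spaceD'[OF F.y_root] entry by simp_all
    have xy: "br (x i) (y j) \<in> V.span ?S" for i
      by (cases "i = j") (simp_all add: F.brk_xy F.brk_xy_coroot V.span_zero base)
    have yx: "br (y i) (x j) \<in> V.span ?S" for i
      using F.span_neg_scale_base[of "hm ?h" ?S]
      by (cases "i = j") (simp_all add: F.brk_yx F.brk_yx_coroot V.span_zero)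
    have hs: "br (hm h) s \<in> V.span ?S" for h
    proof -
      have "\<exists>l. s \<in> R l" using s F.x_root F.y_root hmap_root_space by blast
      then obtain l where "s \<in> R l" by blast
      from root_spaceD[OF this] show ?thesis using base[OF s] by (simp add: V.span_scale)
    qed
    from u consider h where "u = hm h" | i where "u = x i" | i where "u = y i" by blast
    then show "br u s \<in> V.span ?S"
    proof cases
      case 1
      then show ?thesis using hs by simp
    next
      case (2 i)
      then show ?thesis using s xx[of i] xy[of i] xh[of i] V.span_zero by (elim insertE) simp_all
    next
      case (3 i)
      then show ?thesis using s yy[of i] yx[of i] yh[of i] V.span_zero by (elim insertE) simp_all
    qed
  qed auto
  have "x j \<notin> range hm"
    using root_space_unique[OF F.x_root[of j] _ x_nz, of 0] hmap_root_space F.r_nonzero[of j] by auto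
  moreover have "x j \<in> V.span ?S" by (rule V.span_base) simp
  ultimately have "{u + v | u v. u \<in> V.span ?S \<and> v \<in> range hm} = UNIV"
    using quasisimple J unfolding quasisimple_def by blast
  moreover have "V.span ?S \<subseteq> V.span ({x j, y j} \<union> range hm)"
    by (rule V.span_mono) auto
  moreover have "range hm \<subseteq> V.span ({x j, y j} \<union> range hm)" by (auto intro: V.span_base)
  ultimately have span: "V.span ({x j, y j} \<union> range hm) = UNIV"
  proof -
    assume *: "{u + v | u v. u \<in> V.span ?S \<and> v \<in> range hm} = UNIV"
      "V.span ?S \<subseteq> V.span ({x j, y j} \<union> range hm)" "range hm \<subseteq> V.span ({x j, y j} \<union> range hm)"
    have "z \<in> V.span ({x j, y j} \<union> range hm)" for z
    proof -
      have "z \<in> {u + v | u v. u \<in> V.span ?S \<and> v \<in> range hm}" unfolding *(1) by simp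
      then obtain u v where "z = u + v" "u \<in> V.span ?S" "v \<in> range hm" by blast
      then show ?thesis using *(2,3) by (auto intro: V.span_add)
    qed
    then show ?thesis by blast
  qed
  have sr: "sroot D i = r j \<or> sroot D i = - r j" for i
    by (rule xpos_multiple[OF span F.x_root F.y_root])
  have y_s: "\<exists>c. u = sc c (y j)" if "u \<in> R (- r j)" for u
  proof -
    interpret opp: chevalley_family G D "\<lambda>i. - r i" y x p by (rule F.opposite)
    show ?thesis by (rule opp.root_space_simple[OF that])
  qed
  \<comment> \<open>The root spaces of \<open>r j\<close> and its negative are spanned by
    \<open>x j\<close> and \<open>y j\<close>, so [\<open>xpos G i\<close>, \<open>xneg G i\<close>]
    is a multiple of h_j.\<close>
  have "\<exists>c. scoroot D i = hscale D c ?h" for i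
  proof -
    have "\<exists>c. br (xpos G i) (xneg G i) = sc c (hm ?h)"
    proof (cases "sroot D i = r j")
      case True
      then obtain a b where "xpos G i = sc a (x j)" "xneg G i = sc b (y j)"
        using F.root_space_simple[of "xpos G i" j] y_s[of "xneg G i"] Pi.x_root[of i] Pi.y_root[of i] by auto
      then show ?thesis by (auto simp: brk_scale_left brk_scale_right F.brk_xy_coroot)
    next
      case False
      then have "sroot D i = - r j" using sr by blast
      then obtain a b where "xpos G i = sc a (y j)" "xneg G i = sc b (x j)"
        using F.root_space_simple[of "xneg G i" j] y_s[of "xpos G i"] Pi.x_root[of i] Pi.y_root[of i] by auto
      then have "br (xpos G i) (xneg G i) = sc (- (a * b * ssign (p j) (p j))) (hm ?h)"
        by (simp add: brk_scale_left brk_scale_right F.brk_yx_coroot)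
      then show ?thesis by blast
    qed
    then show ?thesis unfolding xpos_xneg hmap_scale[symmetric] hmap_eq_iff .
  qed
  then have "sroot D k (scoroot D i) = 0" for i k
  proof -
    obtain c where "scoroot D i = hscale D c ?h" using \<open>\<exists>c. scoroot D i = hscale D c ?h\<close> by blast
    then show ?thesis using sr[of k] entry[of j] by (auto simp: linear_dual[OF F.r_dual])
  qed
  then have "cmat D = 0" by (simp add: sroot_scoroot vec_eq_iff)
  then show False using cmat_nonzero by simp
qed

end

section \<open>Exponentials of locally nilpotent derivations\<close>

context lie_superalgebra
begin

text \<open>The exponential series cut at the first vanishing power, a bound that varies with
  \<open>z\<close>. By \<open>nexp_eq\<close> every later cut gives the same value, so several
  vectors can share one bound.\<close>

definition nexp :: "('g \<Rightarrow> 'g) \<Rightarrow> 'g \<Rightarrow> 'g" where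
  "nexp d z = (\<Sum>k<(LEAST N. (d ^^ N) z = 0). sc (1 / fact k) ((d ^^ k) z))"

definition nil_linear :: "('g \<Rightarrow> 'g) \<Rightarrow> bool" where
  "nil_linear d \<longleftrightarrow> (\<forall>u v. d (u + v) = d u + d v) \<and> (\<forall>c u. d (sc c u) = sc c (d u)) \<and> locally_nilpotent d"

context
  fixes d assumes d: "nil_linear d"
begin

lemma nil_add: "d (u + v) = d u + d v" and nil_scale: "d (sc c u) = sc c (d u)"
  using d by (auto simp: nil_linear_def)

lemma nil_zero: "d 0 = 0"
  using nil_add[of 0 0] by simp

lemma nil_sum: "d (sum f S) = (\<Sum>i\<in>S. d (f i))"
  by (induction S rule: infinite_finite_induct) (simp_all add: nil_zero nil_add)

lemma nil_pow_add: "(d ^^ n) (u + v) = (d ^^ n) u + (d ^^ n) v"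
  and nil_pow_scale: "(d ^^ n) (sc c u) = sc c ((d ^^ n) u)"
  and nil_pow_zero: "(d ^^ n) 0 = 0"
  by (induction n) (simp_all add: nil_add nil_scale nil_zero)

lemma nil_pow_mono:
  assumes "(d ^^ N) z = 0" "N \<le> M" shows "(d ^^ M) z = 0"
proof -
  have "(d ^^ M) z = (d ^^ (M - N)) ((d ^^ N) z)"
    using assms(2) by (simp add: funpow_add[symmetric, THEN fun_cong, simplified comp_apply])
  then show ?thesis by (simp add: assms(1) nil_pow_zero)
qed

lemma nil_bound: "\<exists>N. \<forall>M\<ge>N. (d ^^ M) z = 0"
  using d nil_pow_mono unfolding nil_linear_def locally_nilpotent_def by meson

lemma nexp_eq:
  assumes "(d ^^ N) z = 0"
  shows "nexp d z = (\<Sum>k<N. sc (1 / fact k) ((d ^^ k) z))"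
  unfolding nexp_def
proof (rule sum.mono_neutral_left)
  let ?L = "LEAST N. (d ^^ N) z = 0"
  have "?L \<le> N" by (rule Least_le) (rule assms)
  then show "{..<?L} \<subseteq> {..<N}" by auto
  have L: "(d ^^ ?L) z = 0" by (rule LeastI[of "\<lambda>N. (d ^^ N) z = 0", OF assms])
  show "\<forall>i\<in>{..<N} - {..<?L}. sc (1 / fact i) ((d ^^ i) z) = 0"
    using nil_pow_mono[OF L] by auto
qed simp

lemma nexp_add: "nexp d (u + v) = nexp d u + nexp d v"
proof -
  obtain N where N: "\<And>M. N \<le> M \<Longrightarrow> (d ^^ M) u = 0" using nil_bound[of "u"] by blast
  obtain N' where N': "\<And>M. N' \<le> M \<Longrightarrow> (d ^^ M) v = 0" using nil_bound[of "v"] by blast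
  let ?M = "max N N'"
  have z: "(d ^^ ?M) u = 0" "(d ^^ ?M) v = 0" using N N' by simp_all
  then have "(d ^^ ?M) (u + v) = 0" by (simp add: nil_pow_add)
  then show ?thesis
    unfolding nexp_eq[OF z(1)] nexp_eq[OF z(2)] nexp_eq[of ?M]
    by (simp add: nexp_eq nil_pow_add V.scale_right_distrib sum.distrib)
qed

lemma nexp_scale: "nexp d (sc c u) = sc c (nexp d u)"
proof -
  obtain N where N: "\<And>M. N \<le> M \<Longrightarrow> (d ^^ M) u = 0" using nil_bound[of "u"] by blast
  then have z: "(d ^^ N) u = 0" by simp
  then have zc: "(d ^^ N) (sc c u) = 0" by (simp add: nil_pow_scale)
  show ?thesis
    unfolding nexp_eq[OF z] nexp_eq[OF zc] by (simp add: nil_pow_scale V.scale_sum_right mult.commute)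
qed

lemma nexp_zero: "nexp d 0 = 0"
  using nexp_add[of 0 0] by simp

lemma nexp_sum: "nexp d (sum f S) = (\<Sum>i\<in>S. nexp d (f i))"
  by (induction S rule: infinite_finite_induct) (simp_all add: nexp_zero nexp_add)

lemma nexp_part:
  assumes "\<And>u. u \<in> part a \<Longrightarrow> d u \<in> part a" "u \<in> part a"
  shows "nexp d u \<in> part a"
proof -
  have "(d ^^ k) u \<in> part a" for k by (induction k) (use assms in auto)
  then show ?thesis unfolding nexp_def
    by (intro V.subspace_sum[OF part_subspace] part_scale)
qed

text \<open>A nonzero term has i, j < N and hence i + j < 2 N, so the square and the triangle differ
  by zero terms only.\<close>

lemma sum_square_antidiagonal:
  fixes g :: "nat \<Rightarrow> nat \<Rightarrow> 'g"
  assumes "\<And>i j. N \<le> i \<or> N \<le> j \<Longrightarrow> g i j = 0"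
  shows "(\<Sum>i<N. \<Sum>j<N. g i j) = (\<Sum>n<2 * N. \<Sum>i\<le>n. g i (n - i))"
proof -
  have g: "i < N \<and> j < N" if "g i j \<noteq> 0" for i j
    using assms[of i j] that by (meson not_le)
  have "(\<Sum>i<N. \<Sum>j<N. g i j) = (\<Sum>(i, j)\<in>{..<N} \<times> {..<N}. g i j)"
    by (simp add: sum.cartesian_product)
  also have "\<dots> = (\<Sum>(i, j)\<in>{(i, j). i + j < 2 * N}. g i j)"
  proof (rule sum.mono_neutral_left)
    have "{(i, j). i + j < 2 * N} \<subseteq> {..<2 * N} \<times> {..<2 * N}" by auto
    then show "finite {(i, j). i + j < 2 * N}" by (rule finite_subset) simp
  qed (use g in auto)
  also have "\<dots> = (\<Sum>n<2 * N. \<Sum>i\<le>n. g i (n - i))" by (rule sum.triangle_reindex)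
  finally show ?thesis .
qed

text \<open>In the divided powers d^n / n! the rule has no binomial coefficients. In the induction
  step a term receives the factors i and n + 1 - i, which add up to n + 1.\<close>

lemma leibniz:
  assumes der: "\<And>u v. d (br u v) = br (d u) v + br u (d v)"
  shows "sc (1 / fact n) ((d ^^ n) (br u v))
    = (\<Sum>i\<le>n. br (sc (1 / fact i) ((d ^^ i) u)) (sc (1 / fact (n - i)) ((d ^^ (n - i)) v)))"
proof (induction n)
  case (Suc n)
  let ?a = "\<lambda>i. sc (1 / fact i) ((d ^^ i) u)" and ?b = "\<lambda>i. sc (1 / fact i) ((d ^^ i) v)"
  have da: "d (?a i) = sc (of_nat (Suc i)) (?a (Suc i))" and db: "d (?b i) = sc (of_nat (Suc i)) (?b (Suc i))" for i
    by (simp_all add: nil_scale del: of_nat_Suc)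
  have "d (\<Sum>i\<le>n. br (?a i) (?b (n - i)))
    = (\<Sum>i\<le>n. sc (of_nat (Suc i)) (br (?a (Suc i)) (?b (n - i))))
      + (\<Sum>i\<le>n. sc (of_nat (Suc (n - i))) (br (?a i) (?b (Suc (n - i)))))"
    unfolding nil_sum der da db sum.distrib brk_scale_left[of "of_nat _"] brk_scale_right[of _ "of_nat _"] ..
  also have "(\<Sum>i\<le>n. sc (of_nat (Suc i)) (br (?a (Suc i)) (?b (n - i))))
    = (\<Sum>i\<le>Suc n. sc (of_nat i) (br (?a i) (?b (Suc n - i))))"
    unfolding sum.atMost_Suc_shift[of "\<lambda>i. sc (of_nat i) (br (?a i) (?b (Suc n - i)))"] by simp
  also have "(\<Sum>i\<le>n. sc (of_nat (Suc (n - i))) (br (?a i) (?b (Suc (n - i)))))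
    = (\<Sum>i\<le>Suc n. sc (of_nat (Suc n - i)) (br (?a i) (?b (Suc n - i))))"
    by (simp add: Suc_diff_le del: of_nat_Suc of_nat_diff)
  also have "(\<Sum>i\<le>Suc n. sc (of_nat i) (br (?a i) (?b (Suc n - i)))) + \<dots>
    = sc (of_nat (Suc n)) (\<Sum>i\<le>Suc n. br (?a i) (?b (Suc n - i)))"
    unfolding sum.distrib[symmetric] V.scale_sum_right V.scale_left_distrib[symmetric] of_nat_add[symmetric]
    by (rule sum.cong) simp_all
  finally have eq1: "d (sc (1 / fact n) ((d ^^ n) (br u v)))
      = sc (of_nat (Suc n)) (\<Sum>i\<le>Suc n. br (?a i) (?b (Suc n - i)))"
    unfolding Suc.IH .
  have eq2: "d (sc (1 / fact n) ((d ^^ n) (br u v)))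
      = sc (of_nat (Suc n)) (sc (1 / fact (Suc n)) ((d ^^ Suc n) (br u v)))"
    by (simp add: nil_scale del: of_nat_Suc)
  have eq: "sc (of_nat (Suc n)) (sc (1 / fact (Suc n)) ((d ^^ Suc n) (br u v)))
      = sc (of_nat (Suc n)) (\<Sum>i\<le>Suc n. br (?a i) (?b (Suc n - i)))"
    by (rule trans[OF eq2[symmetric] eq1])
  show ?case by (rule V.scale_left_imp_eq[OF _ eq]) (simp del: of_nat_Suc)
qed simp

lemma nexp_brk:
  assumes der: "\<And>u v. d (br u v) = br (d u) v + br u (d v)"
  shows "nexp d (br u v) = br (nexp d u) (nexp d v)"
proof -
  let ?a = "\<lambda>i. sc (1 / fact i) ((d ^^ i) u)" and ?b = "\<lambda>i. sc (1 / fact i) ((d ^^ i) v)"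
  obtain N where N: "\<And>M. N \<le> M \<Longrightarrow> (d ^^ M) u = 0" using nil_bound[of "u"] by blast
  obtain N' where N': "\<And>M. N' \<le> M \<Longrightarrow> (d ^^ M) v = 0" using nil_bound[of "v"] by blast
  obtain N'' where N'': "\<And>M. N'' \<le> M \<Longrightarrow> (d ^^ M) (br u v) = 0" using nil_bound[of "(br u v)"] by blast
  define K where "K = max N'' (max N N')"
  have z: "(d ^^ K) u = 0" "(d ^^ K) v = 0" "(d ^^ (2 * K)) (br u v) = 0"
    using N N' N'' by (simp_all add: K_def)
  have "br (nexp d u) (nexp d v) = (\<Sum>i<K. \<Sum>j<K. br (?a i) (?b j))"
    unfolding nexp_eq[OF z(1)] nexp_eq[OF z(2)] brk_sum_left brk_sum_right by (rule sum.swap)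
  also have "\<dots> = (\<Sum>n<2 * K. \<Sum>i\<le>n. br (?a i) (?b (n - i)))"
    by (rule sum_square_antidiagonal) (use N N' in \<open>auto simp: K_def\<close>)
  also have "\<dots> = nexp d (br u v)"
    unfolding nexp_eq[OF z(3)] leibniz[OF der] ..
  finally show ?thesis ..
qed

end

lemma nil_linear_minus:
  assumes "nil_linear d" shows "nil_linear (\<lambda>z. - d z)" "((\<lambda>z. - d z) ^^ k) z = sc ((-1) ^ k) ((d ^^ k) z)"
proof -
  show pow: "((\<lambda>z. - d z) ^^ k) z = sc ((-1) ^ k) ((d ^^ k) z)" for k z
    by (induction k) (simp_all add: nil_scale[OF assms])
  have "locally_nilpotent (\<lambda>z. - d z)"
    using assms by (simp add: nil_linear_def locally_nilpotent_def pow)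
  then show "nil_linear (\<lambda>z. - d z)" using assms by (simp add: nil_linear_def)
qed

lemma nexp_minus_inverse:
  assumes d: "nil_linear d"
  shows "nexp d (nexp (\<lambda>z. - d z) z) = z"
proof -
  obtain N where N: "\<And>M. N \<le> M \<Longrightarrow> (d ^^ M) z = 0" using nil_bound[OF d, of z] by blast
  \<comment> \<open>\<open>Suc\<close> makes \<open>K\<close> positive, so that the term n = 0
    occurs among n < 2 K even when N = 0.\<close>
  define K where "K = Suc N"
  have z: "(d ^^ K) z = 0" by (rule N) (simp add: K_def)
  have pc: "(d ^^ l) ((d ^^ k) z) = (d ^^ (k + l)) z" for k l
    by (metis add.commute comp_apply funpow_add)
  have zk: "(d ^^ K) ((d ^^ k) z) = 0" for k
  proof -
    have "N \<le> K + k" by (simp add: K_def)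
    from N[OF this] show ?thesis by (simp add: funpow_add)
  qed
  have zm: "((\<lambda>z. - d z) ^^ K) z = 0" by (simp add: nil_linear_minus(2)[OF d] z)
  have m: "nexp (\<lambda>z. - d z) z = (\<Sum>k<K. sc ((-1) ^ k / fact k) ((d ^^ k) z))"
    unfolding nexp_eq[OF nil_linear_minus(1)[OF d] zm] by (simp add: nil_linear_minus(2)[OF d])
  have "nexp d (nexp (\<lambda>z. - d z) z)
    = (\<Sum>k<K. \<Sum>l<K. sc ((-1) ^ k / fact k * (1 / fact l)) ((d ^^ (k + l)) z))"
    unfolding m nexp_sum[OF d] nexp_scale[OF d] nexp_eq[OF d zk] V.scale_sum_right pc
    by simp
  also have "\<dots> = (\<Sum>n<2 * K. \<Sum>k\<le>n. sc ((-1) ^ k / fact k * (1 / fact (n - k))) ((d ^^ (k + (n - k))) z))"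
    by (rule sum_square_antidiagonal[OF d]) (use N in \<open>auto simp: K_def\<close>)
  also have "\<dots> = (\<Sum>n<2 * K. sc (\<Sum>k\<le>n. (-1) ^ k / fact k * (1 / fact (n - k))) ((d ^^ n) z))"
    unfolding V.scale_sum_left by (intro sum.cong) auto
  also have "\<dots> = (\<Sum>n<2 * K. if n = 0 then z else 0)"
  proof (rule sum.cong)
    fix n
    \<comment> \<open>The coefficient of d^n is an alternating sum of binomial coefficients divided
      by n!, which vanishes for n > 0.\<close>
    have "(\<Sum>k\<le>n. (-1) ^ k / fact k * (1 / fact (n - k)))
      = (1 / fact n) * (\<Sum>k\<le>n. (-1) ^ k * of_nat (n choose k) :: complex)"
      unfolding sum_distrib_left by (rule sum.cong) (auto simp: binomial_fact field_simps)
    then show "sc (\<Sum>k\<le>n. (-1) ^ k / fact k * (1 / fact (n - k))) ((d ^^ n) z) = (if n = 0 then z else 0)"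
      using choose_alternating_sum[of n, where ?'a = complex] by (cases "n = 0") simp_all
  qed simp
  also have "\<dots> = z" by (simp add: K_def sum.delta)
  finally show ?thesis .
qed

lemma nil_linear_brk: "locally_nilpotent (br e) \<Longrightarrow> nil_linear (br e)"
  by (simp add: nil_linear_def brk_add_right brk_scale_right)

lemma nexp_1: "nil_linear d \<Longrightarrow> d z = 0 \<Longrightarrow> nexp d z = z"
  using nexp_eq[of d 1 z] by simp

lemma nexp_2: "nil_linear d \<Longrightarrow> d (d z) = 0 \<Longrightarrow> nexp d z = z + d z"
  using nexp_eq[of d 2 z] by (simp add: numeral_2_eq_2)

lemma nexp_3: "nil_linear d \<Longrightarrow> d (d (d z)) = 0 \<Longrightarrow> nexp d z = z + d z + sc (1/2) (d (d z))"
  using nexp_eq[of d 3 z] by (simp add: numeral_3_eq_3)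

lemma locally_nilpotent_scale:
  assumes "locally_nilpotent (br u)" shows "locally_nilpotent (br (sc c u))"
proof -
  have "(br (sc c u) ^^ n) z = sc (c ^ n) ((br u ^^ n) z)" for n z
    by (induction n) (simp_all add: brk_scale_left brk_scale_right)
  then show ?thesis using assms unfolding locally_nilpotent_def by (metis V.scale_zero_right)
qed

text \<open>For odd \<open>u\<close> one has ad [u, u] = 2 (ad u)^2.\<close>

lemma locally_nilpotent_square:
  assumes "locally_nilpotent (br u)" "u \<in> part 1"
  shows "locally_nilpotent (br (br u u))"
proof -
  have "br (br u u) z = sc 2 (br u (br u z))" for z
    using odd_square[OF assms(2), of z] by simp
  then have "(br (br u u) ^^ n) z = sc (2 ^ n) ((br u ^^ (2 * n)) z)" for n z
    by (induction n) (simp_all add: brk_scale_right)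
  moreover have "(br u ^^ (2 * n)) z = 0" if "(br u ^^ n) z = 0" for n z
    using that nil_pow_mono[OF nil_linear_brk[OF assms(1)] that, of "2 * n"] by simp
  ultimately show ?thesis using assms(1) unfolding locally_nilpotent_def by (metis V.scale_zero_right)
qed

end

section \<open>Lifts of reflections to automorphisms\<close>

context cartan_superalgebra
begin

text \<open>\<open>\<phi>\<close> is an even endomorphism, \<open>\<theta>\<close> its effect on
  \<hh>, and \<open>\<kappa>\<close> is meant to be the inverse of \<open>\<theta>\<close>, so that
  \<open>w\<close> is the induced map on weights. Since \<open>w\<close> acts on arbitrary
  functions, it is constrained on linear ones only.\<close>

definition half_lift where
  "half_lift w \<phi> \<theta> \<kappa> \<longleftrightarrow>
     (\<forall>u v. \<phi> (u + v) = \<phi> u + \<phi> v) \<and> (\<forall>c u. \<phi> (sc c u) = sc c (\<phi> u)) \<and>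
     (\<forall>u v. \<phi> (br u v) = br (\<phi> u) (\<phi> v)) \<and> (\<forall>a u. u \<in> part a \<longrightarrow> \<phi> u \<in> part a) \<and>
     (\<forall>h. \<phi> (hm h) = hm (\<theta> h)) \<and> (\<forall>l. in_dual D l \<longrightarrow> w l = l \<circ> \<kappa> \<and> in_dual D (l \<circ> \<kappa>))"

definition lift_by where
  "lift_by w wi \<phi> \<psi> \<theta> \<kappa> \<longleftrightarrow> half_lift w \<phi> \<theta> \<kappa> \<and> half_lift wi \<psi> \<kappa> \<theta> \<and>
     (\<forall>u. \<phi> (\<psi> u) = u) \<and> (\<forall>u. \<psi> (\<phi> u) = u) \<and> (\<forall>h. \<theta> (\<kappa> h) = h) \<and> (\<forall>h. \<kappa> (\<theta> h) = h)"

definition lift where "lift w wi \<longleftrightarrow> (\<exists>\<phi> \<psi> \<theta> \<kappa>. lift_by w wi \<phi> \<psi> \<theta> \<kappa>)"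

lemma lift_by_sym: "lift_by w wi \<phi> \<psi> \<theta> \<kappa> \<Longrightarrow> lift_by wi w \<psi> \<phi> \<kappa> \<theta>"
  by (auto simp: lift_by_def)

lemma lift_id: "lift id id"
  unfolding lift_def lift_by_def half_lift_def
  by (intro exI[of _ id]) auto

lemma half_lift_comp:
  "half_lift w \<phi> \<theta> \<kappa> \<Longrightarrow> half_lift w' \<phi>' \<theta>' \<kappa>' \<Longrightarrow> half_lift (w \<circ> w') (\<phi> \<circ> \<phi>') (\<theta> \<circ> \<theta>') (\<kappa>' \<circ> \<kappa>)"
  unfolding half_lift_def by (simp add: o_assoc)

lemma lift_comp: "lift w wi \<Longrightarrow> lift w' wi' \<Longrightarrow> lift (w \<circ> w') (wi' \<circ> wi)"
proof -
  assume "lift w wi" "lift w' wi'"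
  then obtain \<phi> \<psi> \<theta> \<kappa> \<phi>' \<psi>' \<theta>' \<kappa>' where *: "lift_by w wi \<phi> \<psi> \<theta> \<kappa>" "lift_by w' wi' \<phi>' \<psi>' \<theta>' \<kappa>'"
    unfolding lift_def by blast
  then have "lift_by (w \<circ> w') (wi' \<circ> wi) (\<phi> \<circ> \<phi>') (\<psi>' \<circ> \<psi>) (\<theta> \<circ> \<theta>') (\<kappa>' \<circ> \<kappa>)"
    unfolding lift_by_def using half_lift_comp by simp
  then show ?thesis unfolding lift_def by blast
qed

context
  fixes w wi \<phi> \<psi> \<theta> \<kappa> assumes l: "lift_by w wi \<phi> \<psi> \<theta> \<kappa>"
begin

lemma lift_simps:
  "\<phi> (u + v) = \<phi> u + \<phi> v" "\<phi> (sc c u) = sc c (\<phi> u)" "\<phi> (br u v) = br (\<phi> u) (\<phi> v)" "\<phi> (hm h) = hm (\<theta> h)"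
  "\<phi> (\<psi> u) = u" "\<psi> (\<phi> u) = u" "\<theta> (\<kappa> h) = h" "\<kappa> (\<theta> h) = h"
  using l by (auto simp: lift_by_def half_lift_def)

lemma lift_part: "u \<in> part a \<Longrightarrow> \<phi> u \<in> part a"
  using l by (auto simp: lift_by_def half_lift_def)

lemma lift_apply: "in_dual D m \<Longrightarrow> w m = m \<circ> \<kappa>"
  and lift_dual: "in_dual D m \<Longrightarrow> in_dual D (w m)"
  using l by (auto simp: lift_by_def half_lift_def)

lemma lift_inverse: "in_dual D m \<Longrightarrow> wi (w m) = m"
proof -
  assume m: "in_dual D m"
  then have "wi (w m) = w m \<circ> \<theta>" using l lift_dual by (auto simp: lift_by_def half_lift_def)
  then show ?thesis using lift_apply[OF m] by (auto simp: lift_simps)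
qed

lemma lift_zero: "\<phi> 0 = 0"
  using lift_simps(1)[of 0 0] by simp

lemma lift_root_space: "in_dual D m \<Longrightarrow> u \<in> R m \<Longrightarrow> \<phi> u \<in> R (w m)"
proof (rule root_spaceI)
  fix h assume m: "in_dual D m" "u \<in> R m"
  have "br (hm h) (\<phi> u) = \<phi> (br (hm (\<kappa> h)) u)" by (simp add: lift_simps)
  also have "\<dots> = sc (w m h) (\<phi> u)" using m by (simp add: root_spaceD lift_simps lift_apply)
  finally show "br (hm h) (\<phi> u) = sc (w m h) (\<phi> u)" .
qed

lemma lift_nonzero: "u \<noteq> 0 \<Longrightarrow> \<phi> u \<noteq> 0"
  using lift_simps(6)[of u] lift_simps(6)[of 0] lift_zero by auto

lemma lift_weight_nonzero: "in_dual D m \<Longrightarrow> m \<noteq> 0 \<Longrightarrow> w m \<noteq> 0"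
proof
  assume m: "in_dual D m" "m \<noteq> 0" and "w m = 0"
  then have "m (\<kappa> (\<theta> h)) = 0" for h using lift_apply[OF m(1)] by (metis comp_apply zero_fun_apply)
  then show False using m(2) by (auto simp: lift_simps)
qed

lemma lift_roots: "m \<in> roots D G \<Longrightarrow> w m \<in> roots D G"
proof -
  assume "m \<in> roots D G"
  then obtain u where u: "u \<in> R m" "u \<noteq> 0" "m \<noteq> 0" "in_dual D m" by (rule rootsE)
  show ?thesis by (rule rootsI[of "\<phi> u"])
      (use u lift_root_space lift_nonzero lift_weight_nonzero in auto)
qed

end

lemma lift_by_image_parity:
  assumes l: "lift_by w wi \<phi> \<psi> \<theta> \<kappa>" and m: "in_dual D m" "has_parity G m a"
  shows "has_parity G (w m) a"
  unfolding has_parity_def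
proof
  fix u assume "u \<in> R (w m)"
  then have "\<psi> u \<in> R (wi (w m))" by (rule lift_root_space[OF lift_by_sym[OF l] lift_dual[OF l m(1)]])
  then have "\<psi> u \<in> part a" using m lift_inverse[OF l] by (auto simp: has_parity_def)
  then have "\<phi> (\<psi> u) \<in> part a" by (rule lift_part[OF l])
  then show "u \<in> part a" by (simp add: lift_simps[OF l])
qed

text \<open>Coroots move by \<open>\<theta>\<close> and roots by composition with its inverse
  \<open>\<kappa>\<close>, so the Cartan entries of the transported family are unchanged.\<close>

lemma lift_family:
  assumes l: "lift_by w wi \<phi> \<psi> \<theta> \<kappa>" and F: "chevalley_family G D r x y p"
  shows "chevalley_family G D (w \<circ> r) (\<phi> \<circ> x) (\<phi> \<circ> y) p"
    and "chevalley_family.coroot G (\<phi> \<circ> x) (\<phi> \<circ> y) i = \<theta> (chevalley_family.coroot G x y i)"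
proof -
  interpret F: chevalley_family G D r x y p by (rule F)
  note s = lift_simps[OF l]
  have wr: "(w \<circ> r) i = r i \<circ> \<kappa>" for i using lift_apply[OF l F.r_dual] by simp
  have mdual: "in_dual D (- r i)" for i
    by (rule in_dualI[OF hvs]) (simp_all add: linear_dual[OF F.r_dual])
  have wmr: "w (- r i) = - (w \<circ> r) i" for i
    unfolding wr lift_apply[OF l mdual] by auto
  interpret F': chevalley_family G D "w \<circ> r" "\<phi> \<circ> x" "\<phi> \<circ> y" p
  proof unfold_locales
    show "c i = 0" if *: "\<And>h. (\<Sum>j\<in>UNIV. c j * (w \<circ> r) j h) = 0" for c i
    proof (rule F.indep)
      show "(\<Sum>j\<in>UNIV. c j * r j h) = 0" for h using *[of "\<theta> h"] by (simp add: wr s del: comp_apply) (simp add: s)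
    qed
    show "in_dual D ((w \<circ> r) i)" for i using lift_dual[OF l F.r_dual] by simp
    show "(\<phi> \<circ> x) i \<in> R ((w \<circ> r) i)" for i using lift_root_space[OF l F.r_dual F.x_root] by simp
    show "(\<phi> \<circ> y) i \<in> R (- (w \<circ> r) i)" for i
      using lift_root_space[OF l mdual F.y_root] unfolding wmr by simp
    show "(\<phi> \<circ> x) i \<in> part (p i)" "(\<phi> \<circ> y) i \<in> part (p i)" for i
      using lift_part[OF l] F.x_par F.y_par by simp_all
    show "i \<noteq> j \<Longrightarrow> br ((\<phi> \<circ> x) i) ((\<phi> \<circ> y) j) = 0" for i j
      using F.brk_xy[of i j] lift_zero[OF l] by (simp flip: s(3))
    show "br ((\<phi> \<circ> x) i) ((\<phi> \<circ> y) i) \<in> range hm" for i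
      using F.brk_xy_coroot[of i] by (simp flip: s(3)) (simp add: s)
    let ?X = "range hm \<union> range x \<union> range y" and ?Y = "range hm \<union> range (\<phi> \<circ> x) \<union> range (\<phi> \<circ> y)"
    have "\<phi> u \<in> lie_generated G ?Y" if "u \<in> lie_generated G ?X" for u
      using that
    proof induction
      case (gen u)
      then show ?case by (intro lie_generated.gen) (auto simp: s)
    qed (auto simp: s lift_zero[OF l] intro: lie_generated.intros(2-5))
    then have "\<phi> (\<psi> u) \<in> lie_generated G ?Y" for u using F.generates by blast
    then show "lie_generated G ?Y = UNIV" by (auto simp: s)
  qed
  show "chevalley_family G D (w \<circ> r) (\<phi> \<circ> x) (\<phi> \<circ> y) p" by (rule F'.chevalley_family_axioms)
  have "hm (F'.coroot i) = hm (\<theta> (F.coroot i))"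
    unfolding F'.brk_xy_coroot[symmetric] s(4)[symmetric] F.brk_xy_coroot[symmetric] by (simp add: s)
  then show "F'.coroot i = \<theta> (F.coroot i)" by simp
qed

text \<open>Exponentials of even locally nilpotent derivations are automorphisms, so only their
  effect on \<hh> has to be computed. This takes place in the span of \<hh>, e and f, where the
  series stop after at most three terms.\<close>

lemma reflection_lift:
  assumes e: "e \<in> R \<alpha>" "e \<in> part 0" and f: "f \<in> R (- \<alpha>)" "f \<in> part 0" and ef: "br e f = hm h0"
    and h0: "\<alpha> h0 = 2" and nil: "locally_nilpotent (br e)" "locally_nilpotent (br f)" and dual: "in_dual D \<alpha>"
  shows "lift (even_reflection \<alpha> h0) (even_reflection \<alpha> h0)"
proof -
  define E where "E = nexp (br e)"
  define F where "F = nexp (br (- f))"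
  define Ei where "Ei = nexp (br (- e))"
  define Fi where "Fi = nexp (br f)"
  have brn: "br (- u) = (\<lambda>z. - br u z)" for u by (rule ext) simp
  have ne: "nil_linear (br e)" and nf: "nil_linear (br f)"
    using nil nil_linear_brk by auto
  have nme: "nil_linear (br (- e))" and nmf: "nil_linear (br (- f))"
    unfolding brn using nil_linear_minus(1) ne nf by auto
  have inv: "E (Ei z) = z" "Ei (E z) = z" "F (Fi z) = z" "Fi (F z) = z" for z
    unfolding E_def Ei_def F_def Fi_def
    using nexp_minus_inverse[OF ne, of z] nexp_minus_inverse[OF nme, of z]
      nexp_minus_inverse[OF nf, of z] nexp_minus_inverse[OF nmf, of z]
    by (simp_all add: brn)
  define hom where "hom \<phi> \<longleftrightarrow> (\<forall>u v. \<phi> (u + v) = \<phi> u + \<phi> v) \<and> (\<forall>c u. \<phi> (sc c u) = sc c (\<phi> u)) \<and>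
     (\<forall>u v. \<phi> (br u v) = br (\<phi> u) (\<phi> v)) \<and> (\<forall>a u. u \<in> part a \<longrightarrow> \<phi> u \<in> part a)" for \<phi>
  have hom_exp: "hom (nexp (br u))" if "nil_linear (br u)" "u \<in> part 0" for u
  proof -
    have "br u v \<in> part a" if "v \<in> part a" for v a using brk_part[OF \<open>u \<in> part 0\<close> that] by simp
    then show ?thesis
      unfolding hom_def using nexp_add[OF that(1)] nexp_scale[OF that(1)] nexp_part[OF that(1)]
        nexp_brk[OF that(1) even_derivation[OF that(2)]] by blast
  qed
  have homs: "hom E" "hom F" "hom Ei" "hom Fi"
    unfolding E_def F_def Ei_def Fi_def using hom_exp ne nf nme nmf e f part_neg by auto
  have hom_comp: "hom (\<phi> \<circ> \<psi>)" if "hom \<phi>" "hom \<psi>" for \<phi> \<psi> using that by (auto simp: hom_def)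
  let ?\<phi> = "E \<circ> (F \<circ> E)" and ?\<psi> = "Ei \<circ> (Fi \<circ> Ei)"
  have h\<phi>: "hom ?\<phi>" "hom ?\<psi>" using homs hom_comp by auto
  have comp: "?\<phi> (?\<psi> z) = z" "?\<psi> (?\<phi> z) = z" for z by (simp_all add: inv)
  let ?\<theta> = "\<lambda>h. h - hscale D (\<alpha> h) h0"
  note al = linear_dual[OF dual]
  have al0: "\<alpha> 0 = 0" using al(1)[of 0 0] by simp
  have alm: "\<alpha> (- h) = - \<alpha> h" for h using al(1)[of "- h" h] al0 by (simp add: eq_neg_iff_add_eq_0)
  have ald: "\<alpha> (h - h') = \<alpha> h - \<alpha> h'" for h h' using al(1)[of h "- h'"] alm by simp
  have th: "?\<theta> (?\<theta> h) = h" for h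
    by (simp add: ald al h0 VH.scale_minus_left)
  have eh: "br e (hm h) = - sc (\<alpha> h) e" and fh: "br f (hm h) = sc (\<alpha> h) f" for h
    using root_spaceD'[OF e(1)] root_spaceD'[OF f(1)] by simp_all
  have ee: "br e e = 0" and ff: "br f f = 0" using e f even_self_brk by auto
  have fe: "br f e = - hm h0" using even_skew[OF e(2), of f] ef by simp
  have E_h: "E (hm h) = hm h - sc (\<alpha> h) e" for h
    unfolding E_def by (subst nexp_2[OF ne]) (simp_all add: eh ee brk_scale_right)
  have E_e: "E e = e" unfolding E_def by (rule nexp_1[OF ne ee])
  have F_h: "F (hm h) = hm h - sc (\<alpha> h) f" for h
    unfolding F_def by (subst nexp_2[OF nmf]) (simp_all add: fh ff brk_scale_right)
  \<comment> \<open>The quadratic term is [f, [f, e]] / 2 = -f because \<alpha>(h0) = 2.\<close>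
  have F_e: "F e = e + hm h0 - f"
    unfolding F_def by (subst nexp_3[OF nmf]) (simp_all add: fe fh ff h0 brk_scale_right)
  have lin: "E (u - sc c v) = E u - sc c (E v)" "F (u - sc c v) = F u - sc c (F v)" for u v c
    using homs(1,2) unfolding hom_def
    by (metis (no_types, opaque_lifting) add_uminus_conv_diff V.scale_minus_left)+
  have hmd: "hm (h - hscale D c h') = hm h - sc c (hm h')" for h c h'
    using hmap_add[of h "- hscale D c h'"] by (simp add: hmap_minus hmap_scale)
  have \<phi>_h: "?\<phi> (hm h) = hm (?\<theta> h)" for h
  proof -
    have "F (E (hm h)) = (hm h - sc (\<alpha> h) (hm h0)) - sc (\<alpha> h) e"
      unfolding E_h lin F_h F_e by (simp add: V.scale_right_distrib V.scale_right_diff_distrib)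
    then have "?\<phi> (hm h) = E (hm h) - sc (\<alpha> h) (E (hm h0)) - sc (\<alpha> h) (E e)"
      by (simp add: lin)
    also have "\<dots> = hm h - sc (\<alpha> h) (hm h0)"
      unfolding E_h E_e h0 by (simp add: V.scale_right_diff_distrib algebra_simps flip: V.scale_left_distrib)
    finally show ?thesis by (simp add: hmd)
  qed
  \<comment> \<open>The inverse automorphism induces the same map because the reflection is an
    involution.\<close>
  have \<psi>_h: "?\<psi> (hm h) = hm (?\<theta> h)" for h
    using comp(2)[of "hm (?\<theta> h)"] \<phi>_h[of "?\<theta> h"] by (simp only: th)
  have w: "even_reflection \<alpha> h0 l = l \<circ> ?\<theta> \<and> in_dual D (l \<circ> ?\<theta>)" if l: "in_dual D l" for l
  proof
    note ll = linear_dual[OF l]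
    have ld: "l (h - h') = l h - l h'" for h h'
      using ll(1)[of "h - h'" h'] by simp
    show "even_reflection \<alpha> h0 l = l \<circ> ?\<theta>"
      by (rule ext) (simp add: even_reflection_def dscale_def ld ll)
    show "in_dual D (l \<circ> ?\<theta>)"
      by (rule in_dualI[OF hvs]) (simp_all add: ld ll al algebra_simps)
  qed
  have "half_lift (even_reflection \<alpha> h0) ?\<phi> ?\<theta> ?\<theta>" "half_lift (even_reflection \<alpha> h0) ?\<psi> ?\<theta> ?\<theta>"
    using h\<phi> \<phi>_h \<psi>_h w unfolding half_lift_def hom_def by blast+
  then have "lift_by (even_reflection \<alpha> h0) (even_reflection \<alpha> h0) ?\<phi> ?\<psi> ?\<theta> ?\<theta>"
    unfolding lift_by_def using comp th by blast
  then show ?thesis unfolding lift_def by blast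
qed

end

section \<open>Even reflections and the Weyl group\<close>

lemma (in chevalley_family) root_vector_nilpotent:
  assumes "locally_nilpotent (br (x j))" "u \<in> R (r j) \<or> u \<in> R (r j + r j)"
  shows "locally_nilpotent (br u)"
  using assms(2)
proof
  assume "u \<in> R (r j)"
  then show ?thesis using root_space_simple locally_nilpotent_scale[OF assms(1)] by blast
next
  assume "u \<in> R (r j + r j)"
  then obtain c where c: "u = sc c (br (x j) (x j))" using root_space_double by blast
  show ?thesis
  proof (cases "p j")
    case zero
    then have "u = sc 0 (x j)" using c even_self_brk[of "x j"] x_par[of j] by simp
    then show ?thesis using locally_nilpotent_scale[OF assms(1)] by blast
  next
    case one
    then show ?thesis
      unfolding c using locally_nilpotent_square[OF assms(1)] x_par[of j] locally_nilpotent_scale by simp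
  qed
qed

lemma dscale_half: "dscale (1/2) l = m \<longleftrightarrow> l = m + m"
  by (auto simp: dscale_def fun_eq_iff)

context kac_moody
begin

definition principal_triple where
  "principal_triple \<alpha> h e f \<longleftrightarrow> e \<in> R \<alpha> \<and> e \<in> part 0 \<and> f \<in> R (- \<alpha>) \<and> f \<in> part 0 \<and> br e f = hm h \<and> \<alpha> h = 2 \<and>
     locally_nilpotent (br e) \<and> locally_nilpotent (br f)"

text \<open>\<open>sl2_coroot\<close> supplies vectors without nilpotency. As \<alpha> or its half
  is simple in an odd-reflected base, they are multiples of x_j and y_j or of [x_j, x_j] and
  [y_j, y_j], and admissibility applies.\<close>

lemma principal_root_triple:
  assumes \<alpha>: "\<alpha> \<in> principal_roots D G" and h: "sl2_coroot G \<alpha> h"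
  shows "\<exists>e f. principal_triple \<alpha> h e f"
proof -
  obtain e f where ef: "e \<in> R \<alpha>" "f \<in> R (- \<alpha>)" "h = h_brk G e f" "\<alpha> h = 2"
    using h by (auto simp: sl2_coroot_def)
  have "br e f \<in> range hm" using root_space_brk[OF ef(1,2)] Pi.root_space_zero by simp
  then have efh: "br e f = hm h" using h_brk_eq ef(3) by blast
  have root: "\<alpha> \<in> roots D G" and par: "has_parity G \<alpha> 0" using \<alpha> by (auto simp: principal_roots_def)
  have lin: "\<alpha> 0 = 0" using root linear_dual(1)[of D \<alpha> 0 0] by (simp add: roots_def)
  then have "h \<noteq> 0" using ef(4) by auto
  then have "br e f \<noteq> 0" using efh hmap_inj by metis
  then have e0: "e \<noteq> 0" by auto
  \<comment> \<open>Opposite roots have equal parity, and the nonzero vector e is even; hence f is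
    even as well.\<close>
  obtain a where a: "has_parity G \<alpha> a" "has_parity G (- \<alpha>) a" using Pi.root_has_parity[OF root] by blast
  have "a = 0"
  proof (rule ccontr)
    assume "a \<noteq> 0"
    then have "a = 1" by simp
    then show False using a(1) par ef(1) e0 parts_disjoint by (auto simp: has_parity_def)
  qed
  then have par': "e \<in> part 0" "f \<in> part 0" using a ef(1,2) unfolding has_parity_def by blast+
  obtain \<Sigma> where \<Sigma>: "\<Sigma> \<in> odd_bases D G" "\<alpha> \<in> \<Sigma> \<or> dscale (1/2) \<alpha> \<in> \<Sigma>"
    using \<alpha> by (auto simp: principal_roots_def)
  obtain r x y p where F: "base_family r x y p" "\<Sigma> = range r" using odd_bases_family[OF \<Sigma>(1)] .
  interpret F: chevalley_family G D r x y p using F(1) by (rule base_familyD)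
  interpret opp: chevalley_family G D "\<lambda>i. - r i" y x p by (rule F.opposite)
  have "\<exists>j. \<alpha> = r j \<or> \<alpha> = r j + r j" using \<Sigma>(2) unfolding F(2) by (metis dscale_half rangeE)
  then obtain j where j: "\<alpha> = r j \<or> \<alpha> = r j + r j" by blast
  have adm: "locally_nilpotent (br (x j))" "locally_nilpotent (br (y j))"
    using odd_base_admissible F \<Sigma>(1) by blast+
  have "locally_nilpotent (br e)" using F.root_vector_nilpotent[OF adm(1)] ef(1) j by blast
  moreover have "- \<alpha> = - r j \<or> - \<alpha> = - r j + - r j" using j by auto
  then have "locally_nilpotent (br f)" using opp.root_vector_nilpotent[OF adm(2)] ef(2) by metis
  ultimately show ?thesis unfolding principal_triple_def using ef efh par' by blast
qed

lemma principal_lift: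
  assumes "\<alpha> \<in> principal_roots D G" "sl2_coroot G \<alpha> h"
  shows "lift (even_reflection \<alpha> h) (even_reflection \<alpha> h)"
proof -
  have "in_dual D \<alpha>" using assms(1) by (auto simp: principal_roots_def roots_def)
  then show ?thesis
    using principal_root_triple[OF assms] reflection_lift unfolding principal_triple_def by blast
qed

text \<open>The case a = 2 of \<open>weight_of_nilpotent_triple\<close>, which gives l(h) + 2 m =
  k.\<close>

lemma coroot_integral:
  assumes "\<alpha> \<in> principal_roots D G" "sl2_coroot G \<alpha> h" "l \<in> roots D G"
  shows "\<exists>k. l h = of_int k"
proof -
  obtain e f where *: "principal_triple \<alpha> h e f" using principal_root_triple[OF assms(1,2)] by blast
  obtain v where v: "v \<in> R l" "v \<noteq> 0" using assms(3) by (rule rootsE)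
  have "\<exists>m k. l h + of_nat m * 2 = of_nat k * 2 / 2"
    by (rule weight_of_nilpotent_triple[of e f h 2 v])
       (use * v root_spaceD[of e \<alpha> h] root_spaceD[of f "- \<alpha>" h] root_spaceD[OF v(1), of h]
        in \<open>auto simp: principal_triple_def\<close>)
  then obtain m k :: nat where "l h = of_nat k - of_nat m * 2" by (auto simp: eq_diff_eq)
  then show ?thesis by (intro exI[of _ "int k - int m * 2"]) simp
qed

text \<open>The second argument is the reversed word in the same reflections. Carrying it along
  makes inversion symmetric and provides the inverse required by \<open>lift\<close>.\<close>

inductive weyl where
  id: "weyl id id"
| step: "weyl w wi \<Longrightarrow> \<alpha> \<in> principal_roots D G \<Longrightarrow> sl2_coroot G \<alpha> h
    \<Longrightarrow> weyl (even_reflection \<alpha> h \<circ> w) (wi \<circ> even_reflection \<alpha> h)"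

lemma weyl_lift: "weyl w wi \<Longrightarrow> lift w wi"
proof (induction rule: weyl.induct)
  case (step w wi \<alpha> h)
  show ?case by (rule lift_comp[OF principal_lift[OF step.hyps(2,3)] step.IH])
qed (rule lift_id)

lemma weyl_comp: "weyl w wi \<Longrightarrow> weyl w' wi' \<Longrightarrow> weyl (w \<circ> w') (wi' \<circ> wi)"
proof (induction rule: weyl.induct)
  case (step w wi \<alpha> h)
  show ?case
    using weyl.step[OF step.IH[OF step.prems] step.hyps(2,3)] unfolding comp_assoc .
qed simp

lemma weyl_reflection:
  "\<alpha> \<in> principal_roots D G \<Longrightarrow> sl2_coroot G \<alpha> h \<Longrightarrow> weyl (even_reflection \<alpha> h) (even_reflection \<alpha> h)"
  using weyl.step[OF weyl.id] by simp

lemma weyl_sym: "weyl w wi \<Longrightarrow> weyl wi w"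
proof (induction rule: weyl.induct)
  case (step w wi \<alpha> h)
  show ?case by (rule weyl_comp[OF step.IH weyl_reflection[OF step.hyps(2,3)]])
qed (rule weyl.id)

lemma sl2_coroot_2: "sl2_coroot G \<alpha> h \<Longrightarrow> \<alpha> h = 2"
  by (auto simp: sl2_coroot_def)

lemma reflection_involution: "\<alpha> h = 2 \<Longrightarrow> even_reflection \<alpha> h (even_reflection \<alpha> h l) = l"
  by (rule ext) (simp add: even_reflection_def dscale_def)

lemma weyl_inverse: "weyl w wi \<Longrightarrow> wi (w l) = l"
  by (induction arbitrary: l rule: weyl.induct) (simp_all add: reflection_involution sl2_coroot_2)

lemma weyl_all_bases:
  assumes "weyl w wi" "\<Sigma> \<in> all_bases D G" shows "w ` \<Sigma> \<in> all_bases D G"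
  using assms(1)
proof induction
  case (step w wi \<alpha> h)
  then show ?case using all_bases.even[of "w ` \<Sigma>" D G \<alpha> h] by (simp add: image_comp)
qed (simp add: assms)

lemma odd_bases_all: "\<Sigma> \<in> odd_bases D G \<Longrightarrow> \<Sigma> \<in> all_bases D G"
  by (induction rule: odd_bases.induct) (auto intro: all_bases.intros)

lemma weyl_linear:
  assumes w: "weyl w wi" and m: "in_dual D m" and n: "in_dual D n"
  shows "w (m + n) = w m + w n" "w (- m) = - w m" "w (dscale c m) = dscale c (w m)"
    "in_dual D (w m)" "in_dual D (m + n)" "in_dual D (- m)" "in_dual D (dscale c m)"
proof -
  obtain \<phi> \<psi> \<theta> \<kappa> where l: "lift_by w wi \<phi> \<psi> \<theta> \<kappa>" using weyl_lift[OF w] by (auto simp: lift_def)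
  note mm = linear_dual[OF m] and nn = linear_dual[OF n]
  show a: "in_dual D (m + n)" and b: "in_dual D (- m)" and c: "in_dual D (dscale c m)"
    by (rule in_dualI[OF hvs]; simp add: dscale_def mm nn algebra_simps)+
  show "in_dual D (w m)" by (rule lift_dual[OF l m])
  show "w (m + n) = w m + w n" "w (- m) = - w m" "w (dscale c m) = dscale c (w m)"
    unfolding lift_apply[OF l a] lift_apply[OF l b] lift_apply[OF l c] lift_apply[OF l m] lift_apply[OF l n]
    by (auto simp: dscale_def)
qed

lemma weyl_roots: "weyl w wi \<Longrightarrow> l \<in> roots D G \<Longrightarrow> w l \<in> roots D G"
  using weyl_lift lift_roots unfolding lift_def by blast

lemma weyl_wt:
  assumes w: "weyl w wi" and r: "\<And>i. in_dual D (r i)"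
  shows "w (wt r n) = wt (w \<circ> r) n" "in_dual D (wt r n)"
proof -
  obtain \<phi> \<psi> \<theta> \<kappa> where l: "lift_by w wi \<phi> \<psi> \<theta> \<kappa>" using weyl_lift[OF w] by (auto simp: lift_def)
  show d: "in_dual D (wt r n)"
    by (rule in_dualI[OF hvs])
       (simp_all add: wt_def linear_dual[OF r] algebra_simps sum.distrib sum_distrib_left)
  show "w (wt r n) = wt (w \<circ> r) n"
    unfolding lift_apply[OF l d] by (rule ext) (simp add: wt_def lift_apply[OF l r])
qed

lemma weyl_family:
  assumes w: "weyl w wi" and F: "base_family r x y p"
  shows "\<exists>x' y'. base_family (w \<circ> r) x' y' p \<and>
    (\<forall>i k. (w \<circ> r) k (chevalley_family.coroot G x' y' i) = r k (chevalley_family.coroot G x y i))"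
proof -
  obtain \<phi> \<psi> \<theta> \<kappa> where l: "lift_by w wi \<phi> \<psi> \<theta> \<kappa>" using weyl_lift[OF w] by (auto simp: lift_def)
  note f = lift_family[OF l base_familyD(1)[OF F]]
  have "base_family (w \<circ> r) (\<phi> \<circ> x) (\<phi> \<circ> y) p"
    unfolding base_family_def using f(1) lift_nonzero[OF l base_familyD(2)[OF F]] by simp
  moreover have "in_dual D (r k)" for k by (rule chevalley_family.r_dual[OF base_familyD(1)[OF F]])
  then have "(w \<circ> r) k (chevalley_family.coroot G (\<phi> \<circ> x) (\<phi> \<circ> y) i) = r k (chevalley_family.coroot G x y i)" for i k
    unfolding f(2) by (simp add: lift_apply[OF l] lift_simps[OF l])
  ultimately show ?thesis by blast
qed

text \<open>Odd reflections depend only on parities and Cartan entries, and the lift of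
  \<open>w\<close> preserves both. This permits moving them past Weyl group elements.\<close>

lemma weyl_odd_reflects:
  fixes r :: "'i \<Rightarrow> 'h \<Rightarrow> complex"
  assumes w: "weyl w wi" and r: "inj r" and refl: "odd_reflects_to D G (range r) \<Sigma>'"
  shows "odd_reflects_to D G (w ` range r) (w ` \<Sigma>')"
proof -
  obtain X Y j where *: "base_with D G (range r) X Y" "has_parity G (r j) 1"
    "cartan_entry G X Y (r j) (r j) = 0"
    "\<Sigma>' = odd_reflection (cartan_entry G X Y) (r j) ` range r"
    using refl unfolding odd_reflects_to_def by blast
  obtain p where f: "base_family r (X \<circ> r) (Y \<circ> r) p" using family_of_base[OF r(1) *(1)] .
  interpret F: chevalley_family G D r "X \<circ> r" "Y \<circ> r" p using f by (rule base_familyD)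
  obtain x' y' where f': "base_family (w \<circ> r) x' y' p"
    "\<And>i k. (w \<circ> r) k (chevalley_family.coroot G x' y' i) = r k (F.coroot i)"
    using weyl_family[OF w f] by blast
  interpret F': chevalley_family G D "w \<circ> r" x' y' p using f'(1) by (rule base_familyD)
  let ?X = "x' \<circ> inv (w \<circ> r)" and ?Y = "y' \<circ> inv (w \<circ> r)"
  have b: "base_with D G (range (w \<circ> r)) ?X ?Y"
    by (rule F'.base_with_family) (rule base_familyD[OF f'(1)])
  have ent: "cartan_entry G X Y (r i) l = l (F.coroot i)" for i l
    by (rule F.cartan_entry_coroot) simp_all
  have ent': "cartan_entry G ?X ?Y ((w \<circ> r) i) l = l (F'.coroot i)" for i l
    by (rule F'.cartan_entry_coroot)
       (simp_all only: o_apply[of x' "inv (w \<circ> r)"] o_apply[of y' "inv (w \<circ> r)"] inv_f_f[OF F'.r_inj])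
  obtain \<phi> \<psi> \<theta> \<kappa> where l: "lift_by w wi \<phi> \<psi> \<theta> \<kappa>" using weyl_lift[OF w] by (auto simp: lift_def)
  have par: "has_parity G ((w \<circ> r) j) 1"
    using lift_by_image_parity[OF l F.r_dual *(2)] by simp
  have iso: "cartan_entry G ?X ?Y ((w \<circ> r) j) ((w \<circ> r) j) = 0"
    unfolding ent' f'(2) using *(3) by (simp add: ent)
  have refl_w: "odd_reflection (cartan_entry G ?X ?Y) ((w \<circ> r) j) ((w \<circ> r) i)
      = w (odd_reflection (cartan_entry G X Y) (r j) (r i))" for i
    unfolding odd_reflection_def ent' f'(2) ent
    using inj_eq[OF F'.r_inj, of j i] inj_eq[OF r, of j i] weyl_linear[OF w F.r_dual[of j] F.r_dual[of i]]
      weyl_linear(2)[OF w F.r_dual[of i] F.r_dual[of i]] by auto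
  have "w ` \<Sigma>' = odd_reflection (cartan_entry G ?X ?Y) ((w \<circ> r) j) ` range (w \<circ> r)"
    unfolding *(4) image_image refl_w by simp
  moreover have "w ` range r = range (w \<circ> r)" by (simp add: image_comp)
  ultimately show ?thesis
    unfolding odd_reflects_to_def using b par iso by (metis rangeI)
qed

text \<open>\<open>regular_kac_moody\<close> speaks about \<open>odd_bases\<close>; through this
  factorization its consequences reach every base.\<close>

lemma all_bases_weyl:
  assumes "\<Sigma> \<in> all_bases D G"
  obtains w wi \<Sigma>0 where "weyl w wi" "\<Sigma>0 \<in> odd_bases D G" "\<Sigma> = w ` \<Sigma>0"
proof -
  have "\<exists>w wi \<Sigma>0. weyl w wi \<and> \<Sigma>0 \<in> odd_bases D G \<and> \<Sigma> = w ` \<Sigma>0"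
    using assms
  proof induction
    case initial
    show ?case using weyl.id odd_bases.initial by (metis image_id id_apply)
  next
    case (odd \<Sigma> \<Sigma>')
    then obtain w wi \<Sigma>0 where w: "weyl w wi" "\<Sigma>0 \<in> odd_bases D G" "\<Sigma> = w ` \<Sigma>0" by blast
    obtain r x y p where F: "base_family r x y p" "\<Sigma>0 = range r" using odd_bases_family[OF w(2)] .
    obtain x' y' where F': "base_family (w \<circ> r) x' y' p" using weyl_family[OF w(1) F(1)] by blast
    have inj: "inj (w \<circ> r)" using base_familyD(1)[OF F'] by (rule chevalley_family.r_inj)
    have "\<Sigma> = range (w \<circ> r)" using w(3) F(2) by (simp add: image_comp)
    \<comment> \<open>Pulled back by \<open>wi\<close>, the reflection starts at
      \<open>\<Sigma>0\<close> and stays among \<open>odd_bases\<close>; \<open>w\<close> carries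
      the result back.\<close>
    then have "odd_reflects_to D G (wi ` range (w \<circ> r)) (wi ` \<Sigma>')"
      using weyl_odd_reflects[OF weyl_sym[OF w(1)] inj] odd.hyps(2) by simp
    moreover have "wi ` range (w \<circ> r) = \<Sigma>0" using F(2) weyl_inverse[OF w(1)] by (simp add: image_image)
    ultimately have "wi ` \<Sigma>' \<in> odd_bases D G" using w(2) by (metis odd_bases.odd)
    moreover have "\<Sigma>' = w ` (wi ` \<Sigma>')" using weyl_inverse[OF weyl_sym[OF w(1)]] by (simp add: image_image)
    ultimately show ?case using w(1) by blast
  next
    case (even \<Sigma> \<alpha> h)
    then obtain w wi \<Sigma>0 where w: "weyl w wi" "\<Sigma>0 \<in> odd_bases D G" "\<Sigma> = w ` \<Sigma>0" by blast
    have "even_reflection \<alpha> h ` \<Sigma> = (even_reflection \<alpha> h \<circ> w) ` \<Sigma>0" using w(3) by (simp add: image_comp)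
    then show ?case using weyl.step[OF w(1) even.hyps(2,3)] w(2) by blast
  qed
  then show thesis using that by blast
qed

lemma all_bases_family:
  assumes "\<Sigma> \<in> all_bases D G"
  obtains r x y p where "base_family r x y p" "\<Sigma> = range r"
proof -
  obtain w wi \<Sigma>0 where w: "weyl w wi" "\<Sigma>0 \<in> odd_bases D G" "\<Sigma> = w ` \<Sigma>0"
    using all_bases_weyl[OF assms] .
  obtain r x y p where F: "base_family r x y p" "\<Sigma>0 = range r" using odd_bases_family[OF w(2)] .
  obtain x' y' where "base_family (w \<circ> r) x' y' p" using weyl_family[OF w(1) F(1)] by blast
  then show thesis using that w(3) F(2) by (metis image_comp)
qed

lemma weyl_real:
  assumes w: "weyl w wi" and l: "l \<in> real_roots D G" shows "w l \<in> real_roots D G"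
proof -
  obtain \<Sigma> where \<Sigma>: "\<Sigma> \<in> all_bases D G" "l \<in> \<Sigma> \<or> dscale (1/2) l \<in> \<Sigma>" and root: "l \<in> roots D G"
    using l by (auto simp: real_roots_def)
  have "in_dual D l" using root by (simp add: roots_def)
  then have "w l \<in> w ` \<Sigma> \<or> dscale (1/2) (w l) \<in> w ` \<Sigma>"
    using \<Sigma>(2) weyl_linear(3)[OF w, of l l "1/2"] by (metis imageI)
  then show ?thesis
    unfolding real_roots_def mem_Collect_eq
    by (rule conjI[OF weyl_roots[OF w root] bexI[OF _ weyl_all_bases[OF w \<Sigma>(1)]]])
qed

lemma weyl_imaginary:
  assumes w: "weyl w wi" and l: "l \<in> imaginary_roots D G" shows "w l \<in> imaginary_roots D G"
  using weyl_real[OF weyl_sym[OF w], of "w l"] weyl_inverse[OF w] weyl_roots[OF w] l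
  by (auto simp: imaginary_roots_def)

section \<open>Reflections in simple roots\<close>

lemma sl2_corootI:
  "u \<in> R \<alpha> \<Longrightarrow> v \<in> R (- \<alpha>) \<Longrightarrow> br u v = hm h \<Longrightarrow> \<alpha> h = 2 \<Longrightarrow> sl2_coroot G \<alpha> h"
  unfolding sl2_coroot_def using h_brk_eq by blast

text \<open>For even \<open>r j\<close> the triple consists of \<open>x j\<close> and a rescaled
  \<open>y j\<close>. For odd \<open>r j\<close> the principal root is its double, with root vectors
  [x_j, x_j] and [y_j, y_j]; that these are nonzero follows from their nonzero bracket.\<close>

lemma nonisotropic_reflection:
  assumes F: "base_family r x y p" and r: "range r \<in> odd_bases D G"
    and a: "r j (chevalley_family.coroot G x y j) \<noteq> 0"
  obtains h m where "dscale m (r j) \<in> principal_roots D G" "sl2_coroot G (dscale m (r j)) h"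
    "p j = 0 \<and> m = 1 \<or> p j = 1 \<and> m = 2" "even_reflection (dscale m (r j)) h (r j) = - r j"
proof -
  interpret F: chevalley_family G D r x y p using F by (rule base_familyD)
  let ?h = "F.coroot j" and ?a = "r j (F.coroot j)"
  have ev: "even_reflection (dscale m (r j)) h (r j) = - r j" if "m * r j h = 2" for h m
  proof
    fix t
    have "r j t - r j h * (m * r j t) = r j t - (m * r j h) * r j t" by (simp add: mult_ac)
    then show "even_reflection (dscale m (r j)) h (r j) t = (- r j) t"
      unfolding that by (simp add: even_reflection_def dscale_def)
  qed
  have sub: "dscale m (r j) \<in> principal_roots D G \<and> sl2_coroot G (dscale m (r j)) h \<Longrightarrow> m * r j h = 2" for h m
    using sl2_coroot_2[of "dscale m (r j)" h] by (simp add: dscale_def)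
  show thesis
  proof (cases "p j")
    case zero
    have d: "dscale 1 (r j) = r j" by (simp add: dscale_def)
    have "has_parity G (r j) 0" using F.pos_has_parity[of "unitv j" j] zero by simp
    then have "r j \<in> principal_roots D G"
      using F.r_root[OF base_familyD(2)[OF F]] r unfolding principal_roots_def by blast
    moreover have "br (x j) (sc (2 / ?a) (y j)) = hm (hscale D (2 / ?a) ?h)"
      by (simp add: brk_scale_right F.brk_xy_coroot hmap_scale)
    then have "sl2_coroot G (r j) (hscale D (2 / ?a) ?h)"
      by (rule sl2_corootI[OF F.x_root root_space_scale[OF F.y_root]])
         (use a in \<open>simp add: linear_dual[OF F.r_dual]\<close>)
    ultimately show thesis using that[of 1] zero ev[of 1] sub[of 1] by (simp add: d)
  next
    case one
    have d: "dscale 2 (r j) = r j + r j" by (rule ext) (simp add: dscale_def)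
    have par: "has_parity G (r j + r j) 0"
      using F.pos_has_parity[of "unitv j + unitv j" j]
      unfolding wt_add wpar_add wt_unitv wpar_unitv bit_add_self by simp
    have odd: "x j \<in> part 1" "y j \<in> part 1" using F.x_par[of j] F.y_par[of j] one by simp_all
    let ?xx = "br (x j) (x j)" and ?yy = "br (y j) (y j)"
    have dbl: "sc (2 * ?a) (y j) = sc ?a (y j) + sc ?a (y j)"
      by (simp only: mult_2 V.scale_left_distrib)
    have 1: "br (x j) ?yy = - sc (2 * ?a) (y j)"
      unfolding jacobi[OF odd] F.brk_xy_coroot root_spaceD[OF F.y_root] root_spaceD'[OF F.y_root]
      by (simp add: ssign_def dbl)
    have "br (x j) (br (x j) ?yy) = - sc (2 * ?a) (hm ?h)"
      unfolding 1 by (simp add: brk_scale_right F.brk_xy_coroot)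
    then have 2: "br ?xx ?yy = - sc (4 * ?a) (hm ?h)"
      using odd_square[OF odd(1), of ?yy] by (simp add: V.scale_left_imp_eq[of "1/2"])
    have "?h \<noteq> 0" using a linear_dual(1)[OF F.r_dual, of j 0 0] by auto
    then have "hm ?h \<noteq> 0" using hmap_inj by blast
    then have "br ?xx ?yy \<noteq> 0" unfolding 2 using a by simp
    then have xx: "?xx \<noteq> 0" by auto
    have rr: "r j + r j \<noteq> 0" using F.r_nonzero[of j] d by (auto simp: dscale_def fun_eq_iff)
    have xr: "?xx \<in> R (r j + r j)" by (rule root_space_brk[OF F.x_root F.x_root])
    have yr: "?yy \<in> R (- (r j + r j))"
      using root_space_brk[OF F.y_root F.y_root, of j j] by (simp add: add.commute)
    have "r j + r j \<in> principal_roots D G"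
      unfolding principal_roots_def mem_Collect_eq
      using rootsI[OF xr xx rr] par r dscale_half[of "r j + r j" "r j"] by (metis rangeI)
    moreover
    \<comment> \<open>As [[x_j, x_j], [y_j, y_j]] = -4 a h_j, this factor turns the bracket into h_j
      / a, on which the root 2 \<open>r j\<close> takes the value 2.\<close>
    let ?c = "- 1 / (4 * ?a * ?a)"
    have "br ?xx (sc ?c ?yy) = hm (hscale D (1 / ?a) ?h)"
      unfolding brk_scale_right 2 hmap_scale using a by simp
    then have "sl2_coroot G (r j + r j) (hscale D (1 / ?a) ?h)"
      by (rule sl2_corootI[OF xr root_space_scale[OF yr]])
         (use a in \<open>simp add: linear_dual[OF F.r_dual]\<close>)
    ultimately show thesis using that[of 2] one ev[of 2] sub[of 2] by (simp add: d)
  qed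
qed

text \<open>An isotropic simple root is negated by the odd reflection at it, which is available
  because the root is odd. A non-isotropic one is negated by the reflection in it or in its
  double.\<close>

lemma negate_simple_odd:
  assumes F: "base_family r x y p" and r: "range r \<in> odd_bases D G"
  shows "\<exists>\<Sigma>\<in>all_bases D G. - r j \<in> \<Sigma>"
proof -
  interpret F: chevalley_family G D r x y p using F by (rule base_familyD)
  show ?thesis
  proof (cases "r j (F.coroot j) = 0")
    case True
    then interpret I: isotropic_simple_root G D r x y p j
      using isotropic_odd[OF F r True] base_familyD(2)[OF F] odd_base_regular[OF F r]
      by unfold_locales auto
    let ?X = "x \<circ> inv r" and ?Y = "y \<circ> inv r"
    have ent: "cartan_entry G ?X ?Y (r i) l = l (F.coroot i)" for i l
      by (rule F.cartan_entry_coroot) (simp_all add: F.r_inj)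
    have "base_with D G (range r) ?X ?Y" by (rule F.base_with_family) (rule base_familyD[OF F])
    moreover have "has_parity G (r j) 1" using F.pos_has_parity[of "unitv j" j] I.odd by simp
    moreover have "range I.r' = odd_reflection (cartan_entry G ?X ?Y) (r j) ` range r"
      using I.odd_reflection_r'[of "cartan_entry G ?X ?Y"] by (simp add: ent image_image)
    ultimately have "odd_reflects_to D G (range r) (range I.r')"
      unfolding odd_reflects_to_def using True ent by (metis rangeI)
    then have "range I.r' \<in> all_bases D G" using r odd_bases.odd odd_bases_all by blast
    moreover have "- r j \<in> range I.r'" using rangeI[of I.r' j] by (simp add: I.r'_def)
    ultimately show ?thesis by blast
  next
    case False
    obtain h m where *: "dscale m (r j) \<in> principal_roots D G" "sl2_coroot G (dscale m (r j)) h"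
      "even_reflection (dscale m (r j)) h (r j) = - r j"
      using nonisotropic_reflection[OF F r False] by metis
    then have "- r j \<in> even_reflection (dscale m (r j)) h ` range r" by (metis rangeI imageI)
    then show ?thesis by (rule bexI[OF _ all_bases.even[OF odd_bases_all[OF r] *(1,2)]])
  qed
qed

lemma negate_simple:
  assumes "\<Sigma> \<in> all_bases D G" "s \<in> \<Sigma>"
  shows "\<exists>\<Sigma>\<in>all_bases D G. - s \<in> \<Sigma>"
proof -
  obtain w wi \<Sigma>0 where w: "weyl w wi" "\<Sigma>0 \<in> odd_bases D G" "\<Sigma> = w ` \<Sigma>0"
    using all_bases_weyl[OF assms(1)] .
  obtain r x y p where F: "base_family r x y p" "\<Sigma>0 = range r" using odd_bases_family[OF w(2)] .
  obtain j where j: "s = w (r j)" using assms(2) w(3) F(2) by blast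
  have d: "in_dual D (r j)" by (rule chevalley_family.r_dual[OF base_familyD(1)[OF F(1)]])
  obtain \<Sigma>1 where \<Sigma>1: "\<Sigma>1 \<in> all_bases D G" "- r j \<in> \<Sigma>1"
    using negate_simple_odd[OF F(1)] F(2) w(2) by blast
  have "- s \<in> w ` \<Sigma>1" unfolding j using weyl_linear(2)[OF w(1) d d] \<Sigma>1(2) by (metis imageI)
  then show ?thesis by (rule bexI[OF _ weyl_all_bases[OF w(1) \<Sigma>1(1)]])
qed

end

section \<open>Signs of roots with respect to bases\<close>

text \<open>Stated for sets, since bases are sets and may be reached with different indexings;
  \<open>positive_wrt_range\<close> translates to coordinates of a family.\<close>

definition positive_wrt :: "('h \<Rightarrow> complex) set \<Rightarrow> ('h \<Rightarrow> complex) \<Rightarrow> bool" where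
  "positive_wrt \<Sigma> l \<longleftrightarrow> (\<exists>n::('h \<Rightarrow> complex) \<Rightarrow> int. (\<forall>s. 0 \<le> n s) \<and> l = (\<lambda>h. \<Sum>s\<in>\<Sigma>. of_int (n s) * s h))"

lemma positive_wrt_range:
  fixes r :: "'i::finite \<Rightarrow> 'h \<Rightarrow> complex"
  assumes "inj r"
  shows "positive_wrt (range r) l \<longleftrightarrow> (\<exists>n. (\<forall>i. 0 \<le> n i) \<and> l = wt r n)"
proof
  assume "positive_wrt (range r) l"
  then obtain n where n: "\<forall>s. 0 \<le> (n s :: int)" "l = (\<lambda>h. \<Sum>s\<in>range r. of_int (n s) * s h)"
    by (auto simp: positive_wrt_def)
  have "l = wt r (n \<circ> r)" by (rule ext) (simp add: n(2) wt_def sum.reindex[OF assms])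
  then show "\<exists>n. (\<forall>i. 0 \<le> n i) \<and> l = wt r n" using n(1) by (intro exI[of _ "n \<circ> r"]) simp
next
  assume "\<exists>n. (\<forall>i. 0 \<le> n i) \<and> l = wt r n"
  then obtain n where n: "\<forall>i. 0 \<le> n i" "l = wt r n" by blast
  have "l = (\<lambda>h. \<Sum>s\<in>range r. of_int ((n \<circ> inv r) s) * s h)"
    by (rule ext) (simp add: n(2) wt_def sum.reindex[OF assms] assms)
  then show "positive_wrt (range r) l" unfolding positive_wrt_def using n(1)
    by (intro exI[of _ "n \<circ> inv r"]) simp
qed

context chevalley_family
begin

text \<open>All coordinates of a root have the same sign, so a single nonzero one decides. Signs
  with respect to different bases are compared by means of one shared coordinate.\<close>

lemma positive_iff_coordinate:
  assumes "wt r n \<in> roots D G" "n i \<noteq> 0"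
  shows "positive_wrt (range r) (wt r n) \<longleftrightarrow> n i > 0"
proof
  assume "positive_wrt (range r) (wt r n)"
  then show "n i > 0"
    using assms(2) by (auto simp: positive_wrt_range[OF r_inj] wt_inj order.not_eq_order_implies_strict)
next
  assume n: "n i > 0"
  obtain m where m: "\<forall>i. 0 \<le> m i" "wt r n = wt r m \<or> wt r n = - wt r m" using root_sign[OF assms(1)] by blast
  have "wt r n \<noteq> - wt r m"
  proof
    assume "wt r n = - wt r m"
    then have "n = - m" by (simp add: wt_eq_minus)
    then have "n i = - m i" by simp
    moreover have "0 \<le> m i" using m(1) by blast
    ultimately show False using n by simp
  qed
  then show "positive_wrt (range r) (wt r n)" using m by (auto simp: positive_wrt_range[OF r_inj])
qed

lemma root_coordinates:
  assumes "l \<in> roots D G"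
  obtains n where "l = wt r n" "positive_wrt (range r) l \<longleftrightarrow> (\<forall>i. 0 \<le> n i)"
    "\<not> positive_wrt (range r) l \<longleftrightarrow> (\<forall>i. n i \<le> 0)" "n \<noteq> 0"
proof -
  obtain m where m: "\<forall>i. 0 \<le> m i" "l = wt r m \<or> l = - wt r m" using root_sign[OF assms] by blast
  obtain n where n: "l = wt r n" "(\<forall>i. 0 \<le> n i) \<or> (\<forall>i. n i \<le> 0)"
  proof (cases "l = wt r m")
    case True
    then show thesis using that m(1) by blast
  next
    case False
    then show thesis using that[of "- m"] m by (simp add: wt_minus)
  qed
  have n0: "n \<noteq> 0" using assms n(1) by (auto simp: roots_def)
  then obtain i where i: "n i \<noteq> 0" by (metis ext zero_fun_apply)
  have pos: "positive_wrt (range r) l \<longleftrightarrow> n i > 0"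
    using positive_iff_coordinate[of n i] assms n(1) i by simp
  have "positive_wrt (range r) l \<longleftrightarrow> (\<forall>i. 0 \<le> n i)" "\<not> positive_wrt (range r) l \<longleftrightarrow> (\<forall>i. n i \<le> 0)"
    unfolding pos using n(2) i by (metis linorder_not_less order.antisym)+
  then show thesis using that n(1) n0 by blast
qed

end

context kac_moody
begin

abbreviation positive where "positive \<equiv> positive_wrt (range (sroot D))"

lemma positive_of_simple:
  assumes "\<Sigma> \<in> all_bases D G" "l \<in> \<Sigma> \<or> dscale (1/2) l \<in> \<Sigma>"
  shows "positive_wrt \<Sigma> l"
proof -
  obtain r x y p where F: "base_family r x y p" "\<Sigma> = range r" using all_bases_family[OF assms(1)] .
  interpret F: chevalley_family G D r x y p using F(1) by (rule base_familyD)
  have "\<exists>j. l = r j \<or> l = r j + r j" using assms(2) unfolding F(2) by (metis dscale_half rangeE)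
  then obtain j where "l = wt r (unitv j) \<or> l = wt r (unitv j + unitv j)"
    by (auto simp only: wt_add wt_unitv)
  then show ?thesis unfolding F(2) positive_wrt_range[OF F.r_inj]
    by (elim disjE) (rule exI, rule conjI[rotated], assumption, simp)+
qed

lemma positive_antisym:
  assumes "\<Sigma> \<in> all_bases D G" "l \<in> roots D G" "positive_wrt \<Sigma> (- l)"
  shows "\<not> positive_wrt \<Sigma> l"
proof
  obtain r x y p where F: "base_family r x y p" "\<Sigma> = range r" using all_bases_family[OF assms(1)] .
  interpret F: chevalley_family G D r x y p using F(1) by (rule base_familyD)
  assume "positive_wrt \<Sigma> l"
  then obtain m n where mn: "\<forall>i. 0 \<le> m i" "- l = wt r m" "\<forall>i. 0 \<le> n i" "l = wt r n"
    using assms(3) unfolding F(2) positive_wrt_range[OF F.r_inj] by blast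
  then have "m = - n" using F.wt_eq_minus by metis
  then have "n i = 0" for i using mn(1,3) by (simp add: order.antisym)
  then have "n = 0" by (simp add: fun_eq_iff)
  then show False using assms(2) mn(4) by (simp add: roots_def)
qed

lemma real_changes_sign:
  assumes "l \<in> real_roots D G"
  shows "\<exists>\<Sigma>\<in>all_bases D G. positive_wrt \<Sigma> l" "\<exists>\<Sigma>\<in>all_bases D G. \<not> positive_wrt \<Sigma> l"
proof -
  obtain \<Sigma> where \<Sigma>: "\<Sigma> \<in> all_bases D G" "l \<in> \<Sigma> \<or> dscale (1/2) l \<in> \<Sigma>" and root: "l \<in> roots D G"
    using assms unfolding real_roots_def by blast
  show "\<exists>\<Sigma>\<in>all_bases D G. positive_wrt \<Sigma> l" using positive_of_simple[OF \<Sigma>] \<Sigma>(1) by blast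
  have half: "dscale (1/2) (- l) = - dscale (1/2) l" by (rule ext) (simp add: dscale_def)
  obtain \<Sigma>' where \<Sigma>': "\<Sigma>' \<in> all_bases D G" "- l \<in> \<Sigma>' \<or> dscale (1/2) (- l) \<in> \<Sigma>'"
    unfolding half using \<Sigma>(2) negate_simple[OF \<Sigma>(1)] by metis
  from positive_antisym[OF \<Sigma>'(1) root positive_of_simple[OF \<Sigma>']] \<Sigma>'(1)
  show "\<exists>\<Sigma>\<in>all_bases D G. \<not> positive_wrt \<Sigma> l" by blast
qed

text \<open>The only candidates are \<plusminus> \<open>r j\<close> and their doubles; negative
  multiples are real because \<open>- r j\<close> lies in a base too. Consequently an imaginary root
  has a nonzero coordinate away from any given \<open>j\<close>.\<close>

lemma real_multiple:
  assumes r: "base_family r x y p" "range r \<in> all_bases D G" and root: "wt r n \<in> roots D G"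
    and n: "\<And>i. i \<noteq> j \<Longrightarrow> n i = 0"
  shows "wt r n \<in> real_roots D G"
proof -
  interpret F: chevalley_family G D r x y p using r(1) by (rule base_familyD)
  have "n j \<in> {1, 2, -1, -2}" by (rule F.root_multiple[OF root n])
  moreover have "n = (\<lambda>i. n j * unitv j i)" by (rule ext) (use n in \<open>auto simp: unitv_def\<close>)
  then have "wt r n = (\<lambda>h. \<Sum>i\<in>UNIV. of_int (n j * unitv j i) * r i h)" by (metis wt_def)
  then have w: "wt r n = dscale (of_int (n j)) (r j)"
    by (simp add: dscale_def unitv_def if_distrib if_distribR mult.assoc cong: if_cong)
  obtain \<Sigma> where \<Sigma>: "\<Sigma> \<in> all_bases D G" "- r j \<in> \<Sigma>" using negate_simple[OF r(2), of "r j"] by auto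
  ultimately consider "wt r n = r j" | "dscale (1/2) (wt r n) = r j" | "wt r n = - r j"
    | "dscale (1/2) (wt r n) = - r j"
    using w by (auto simp: dscale_def fun_eq_iff)
  then show ?thesis
    unfolding real_roots_def mem_Collect_eq using root r(2) \<Sigma> by (cases) (metis rangeI)+
qed

section \<open>Invariance of the sign of imaginary roots\<close>

lemma imaginary_coordinate:
  assumes r: "base_family r x y p" "range r \<in> all_bases D G" and im: "wt r n \<in> imaginary_roots D G"
  obtains i where "i \<noteq> j" "n i \<noteq> 0"
  using real_multiple[OF r, of n j] im by (auto simp: imaginary_roots_def)

lemma imaginary_root: "l \<in> imaginary_roots D G \<Longrightarrow> l \<in> roots D G"
  by (simp add: imaginary_roots_def)

text \<open>Both the base and the root may change: odd reflections change the base, even ones are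
  viewed as changing the root, and transport by the Weyl group changes both.\<close>

lemma positive_transfer:
  assumes F: "base_family r x y p" and F': "base_family r' x' y' p'"
    and n: "wt r n \<in> roots D G" "wt r' n' \<in> roots D G" and i: "n i = n' i" "n i \<noteq> 0"
  shows "positive_wrt (range r) (wt r n) \<longleftrightarrow> positive_wrt (range r') (wt r' n')"
  using chevalley_family.positive_iff_coordinate[OF base_familyD(1)[OF F] n(1) i(2)]
    chevalley_family.positive_iff_coordinate[OF base_familyD(1)[OF F'] n(2), of i] i by simp

lemma imaginary_sign_odd:
  assumes "\<Sigma> \<in> odd_bases D G" "l \<in> imaginary_roots D G"
  shows "positive_wrt \<Sigma> l \<longleftrightarrow> positive l"
  using assms(1)
proof induction
  case (odd \<Sigma> \<Sigma>')
  obtain r0 x0 y0 p0 where F0: "base_family r0 x0 y0 p0" "\<Sigma> = range r0" using odd_bases_family[OF odd.hyps(1)] .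
  have inj: "inj r0" using base_familyD(1)[OF F0(1)] by (rule chevalley_family.r_inj)
  obtain j x y p where F: "base_family r0 x y p" and I: "isotropic_simple_root G D r0 x y p j"
    and \<Sigma>': "\<Sigma>' = range (isotropic_simple_root.r' G r0 x y j)"
    and F': "base_family (isotropic_simple_root.r' G r0 x y j) (isotropic_simple_root.x' G r0 x y j)
       (isotropic_simple_root.y' G r0 x y j) (isotropic_simple_root.p' G r0 x y p j)"
    using odd_reflection_family[OF inj, of \<Sigma>'] odd.hyps F0(2) by metis
  interpret I: isotropic_simple_root G D r0 x y p j by (rule I)
  have root: "l \<in> roots D G" using assms(2) by (rule imaginary_root)
  obtain n where n: "l = wt r0 n" using I.root_coordinates[OF root] by blast
  obtain i where i: "i \<noteq> j" "n i \<noteq> 0"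
    using imaginary_coordinate[OF F, of n j] odd_bases_all[OF odd.hyps(1)] F0(2) assms(2) n by metis
  let ?n = "\<lambda>i. if i = j then (\<Sum>k\<in>{k. I.adj k}. n k) - n j else n i"
  have n': "l = wt I.r' ?n" using I.wt_r'[of n] n by simp
  have "positive_wrt (range r0) l \<longleftrightarrow> positive_wrt (range I.r') l"
    using positive_transfer[OF F F', of n ?n i] root n n' i by simp
  then show ?case using odd.IH F0(2) \<Sigma>' by simp
qed simp

text \<open>\<alpha> need not be proportional to a root of \<Pi>. The comparison takes place in an
  odd-reflected base containing \<alpha> or its half, and \<open>imaginary_sign_odd\<close> leads
  back to \<Pi>.\<close>

lemma imaginary_sign_reflection:
  assumes \<alpha>: "\<alpha> \<in> principal_roots D G" "sl2_coroot G \<alpha> h" and l: "l \<in> imaginary_roots D G"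
  shows "positive (even_reflection \<alpha> h l) \<longleftrightarrow> positive l"
proof -
  let ?s = "even_reflection \<alpha> h"
  have sl: "?s l \<in> imaginary_roots D G" by (rule weyl_imaginary[OF weyl_reflection[OF \<alpha>] l])
  obtain \<Sigma> where \<Sigma>: "\<Sigma> \<in> odd_bases D G" "\<alpha> \<in> \<Sigma> \<or> dscale (1/2) \<alpha> \<in> \<Sigma>"
    using \<alpha>(1) by (auto simp: principal_roots_def)
  obtain r x y p where F: "base_family r x y p" "\<Sigma> = range r" using odd_bases_family[OF \<Sigma>(1)] .
  interpret F: chevalley_family G D r x y p using F(1) by (rule base_familyD)
  have "\<exists>j c. \<alpha> = dscale c (r j)"
  proof -
    have "\<exists>j. \<alpha> = r j \<or> \<alpha> = r j + r j" using \<Sigma>(2) unfolding F(2) by (metis dscale_half rangeE)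
    then obtain j where "\<alpha> = dscale 1 (r j) \<or> \<alpha> = dscale 2 (r j)" by (auto simp: dscale_def fun_eq_iff)
    then show ?thesis by blast
  qed
  then obtain j c where j: "\<alpha> = dscale c (r j)" by blast
  obtain n where n: "l = wt r n" using F.root_coordinates[OF imaginary_root[OF l]] by blast
  obtain n' where n': "?s l = wt r n'" using F.root_coordinates[OF imaginary_root[OF sl]] by blast
  obtain i where i: "i \<noteq> j" "n i \<noteq> 0"
    using imaginary_coordinate[OF F(1), of n j] odd_bases_all[OF \<Sigma>(1)] F(2) l n by metis
  \<comment> \<open>Independence is applied over the complex numbers, so integrality of
    \<open>l h * c\<close> does not enter; away from \<open>j\<close> the coordinates of
    \<open>l\<close> and its reflection agree.\<close>
  have "complex_of_int (n' i) - of_int (n i) + (if i = j then l h * c else 0) = 0"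
  proof (rule F.indep[of "\<lambda>k. complex_of_int (n' k) - of_int (n k) + (if k = j then l h * c else 0)" i])
    fix t
    have "wt r n' t = wt r n t - l h * (c * r j t)"
      unfolding n'[symmetric] n[symmetric] by (simp add: even_reflection_def dscale_def j)
    moreover have "(\<Sum>k\<in>UNIV. (of_int (n' k) - of_int (n k) + (if k = j then l h * c else 0)) * r k t)
      = wt r n' t - wt r n t + (\<Sum>k\<in>UNIV. if k = j then l h * c * r j t else 0)"
      unfolding wt_def sum_subtractf[symmetric] sum.distrib[symmetric]
      by (rule sum.cong) (auto simp: algebra_simps)
    ultimately show "(\<Sum>k\<in>UNIV. (complex_of_int (n' k) - of_int (n k) + (if k = j then l h * c else 0)) * r k t) = 0"
      by simp
  qed
  then have "n i = n' i" using i(1) by simp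
  then have "positive_wrt \<Sigma> l \<longleftrightarrow> positive_wrt \<Sigma> (?s l)"
    using positive_transfer[OF F(1) F(1), of n n' i] i n n' F(2) imaginary_root[OF l] imaginary_root[OF sl]
    by simp
  then show ?thesis using imaginary_sign_odd[OF \<Sigma>(1)] l sl by simp
qed

lemma imaginary_sign_weyl:
  assumes "weyl w wi" "l \<in> imaginary_roots D G"
  shows "positive (w l) \<longleftrightarrow> positive l"
  using assms(1)
proof induction
  case (step w wi \<alpha> h)
  then show ?case
    using imaginary_sign_reflection[OF step.hyps(2,3) weyl_imaginary[OF step.hyps(1) assms(2)]] by simp
qed simp

text \<open>The coordinates of \<open>l\<close> in \<open>w \<circ> r\<close> are those of
  \<open>wi l\<close> in \<open>r\<close>. This reduces the claim to an odd-reflected base and to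
  invariance of the sign under \<open>wi\<close>.\<close>

lemma imaginary_sign:
  assumes \<Sigma>: "\<Sigma> \<in> all_bases D G" and l: "l \<in> imaginary_roots D G"
  shows "positive_wrt \<Sigma> l \<longleftrightarrow> positive l"
proof -
  obtain w wi \<Sigma>0 where w: "weyl w wi" "\<Sigma>0 \<in> odd_bases D G" "\<Sigma> = w ` \<Sigma>0"
    using all_bases_weyl[OF \<Sigma>] .
  note wi = weyl_sym[OF w(1)]
  obtain r x y p where F: "base_family r x y p" "\<Sigma>0 = range r" using odd_bases_family[OF w(2)] .
  interpret F: chevalley_family G D r x y p using F(1) by (rule base_familyD)
  obtain x' y' where F': "base_family (w \<circ> r) x' y' p" using weyl_family[OF w(1) F(1)] by blast
  interpret F': chevalley_family G D "w \<circ> r" x' y' p using F' by (rule base_familyD)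
  have il: "wi l \<in> imaginary_roots D G" by (rule weyl_imaginary[OF wi l])
  obtain n where n: "wi l = wt r n" "n \<noteq> 0" using F.root_coordinates[OF imaginary_root[OF il]] by metis
  then obtain i where i: "n i \<noteq> 0" by (metis ext zero_fun_apply)
  have "w (wi l) = wt (w \<circ> r) n" unfolding n(1) by (rule weyl_wt(1)[OF w(1) F.r_dual])
  then have n': "l = wt (w \<circ> r) n" using weyl_inverse[OF wi] by simp
  have "positive_wrt \<Sigma>0 (wi l) \<longleftrightarrow> positive_wrt \<Sigma> l"
    using positive_transfer[OF F(1) F', of n n i] i n(1) n' imaginary_root[OF il] imaginary_root[OF l] F(2) w(3)
    by (simp add: image_comp)
  then show ?thesis using imaginary_sign_odd[OF w(2) il] imaginary_sign_weyl[OF wi l] by simp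
qed

section \<open>Reflections in real roots\<close>

text \<open>Only principal roots come with a lifted reflection, so the reflection in \<alpha> is
  obtained by conjugating one in an odd-reflected base with \<open>w\<close>.\<close>

lemma real_root_reflection:
  assumes \<alpha>: "\<alpha> \<in> real_roots D G" and ni: "non_isotropic G \<alpha>"
  obtains s where "weyl s s" "s \<alpha> = - \<alpha>" "\<And>l. l \<in> roots D G \<Longrightarrow> \<exists>k. s l = l + dscale (of_int k) \<alpha>"
proof -
  obtain \<Sigma> where \<Sigma>: "\<Sigma> \<in> all_bases D G" "\<alpha> \<in> \<Sigma> \<or> dscale (1/2) \<alpha> \<in> \<Sigma>" and root: "\<alpha> \<in> roots D G"
    using \<alpha> by (auto simp: real_roots_def)
  obtain w wi \<Sigma>0 where w: "weyl w wi" "\<Sigma>0 \<in> odd_bases D G" "\<Sigma> = w ` \<Sigma>0"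
    using all_bases_weyl[OF \<Sigma>(1)] .
  note wi = weyl_sym[OF w(1)]
  obtain r x y p where F: "base_family r x y p" "\<Sigma>0 = range r" using odd_bases_family[OF w(2)] .
  have odd: "range r \<in> odd_bases D G" using w(2) F(2) by simp
  interpret F: chevalley_family G D r x y p using F(1) by (rule base_familyD)
  obtain x' y' where F': "base_family (w \<circ> r) x' y' p"
    "\<forall>i k. (w \<circ> r) k (chevalley_family.coroot G x' y' i) = r k (F.coroot i)"
    using weyl_family[OF w(1) F(1)] by blast
  interpret F': chevalley_family G D "w \<circ> r" x' y' p using F'(1) by (rule base_familyD)
  interpret opp: chevalley_family G D "\<lambda>i. - (w \<circ> r) i" y' x' p by (rule F'.opposite)
  have "\<exists>j. \<alpha> = w (r j) \<or> \<alpha> = w (r j) + w (r j)"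
    using \<Sigma>(2)
  proof
    assume "\<alpha> \<in> \<Sigma>"
    then show ?thesis unfolding w(3) F(2) by auto
  next
    assume "dscale (1/2) \<alpha> \<in> \<Sigma>"
    then obtain j where "dscale (1/2) \<alpha> = w (r j)" unfolding w(3) F(2) by auto
    then have "\<alpha> = w (r j) + w (r j)" by (simp only: dscale_half)
    then show ?thesis by blast
  qed
  then obtain j where j: "\<alpha> = w (r j) \<or> \<alpha> = w (r j) + w (r j)" by blast
  have double: "br (x j) (x j) \<noteq> 0" if "\<alpha> = w (r j) + w (r j)"
  proof
    assume 0: "br (x j) (x j) = 0"
    have "w (r j + r j) = \<alpha>" using weyl_linear(1)[OF w(1) F.r_dual F.r_dual, of j j] that by (simp only:)
    then have "wi \<alpha> = r j + r j" using weyl_inverse[OF w(1)] by metis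
    then have "r j + r j \<in> roots D G" using weyl_roots[OF wi root] by simp
    then obtain u where "u \<in> R (r j + r j)" "u \<noteq> 0" by (rule rootsE)
    then show False using F.root_space_double[of u j] 0 by auto
  qed
  have odd_double: "p j = 1" if "\<alpha> = w (r j) + w (r j)"
    using double[OF that] even_self_brk[of "x j"] F.x_par[of j] by (cases "p j") auto
  \<comment> \<open>For \<alpha> = w(r_j) a zero entry contradicts \<open>non_isotropic\<close>,
    root spaces being one-dimensional. For \<alpha> = 2 w(r_j) it would give [x_j, x_j] = 0, and
    then 2 r_j would not be a root.\<close>
  have a: "r j (F.coroot j) \<noteq> 0"
  proof
    assume a0: "r j (F.coroot j) = 0"
    from j show False
    proof
      assume aj: "\<alpha> = w (r j)"
      obtain u v where uv: "u \<in> R \<alpha>" "v \<in> R (- \<alpha>)" "br u v \<noteq> 0" "\<alpha> (h_brk G u v) = 2"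
        using ni by (auto simp: non_isotropic_def)
      obtain b c where bc: "u = sc b (x' j)" "v = sc c (y' j)"
        using F'.root_space_simple[of u j] opp.root_space_simple[of v j] uv(1,2) aj by auto
      have "br u v = hm (hscale D (b * c) (F'.coroot j))"
        by (simp add: bc brk_scale_left brk_scale_right F'.brk_xy_coroot hmap_scale)
      then have "h_brk G u v = hscale D (b * c) (F'.coroot j)" by (rule h_brk_eq)
      then have "b * c * (w \<circ> r) j (F'.coroot j) = 2"
        using uv(4) linear_dual(2)[OF F'.r_dual] aj by simp
      then show False using F'(2) a0 by simp
    next
      assume "\<alpha> = w (r j) + w (r j)"
      interpret I: isotropic_simple_root G D r x y p j
        using odd_double[OF \<open>\<alpha> = w (r j) + w (r j)\<close>] base_familyD(2)[OF F(1)] odd_base_regular[OF F(1) odd] a0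
        by unfold_locales auto
      show False using I.brk_not_adj[OF I.adj_self] double[OF \<open>\<alpha> = w (r j) + w (r j)\<close>] by simp
    qed
  qed
  obtain h m where hm: "dscale m (r j) \<in> principal_roots D G" "sl2_coroot G (dscale m (r j)) h"
    "p j = 0 \<and> m = 1 \<or> p j = 1 \<and> m = 2" "even_reflection (dscale m (r j)) h (r j) = - r j"
    using nonisotropic_reflection[OF F(1) odd a] .
  let ?rho = "even_reflection (dscale m (r j)) h"
  let ?s = "w \<circ> (?rho \<circ> wi)"
  have ws: "weyl ?s ?s"
    using weyl_comp[OF w(1) weyl_comp[OF weyl_reflection[OF hm(1,2)] wi]] by (simp add: comp_assoc)
  have d: "in_dual D (r j)" by (rule F.r_dual)
  have wd: "in_dual D (w (r j))" by (rule weyl_linear(4)[OF w(1) d d])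
  have srj: "?s (w (r j)) = - w (r j)"
    using hm(4) weyl_inverse[OF w(1)] weyl_linear(2)[OF w(1) d d] by simp
  have sa: "?s \<alpha> = - \<alpha>"
    using j weyl_linear(1)[OF ws wd wd] srj by auto
  \<comment> \<open>\<open>t\<close> is 2 when \<alpha> = w(r_j) is odd, since the reflection is
    then in 2 \<alpha>, and 1 otherwise. It keeps the shift along \<alpha> integral.\<close>
  obtain t :: int where t: "dscale m (w (r j)) = dscale (of_int t) \<alpha>"
  proof -
    have "\<exists>t::int. dscale m (w (r j)) = dscale (of_int t) \<alpha>"
      using j
    proof
      assume "\<alpha> = w (r j)"
      then show ?thesis using hm(3) by (intro exI[of _ "if m = 1 then 1 else 2"]) auto
    next
      assume aj: "\<alpha> = w (r j) + w (r j)"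
      then show ?thesis using hm(3) odd_double by (intro exI[of _ 1]) (auto simp: dscale_def fun_eq_iff)
    qed
    then show thesis using that by blast
  qed
  have "\<exists>k. ?s l = l + dscale (of_int k) \<alpha>" if l: "l \<in> roots D G" for l
  proof -
    have il: "wi l \<in> roots D G" by (rule weyl_roots[OF wi l])
    obtain k where k: "wi l h = of_int k" using coroot_integral[OF hm(1,2) il] by blast
    have dl: "in_dual D (wi l)" using il by (simp add: roots_def)
    have dm: "in_dual D (dscale c (r j))" for c by (rule weyl_linear(7)[OF w(1) d d])
    have "?rho (wi l) = wi l + dscale (- of_int k * m) (r j)"
      by (rule ext) (simp add: even_reflection_def dscale_def k)
    then have "?s l = w (wi l) + dscale (- of_int k * m) (w (r j))"
      by (simp only: comp_apply weyl_linear(1)[OF w(1) dl dm] weyl_linear(3)[OF w(1) d d])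
    also have "dscale (- of_int k * m) (w (r j)) = dscale (- of_int k) (dscale m (w (r j)))"
      by (rule ext) (simp add: dscale_def)
    also have "\<dots> = dscale (of_int (- k * t)) \<alpha>" unfolding t by (rule ext) (simp add: dscale_def)
    finally have "?s l = l + dscale (of_int (- k * t)) \<alpha>" by (simp only: weyl_inverse[OF wi])
    then show ?thesis by blast
  qed
  then show thesis using that[OF ws sa] by blast
qed

section \<open>Root strings\<close>

text \<open>\<open>c\<close> is the shift of \<beta> under \<open>s\<close>; since \<open>s\<close>
  negates \<alpha>, positions are mirrored at c/2.\<close>

lemma string_reflection:
  assumes \<alpha>: "\<alpha> \<in> roots D G" and \<beta>: "\<beta> \<in> roots D G"
    and s: "weyl s s" "s \<alpha> = - \<alpha>" "\<And>l. l \<in> roots D G \<Longrightarrow> \<exists>k. s l = l + dscale (of_int k) \<alpha>"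
  obtains c where "\<And>k. s (string_element \<beta> \<alpha> k) = string_element \<beta> \<alpha> (c - k)"
proof -
  obtain c where c: "s \<beta> = \<beta> + dscale (of_int c) \<alpha>" using s(3)[OF \<beta>] by blast
  have d: "in_dual D \<alpha>" "in_dual D \<beta>" using \<alpha> \<beta> by (auto simp: roots_def)
  have "s (string_element \<beta> \<alpha> k) = string_element \<beta> \<alpha> (c - k)" for k
  proof -
    have "s (string_element \<beta> \<alpha> k) = s \<beta> + dscale (of_int k) (s \<alpha>)"
      unfolding string_element_def
      using weyl_linear(1)[OF s(1) d(2) weyl_linear(7)[OF s(1) d(1) d(1)]] weyl_linear(3)[OF s(1) d(1) d(1)]
      by simp
    also have "\<dots> = string_element \<beta> \<alpha> (c - k)"
      unfolding c s(2) string_element_def by (rule ext) (simp add: dscale_def algebra_simps)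
    finally show ?thesis .
  qed
  then show thesis using that by blast
qed

text \<open>In a base where \<alpha> = t r_j, suppose that \<beta> has a nonzero coordinate away
  from \<open>j\<close>. It is constant along the string, so its sign bounds the coordinate at
  \<open>j\<close>, hence \<open>k\<close>, on one side; the mirror symmetry bounds the other.
  Otherwise the string consists of multiples of \<open>r j\<close>, of which only \<plusminus>1 and
  \<plusminus>2 can be roots.\<close>

lemma string_finite:
  assumes \<alpha>: "\<alpha> \<in> real_roots D G" and \<beta>: "\<beta> \<in> roots D G"
    and sym: "\<And>k. string_element \<beta> \<alpha> k \<in> roots D G \<Longrightarrow> string_element \<beta> \<alpha> (c - k) \<in> roots D G"
  shows "finite {k. string_element \<beta> \<alpha> k \<in> roots D G}"
proof -
  obtain \<Sigma> where \<Sigma>: "\<Sigma> \<in> all_bases D G" "\<alpha> \<in> \<Sigma> \<or> dscale (1/2) \<alpha> \<in> \<Sigma>"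
    using \<alpha> by (auto simp: real_roots_def)
  obtain r x y p where F: "base_family r x y p" "\<Sigma> = range r" using all_bases_family[OF \<Sigma>(1)] .
  interpret F: chevalley_family G D r x y p using F(1) by (rule base_familyD)
  have "\<exists>j. \<alpha> = r j \<or> \<alpha> = r j + r j" using \<Sigma>(2) unfolding F(2) by (metis dscale_half rangeE)
  then obtain j where "\<alpha> = dscale (of_int 1) (r j) \<or> \<alpha> = dscale (of_int 2) (r j)"
    by (auto simp: dscale_def fun_eq_iff)
  then have "\<exists>t::int. \<alpha> = dscale (of_int t) (r j) \<and> t \<ge> 1"
  proof
    show ?thesis if "\<alpha> = dscale (of_int 1) (r j)" using that by (intro exI[of _ 1]) simp
    show ?thesis if "\<alpha> = dscale (of_int 2) (r j)" using that by (intro exI[of _ 2]) simp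
  qed
  then obtain t :: int where t: "\<alpha> = dscale (of_int t) (r j)" "t \<ge> 1" by blast
  obtain n where n: "\<beta> = wt r n" using F.root_coordinates[OF \<beta>] by blast
  let ?m = "\<lambda>k i. n i + (if i = j then k * t else 0)"
  have se: "string_element \<beta> \<alpha> k = wt r (?m k)" for k
  proof
    fix h
    have "wt r (?m k) h = wt r n h + (\<Sum>i\<in>UNIV. if i = j then of_int (k * t) * r j h else 0)"
      unfolding wt_def sum.distrib[symmetric] by (rule sum.cong) (auto simp: algebra_simps)
    then show "string_element \<beta> \<alpha> k h = wt r (?m k) h"
      by (simp add: string_element_def n t dscale_def)
  qed
  have coord: "(\<forall>i. 0 \<le> ?m k i) \<or> (\<forall>i. ?m k i \<le> 0)" if k: "string_element \<beta> \<alpha> k \<in> roots D G" for k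
  proof -
    obtain m where m: "string_element \<beta> \<alpha> k = wt r m" "positive_wrt (range r) (string_element \<beta> \<alpha> k) \<longleftrightarrow> (\<forall>i. 0 \<le> m i)"
      "\<not> positive_wrt (range r) (string_element \<beta> \<alpha> k) \<longleftrightarrow> (\<forall>i. m i \<le> 0)"
      using F.root_coordinates[OF k] by metis
    have "?m k = m" using m(1) unfolding se F.wt_inj .
    then show ?thesis using m(2,3) by blast
  qed
  have mono: "k * t \<ge> k" if "k \<ge> 0" for k using that t(2) by (simp add: mult_le_cancel_left1)
  have mono': "k * t \<le> k" if "k \<le> 0" for k using mono[of "- k"] that by simp
  \<comment> \<open>The slack 2 is for multiples of \<open>r j\<close>; the other case uses the
    bound with 0 in its place.\<close>
  have lo: "- \<bar>n j\<bar> - 2 \<le> k" if "- 2 \<le> n j + k * t" for k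
  proof (cases "k \<ge> 0")
    case False
    then show ?thesis using mono'[of k] that by linarith
  qed linarith
  have hi: "k \<le> \<bar>n j\<bar> + 2" if "n j + k * t \<le> 2" for k
  proof (cases "k \<le> 0")
    case False
    then show ?thesis using mono[of k] that by linarith
  qed linarith
  let ?B = "{- \<bar>n j\<bar> - \<bar>c\<bar> - 2..\<bar>n j\<bar> + \<bar>c\<bar> + 2}"
  have "k \<in> ?B" if k: "string_element \<beta> \<alpha> k \<in> roots D G" for k
  proof (cases "\<exists>i. i \<noteq> j \<and> n i \<noteq> 0")
    case True
    then obtain i where i: "i \<noteq> j" "n i \<noteq> 0" by blast
    have bound: "(n i > 0 \<longrightarrow> 0 \<le> n j + k * t) \<and> (n i < 0 \<longrightarrow> n j + k * t \<le> 0)"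
      if "string_element \<beta> \<alpha> k \<in> roots D G" for k
      using coord[OF that]
    proof
      assume *: "\<forall>i. 0 \<le> ?m k i"
      show ?thesis using *[rule_format, of i] *[rule_format, of j] i by auto
    next
      assume *: "\<forall>i. ?m k i \<le> 0"
      show ?thesis using *[rule_format, of i] *[rule_format, of j] i by auto
    qed
    consider "n i > 0" | "n i < 0" using i(2) by linarith
    then have "\<bar>k\<bar> \<le> \<bar>n j\<bar> + \<bar>c\<bar> + 2"
    proof cases
      case 1
      then show ?thesis using lo[of k] lo[of "c - k"] bound[OF k] bound[OF sym[OF k]] by linarith
    next
      case 2
      then show ?thesis using hi[of k] hi[of "c - k"] bound[OF k] bound[OF sym[OF k]] by linarith
    qed
    then show ?thesis by (simp add: abs_le_iff)
  next
    case False
    have "?m k j \<in> {1, 2, -1, -2}" by (rule F.root_multiple) (use k se False in auto)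
    then have "- 2 \<le> n j + k * t" "n j + k * t \<le> 2" by auto
    then have "- \<bar>n j\<bar> - 2 \<le> k" "k \<le> \<bar>n j\<bar> + 2" using lo[of k] hi[of k] by auto
    then show ?thesis using abs_ge_zero[of c] by (simp only: atLeastAtMost_iff) linarith
  qed
  then have "{k. string_element \<beta> \<alpha> k \<in> roots D G} \<subseteq> ?B" by blast
  then show ?thesis by (rule finite_subset) (rule finite_atLeastAtMost_int)
qed

text \<open>An imaginary root has the same sign with respect to all bases, and so has a root lying on the
  segment between two imaginary roots of equal sign; a real root changes its sign.\<close>

lemma between_imaginary:
  assumes "string_element \<beta> \<alpha> a \<in> imaginary_roots D G" "string_element \<beta> \<alpha> b \<in> imaginary_roots D G"
    and sign: "positive (string_element \<beta> \<alpha> a)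
      \<longleftrightarrow> positive (string_element \<beta> \<alpha> b)"
    and k: "string_element \<beta> \<alpha> k \<in> roots D G" "a < b" "a \<le> k" "k \<le> b"
  shows "string_element \<beta> \<alpha> k \<in> imaginary_roots D G"
proof (rule ccontr)
  let ?e = "string_element \<beta> \<alpha>"
  assume "?e k \<notin> imaginary_roots D G"
  then have real: "?e k \<in> real_roots D G" using k(1) by (simp add: imaginary_roots_def)
  have same: "positive_wrt \<Sigma> (?e k) \<longleftrightarrow> positive (?e a)" if \<Sigma>: "\<Sigma> \<in> all_bases D G" for \<Sigma>
  proof -
    obtain r x y p where F: "base_family r x y p" "\<Sigma> = range r" using all_bases_family[OF \<Sigma>] .
    interpret F: chevalley_family G D r x y p using F(1) by (rule base_familyD)
    obtain na where na: "?e a = wt r na" "positive_wrt \<Sigma> (?e a) \<longleftrightarrow> (\<forall>i. 0 \<le> na i)"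
      "\<not> positive_wrt \<Sigma> (?e a) \<longleftrightarrow> (\<forall>i. na i \<le> 0)"
      using F.root_coordinates[OF imaginary_root[OF assms(1)]] F(2) by metis
    obtain nb where nb: "?e b = wt r nb" "positive_wrt \<Sigma> (?e b) \<longleftrightarrow> (\<forall>i. 0 \<le> nb i)"
      "\<not> positive_wrt \<Sigma> (?e b) \<longleftrightarrow> (\<forall>i. nb i \<le> 0)"
      using F.root_coordinates[OF imaginary_root[OF assms(2)]] F(2) by metis
    obtain nk where nk: "?e k = wt r nk" "positive_wrt \<Sigma> (?e k) \<longleftrightarrow> (\<forall>i. 0 \<le> nk i)"
      "\<not> positive_wrt \<Sigma> (?e k) \<longleftrightarrow> (\<forall>i. nk i \<le> 0)"
      using F.root_coordinates[OF k(1)] F(2) by metis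
    \<comment> \<open>The element at \<open>k\<close> is a weighted mean of those at
      \<open>a\<close> and \<open>b\<close>; clearing the denominator b - a keeps the coordinates
      integral.\<close>
    have "wt r (\<lambda>i. (b - a) * nk i) = wt r (\<lambda>i. (b - k) * na i + (k - a) * nb i)"
    proof
      fix h
      have e: "wt r nk h = \<beta> h + of_int k * \<alpha> h" "wt r na h = \<beta> h + of_int a * \<alpha> h"
        "wt r nb h = \<beta> h + of_int b * \<alpha> h"
        unfolding nk(1)[symmetric] na(1)[symmetric] nb(1)[symmetric]
        by (simp_all add: string_element_def dscale_def)
      have "wt r (\<lambda>i. (b - a) * nk i) h = of_int (b - a) * wt r nk h"
        by (simp add: wt_def sum_distrib_left mult.assoc)
      also have "\<dots> = of_int (b - k) * wt r na h + of_int (k - a) * wt r nb h"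
        unfolding e by (simp add: algebra_simps)
      also have "\<dots> = wt r (\<lambda>i. (b - k) * na i + (k - a) * nb i) h"
        by (simp add: wt_def sum_distrib_left sum.distrib distrib_right mult.assoc)
      finally show "wt r (\<lambda>i. (b - a) * nk i) h = wt r (\<lambda>i. (b - k) * na i + (k - a) * nb i) h" .
    qed
    then have eq: "(b - a) * nk i = (b - k) * na i + (k - a) * nb i" for i
      using fun_cong[of "\<lambda>i. (b - a) * nk i" _ i] by (simp add: F.wt_inj)
    have pa: "positive_wrt \<Sigma> (?e a) \<longleftrightarrow> positive (?e a)"
      and pb: "positive_wrt \<Sigma> (?e b) \<longleftrightarrow> positive (?e a)"
      using imaginary_sign[OF \<Sigma>] assms(1,2) sign by simp_all
    show ?thesis
    proof (cases "positive (?e a)")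
      case True
      have "0 \<le> nk i" for i
      proof -
        have "0 \<le> na i" "0 \<le> nb i" using True pa pb na(2) nb(2) by blast+
        then have "0 \<le> (b - a) * nk i" unfolding eq using k(3,4) by simp
        then show ?thesis using k(2) by (simp add: zero_le_mult_iff)
      qed
      then show ?thesis using True nk(2) by blast
    next
      case False
      have "nk i \<le> 0" for i
      proof -
        have "na i \<le> 0" "nb i \<le> 0" using False pa pb na(3) nb(3) by blast+
        then have "(b - k) * na i \<le> 0" "(k - a) * nb i \<le> 0" using k(3,4) by (simp_all add: mult_le_0_iff)
        then have "(b - a) * nk i \<le> 0" unfolding eq by linarith
        then show ?thesis using k(2) by (simp add: mult_le_0_iff)
      qed
      then show ?thesis using False nk(3) by blast
    qed
  qed
  show False using real_changes_sign[OF real] same by blast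
qed

end

text \<open>The imaginary positions are exactly those at distance at most some \<open>M\<close> from the centre \<open>c/2\<close> of
  the reflection.\<close>

lemma symmetric_string_pattern:
  fixes K I :: "int set" and c :: int
  assumes fin: "finite K" and IK: "I \<subseteq> K" and sym: "\<forall>k\<in>K. c - k \<in> K"
    and conv: "\<forall>a\<in>I. \<forall>k\<in>K. \<bar>2 * k - c\<bar> \<le> \<bar>2 * a - c\<bar> \<longrightarrow> k \<in> I"
  shows "\<exists>(p::nat) (q::nat) (r::nat) (ks::int list).
    sorted_wrt (<) ks \<and> set ks = K \<and> length ks = p + q + r \<and>
    (\<forall>i<p. ks ! i \<in> K - I) \<and> (\<forall>i\<in>{p..<p + q}. ks ! i \<in> I) \<and> (\<forall>i\<in>{p + q..<p + q + r}. ks ! i \<in> K - I) \<and>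
    (q \<noteq> 0 \<longrightarrow> p = r)"
proof -
  \<comment> \<open>Doubled distances avoid the half-integral centre c/2. For empty \<open>I\<close>
    the value -1 makes the condition on distances unsatisfiable.\<close>
  define M where "M = (if I = {} then - 1 else Max ((\<lambda>a. \<bar>2 * a - c\<bar>) ` I))"
  \<comment> \<open>With no imaginary positions the whole string is put into the first
    block.\<close>
  define A where "A = (if I = {} then K else {k \<in> K. 2 * k - c < - M})"
  define C where "C = (if I = {} then {} else {k \<in> K. 2 * k - c > M})"
  have finI: "finite I" using fin IK by (rule rev_finite_subset)
  have finAC: "finite A" "finite C" using fin by (auto simp: A_def C_def)
  have I: "k \<in> I \<longleftrightarrow> k \<in> K \<and> \<bar>2 * k - c\<bar> \<le> M" for k
  proof (cases "I = {}")
    case False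
    have "M \<in> (\<lambda>a. \<bar>2 * a - c\<bar>) ` I" unfolding M_def using False finI by simp
    then obtain a where a: "a \<in> I" "M = \<bar>2 * a - c\<bar>" by blast
    have "\<bar>2 * k - c\<bar> \<le> M" if "k \<in> I" unfolding M_def using False finI that by simp
    then show ?thesis using conv a IK by auto
  next
    case True
    have "0 \<le> \<bar>2 * k - c\<bar>" by simp
    moreover have "M = - 1" using True by (simp add: M_def)
    ultimately have "\<not> \<bar>2 * k - c\<bar> \<le> M" by linarith
    then show ?thesis using True by simp
  qed
  have "k \<in> K \<longleftrightarrow> k \<in> A \<or> k \<in> I \<or> k \<in> C" for k
  proof (cases "I = {}")
    case False
    then show ?thesis unfolding A_def C_def I[of k] abs_le_iff by (cases "k \<in> K"; simp; linarith)
  qed (simp add: A_def C_def)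
  then have K: "K = A \<union> I \<union> C" by blast
  have AC: "A \<inter> I = {}" "C \<inter> I = {}" using I by (auto simp: A_def C_def split: if_splits)
  let ?la = "sorted_list_of_set A" and ?li = "sorted_list_of_set I" and ?lc = "sorted_list_of_set C"
  let ?ks = "?la @ ?li @ ?lc"
  have "\<forall>a\<in>A. \<forall>i\<in>I. a < i" "\<forall>i\<in>I. \<forall>k\<in>C. i < k" "\<forall>a\<in>A. \<forall>k\<in>C. a < k"
    using I by (auto simp: A_def C_def abs_le_iff split: if_splits)
  then have sorted: "sorted_wrt (<) ?ks"
    using finAC finI by (auto simp: sorted_wrt_append)
  have set: "set ?ks = K" using finAC finI K by auto
  have len: "length ?la = card A" "length ?li = card I" "length ?lc = card C" by simp_all
  have nth: "?la ! i \<in> A" if "i < card A" for i using nth_mem[of i ?la] that finAC by simp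
  have nthI: "?li ! i \<in> I" if "i < card I" for i using nth_mem[of i ?li] that finI by simp
  have nthC: "?lc ! i \<in> C" if "i < card C" for i using nth_mem[of i ?lc] that finAC by simp
  \<comment> \<open>The mirror map exchanges the positions left and right of the imaginary
    block.\<close>
  have "card A = card C" if "I \<noteq> {}"
  proof (rule bij_betw_same_card[of "\<lambda>k. c - k"])
    show "bij_betw (\<lambda>k. c - k) A C"
      by (rule bij_betw_byWitness[of _ "\<lambda>k. c - k"]) (use that sym in \<open>auto simp: A_def C_def\<close>)
  qed
  then have sym_card: "card I \<noteq> 0 \<longrightarrow> card A = card C" by (cases "I = {}") simp_all
  have "\<forall>i<card A. ?ks ! i \<in> K - I"
  proof (intro allI impI)
    fix i assume that: "i < card A"
    show "?ks ! i \<in> K - I"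
      using nth[OF that] that K AC by (auto simp: nth_append)
  qed
  moreover have "\<forall>i\<in>{card A..<card A + card I}. ?ks ! i \<in> I"
  proof
    fix i assume that: "i \<in> {card A..<card A + card I}"
    show "?ks ! i \<in> I" using nthI[of "i - card A"] that by (auto simp: nth_append)
  qed
  moreover have "\<forall>i\<in>{card A + card I..<card A + card I + card C}. ?ks ! i \<in> K - I"
  proof
    fix i assume that: "i \<in> {card A + card I..<card A + card I + card C}"
    have "?ks ! i = ?lc ! (i - card A - card I)" using that by (auto simp: nth_append)
    moreover have "i - card A - card I < card C" using that by auto
    ultimately show "?ks ! i \<in> K - I" using nthC[of "i - card A - card I"] K AC by auto
  qed
  moreover have "length ?ks = card A + card I + card C" by simp
  ultimately show ?thesis using sorted set sym_card
    by (intro exI[of _ "card A"] exI[of _ "card I"] exI[of _ "card C"] exI[of _ ?ks] conjI)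
qed

theorem mainTheorem3:
  fixes D :: "('h::ab_group_add, 'i::finite) cartan_datum"
    and T :: "('h, 'i, 't::ab_group_add) gen_superalg"
    and G :: "('h, 'i, 'g::ab_group_add) gen_superalg"
    and \<alpha> \<beta> :: "'h \<Rightarrow> complex"
  assumes "realization D"
    and "cmat D \<noteq> 0" and "indecomposable (cmat D)"
    and "contragredient_superalgebra D T G"
    and "regular_kac_moody D G"
    and "quasisimple G"
    and "\<alpha> \<in> real_roots D G" and "non_isotropic G \<alpha>"
    and "\<beta> \<in> roots D G"
    and "root_string D G \<beta> \<alpha> \<inter> real_roots D G \<noteq> {}"
  shows "\<exists>(p::nat) (q::nat) (r::nat) (ks::int list).
           sorted_wrt (<) ks \<and>
           string_element \<beta> \<alpha> ` set ks = root_string D G \<beta> \<alpha> \<and>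
           length ks = p + q + r \<and>
           (\<forall>i < p. string_element \<beta> \<alpha> (ks ! i) \<in> real_roots D G) \<and>
           (\<forall>i \<in> {p..<p + q}. string_element \<beta> \<alpha> (ks ! i) \<in> imaginary_roots D G) \<and>
           (\<forall>i \<in> {p + q..<p + q + r}. string_element \<beta> \<alpha> (ks ! i) \<in> real_roots D G) \<and>
           (q \<noteq> 0 \<longrightarrow> p = r)"
proof -
  note family = contragredient_chevalley_family[OF assms(1,4)]
  interpret Pi: chevalley_family G D "sroot D" "xpos G" "xneg G" "cpar D" by (rule family(1))
  have "\<not> Pi.VH.dependent (range (scoroot D))" using assms(1) by (simp add: realization_def)
  then have "scoroot D i \<noteq> 0" for i using Pi.VH.dependent_zero by (metis rangeI)
  then interpret kac_moody G D
    using assms(1,2,5,6) family(2) by unfold_locales (auto simp: realization_def)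
  let ?e = "string_element \<beta> \<alpha>"
  have \<alpha>: "\<alpha> \<in> roots D G" using assms(7) by (simp add: real_roots_def)
  obtain s where s: "weyl s s" "s \<alpha> = - \<alpha>" "\<And>l. l \<in> roots D G \<Longrightarrow> \<exists>k. s l = l + dscale (of_int k) \<alpha>"
    using real_root_reflection[OF assms(7,8)] by blast
  obtain c where c: "\<And>k. s (?e k) = ?e (c - k)" using string_reflection[OF \<alpha> assms(9) s] by blast
  define K where "K = {k. ?e k \<in> roots D G}"
  define I where "I = {k. ?e k \<in> imaginary_roots D G}"
  have sym: "c - k \<in> K" if "k \<in> K" for k using that weyl_roots[OF s(1), of "?e k"] c by (simp add: K_def)
  have symI: "c - k \<in> I" if "k \<in> I" for k using that weyl_imaginary[OF s(1), of "?e k"] c by (simp add: I_def)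
  have fin: "finite K"
    unfolding K_def by (rule string_finite[OF assms(7,9), of c]) (use sym in \<open>simp add: K_def\<close>)
  have IK: "I \<subseteq> K" by (auto simp: I_def K_def imaginary_root)
  have conv: "k \<in> I" if a: "a \<in> I" "k \<in> K" "\<bar>2 * k - c\<bar> \<le> \<bar>2 * a - c\<bar>" for a k
  proof -
    \<comment> \<open>The mirror image of an imaginary position has the same sign, being its image
      under the Weyl group element \<open>s\<close>, so \<open>between_imaginary\<close> applies to
      the pair.\<close>
    have *: "k \<in> I" if "a \<in> I" "a < c - a" "a \<le> k" "k \<le> c - a" for a
    proof -
      have "positive (?e a) \<longleftrightarrow> positive (?e (c - a))"
        using imaginary_sign_weyl[OF s(1), of "?e a"] that(1) c[of a] by (simp add: I_def)
      then show ?thesis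
        using between_imaginary[of \<beta> \<alpha> a "c - a" k] that symI[OF that(1)] a(2) by (simp add: I_def K_def)
    qed
    \<comment> \<open>The distance condition places \<open>k\<close> between \<open>a\<close> and c
      - a in either order; if the two coincide, then k = a.\<close>
    consider "2 * a = c" | "a < c - a" | "c - a < a" by linarith
    then show ?thesis
    proof cases
      case 1
      then have "k = a" using a(3) by simp
      then show ?thesis using a(1) by simp
    next
      case 2
      then show ?thesis by (intro *[of a]) (use a in auto)
    next
      case 3
      then show ?thesis by (intro *[of "c - a"]) (use a symI in auto)
    qed
  qed
  have img: "?e ` K = root_string D G \<beta> \<alpha>" by (auto simp: root_string_def K_def)
  have real: "?e k \<in> real_roots D G" if "k \<in> K - I" for k
    using that by (auto simp: K_def I_def imaginary_roots_def)
  have "\<forall>k\<in>K. c - k \<in> K" "\<forall>a\<in>I. \<forall>k\<in>K. \<bar>2 * k - c\<bar> \<le> \<bar>2 * a - c\<bar> \<longrightarrow> k \<in> I"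
    using sym conv by blast+
  from symmetric_string_pattern[OF fin IK this] obtain p q r :: nat and ks where ks: "sorted_wrt (<) ks" "set ks = K" "length ks = p + q + r"
    "\<forall>i<p. ks ! i \<in> K - I" "\<forall>i\<in>{p..<p + q}. ks ! i \<in> I" "\<forall>i\<in>{p + q..<p + q + r}. ks ! i \<in> K - I"
    "q \<noteq> 0 \<longrightarrow> p = r"
    by blast
  then show ?thesis
    using real img by (intro exI[of _ p] exI[of _ q] exI[of _ r] exI[of _ ks]) (auto simp: I_def)
qed

end
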